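(* Each $(\boldsymbol\omega,\mathbf{A})\in\mathcal{P}_5$ has exactly $N-2$ eigenvalues, each $(\boldsymbol\omega,\mathbf{A})\in\mathcal{P}\setminus\mathcal{P}_5$ has exactly $N-1$ eigenvalues, and each $(\boldsymbol\omega,\mathbf{A})\in(\Omega_N^{\mathbb{R},+}\times\mathcal{B}^{\mathbb{C}})\setminus\mathcal{P}$ has exactly $N$ eigenvalues, and the functions $\lambda_n$, $0\le n\le N-1$, are continuous in $(\Omega_N^{\mathbb{R},+}\times\mathcal{B}^{\mathbb{C}})\setminus\mathcal{P}$ and not continuous at each point of $\mathcal{P}$.
   Context: Fix an integer $N\ge 2$. A self-adjoint discrete Sturm–Liouville problem is a pair $(\boldsymbol\omega,\mathbf{A})$. Here $\boldsymbol\omega=(1/f,q,w)$ with real sequences $f=\{f_n\}_{n=0}^N$, $q=\{q_n\}_{n=1}^N$, $w=\{w_n\}_{n=1}^N$, $f_n\ne0$, $w_n>0$, encodes the equation $-\nabla(f_n\Delta y_n)+q_ny_n=\lambda w_ny_n$, $1\le n\le N$, for $y=(y_0,\dots,y_{N+1})$, with $\Delta y_n=y_{n+1}-y_n$, $\nabla y_n=y_n-y_{n-1}$; the set $\Omega_N^{\mathbb{R},+}$ of all such $(1/f,q,w)$ has the topology of a subset of $\mathbb{R}^{3N+1}$. $\mathbf{A}=[A\,|\,B]$ encodes the boundary condition $A\begin{pmatrix}y_0\\ f_0\Delta y_0\end{pmatrix}+B\begin{pmatrix}y_N\\ f_N\Delta y_N\end{pmatrix}=0$, where $A,B$ are complex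 $2\times2$ matrices with $\mathrm{rank}(A,B)=2$ and $AJA^*=BJB^*$, $J=\begin{pmatrix}0&1\\-1&0\end{pmatrix}$; $[A\,|\,B]$ is the class of the $2\times4$ matrix $(A,B)$ modulo left multiplication by $GL(2,\mathbb{C})$, and $\mathcal{B}^{\mathbb{C}}$ is the set of all such classes, topologized as a subspace of the quotient of the rank-2 complex $2\times4$ matrices by $GL(2,\mathbb{C})$. $\Omega_N^{\mathbb{R},+}\times\mathcal{B}^{\mathbb{C}}$ has the product topology. An eigenvalue of $(\boldsymbol\omega,\mathbf{A})$ is a $\lambda$ for which a nonzero $y$ solves the equation and the boundary condition. Eigenvalues are real and finite in number; they are counted with multiplicity (the dimension of the solution space) and listed as $\lambda_0\le\lambda_1\le\cdots$; $\lambda_n$ is defined at a problem only if it has more than $n$ eigenvalues, and $\lambda_n$ is regarded as not continuous at a point where it is not defined. $\mathcal{B}^{\mathbb{C}}$ is the union of the four open sets (with real $a_{ij},b_{ij}$ and $z\in\mathbb{C}$) $\mathcal{O}_{1,3}^{\mathbb{C}}=\left\{\left[\begin{array}{cccc}1&a_{12}&0&\bar z\\0&z&-1&b_{22}\end{array}\right]\right\}$, $\mathcal{O}_{1,4}^{\mathbb{C}}=\left\{\left[\begin{array}{cccc}1&a_{12}&\bar z&0\\0&z&b_{21}&1\end{array}\right]\right\}$, $\mathcal{O}_{2,3}^{\mathbb{C}}=\left\{\left[\begin{array}{cccc}a_{11}&-1&0&\bar z\\ z&0&-1&b_{22}\end{array}\right]\right\}$, $\mathcal{O}_{2,4}^{\mathbb{C}}=\left\{\left[\begin{array}{cccc}a_{11}&-1&\bar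 z&0\\ z&0&b_{21}&1\end{array}\right]\right\}$. Put $\mathcal{P}_{1,4}=\{(\boldsymbol\omega,\mathbf{A}):\mathbf{A}\in\mathcal{O}_{1,4}^{\mathbb{C}},\ a_{12}=1/f_0\}$, $\mathcal{P}_{2,4}=\{(\boldsymbol\omega,\mathbf{A}):\mathbf{A}\in\mathcal{O}_{2,4}^{\mathbb{C}},\ a_{11}=-f_0\}$, $\mathcal{P}_{1,3}=\{(\boldsymbol\omega,\mathbf{A}):\mathbf{A}\in\mathcal{O}_{1,3}^{\mathbb{C}},\ (a_{12}-1/f_0)b_{22}=|z|^2\}$, $\mathcal{P}_{2,3}=\{(\boldsymbol\omega,\mathbf{A}):\mathbf{A}\in\mathcal{O}_{2,3}^{\mathbb{C}},\ (a_{11}+f_0)b_{22}=|z|^2\}$ (always $\boldsymbol\omega\in\Omega_N^{\mathbb{R},+}$), $\mathcal{P}=\mathcal{P}_{1,3}\cup\mathcal{P}_{1,4}\cup\mathcal{P}_{2,3}\cup\mathcal{P}_{2,4}$, and $\mathcal{P}_5=\left\{(\boldsymbol\omega,\mathbf{A}):\mathbf{A}=\left[\begin{array}{cccc}1&1/f_0&0&0\\0&0&1&0\end{array}\right]\right\}$.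
   Formalization: Discontinuity of λ_n at a point of P is claimed except when n>0, λ_n is defined there and λ_{n-1}=λ_n at that point; in that case λ_n is in fact continuous (e.g. N=3, f=w=1, q=0, A=[1 1 1 0; 0 1 2 1], n=1), so the literal claim fails. *)

theory Defs
  imports "HOL-Analysis.Analysis" "HOL-Library.Function_Algebras"
begin

text \<open>An equation is the triple \<open>(1/f, q, w)\<close>, with index ranges \<open>0..N\<close>, \<open>1..N\<close>, \<open>1..N\<close>.
  Sequences are extensional functions, so that the product topologies below make the space of
  all triples a copy of \<open>\<real>\<^sup>3\<^sup>N\<^sup>+\<^sup>1\<close>.\<close>

type_synonym equation = "(nat \<Rightarrow> real) \<times> (nat \<Rightarrow> real) \<times> (nat \<Rightarrow> real)"

definition f_of :: "equation \<Rightarrow> nat \<Rightarrow> real" where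
  "f_of \<omega> n = 1 / fst \<omega> n"

definition q_of :: "equation \<Rightarrow> nat \<Rightarrow> real" where
  "q_of \<omega> = fst (snd \<omega>)"

definition w_of :: "equation \<Rightarrow> nat \<Rightarrow> real" where
  "w_of \<omega> = snd (snd \<omega>)"

definition Omega :: "nat \<Rightarrow> equation set" where
  "Omega N = ({0..N} \<rightarrow>\<^sub>E (UNIV - {0})) \<times> ({1..N} \<rightarrow>\<^sub>E UNIV) \<times> ({1..N} \<rightarrow>\<^sub>E {0<..})"

definition Omega_topology :: "nat \<Rightarrow> equation topology" where
  "Omega_topology N =
     subtopology
       (prod_topology (product_topology (\<lambda>_. euclideanreal) {0..N})
         (prod_topology (product_topology (\<lambda>_. euclideanreal) {1..N})
                        (product_topology (\<lambda>_. euclideanreal) {1..N})))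
       (Omega N)"

lemma topspace_Omega_topology: "topspace (Omega_topology N) = Omega N"
  by (auto simp: Omega_topology_def Omega_def PiE_iff)

definition augment :: "complex^2^2 \<Rightarrow> complex^2^2 \<Rightarrow> complex^4^2" where
  "augment A B = (\<chi> i. vector [A$i$1, A$i$2, B$i$1, B$i$2])"

definition adjoint_matrix :: "complex^2^2 \<Rightarrow> complex^2^2" where
  "adjoint_matrix A = (\<chi> i j. cnj (A$j$i))"

definition J_mat :: "complex^2^2" where
  "J_mat = vector [vector [0, 1], vector [-1, 0]]"

definition bc_class :: "complex^4^2 \<Rightarrow> (complex^4^2) set" where
  "bc_class M = {T ** M | T :: complex^2^2. invertible T}"

definition rank2 :: "(complex^4^2) set" where
  "rank2 = {M. rank M = 2}"

definition quotient_topology :: "(complex^4^2) set topology" where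
  "quotient_topology =
     topology (\<lambda>U. U \<subseteq> bc_class ` rank2 \<and> openin (top_of_set rank2) {M \<in> rank2. bc_class M \<in> U})"

definition BC :: "(complex^4^2) set set" where
  "BC = {bc_class (augment A B) | A B.
           rank (augment A B) = 2 \<and>
           A ** J_mat ** adjoint_matrix A = B ** J_mat ** adjoint_matrix B}"

definition BC_topology :: "(complex^4^2) set topology" where
  "BC_topology = subtopology quotient_topology BC"

lemma openin_quotient_topology:
  "openin quotient_topology U \<longleftrightarrow>
     U \<subseteq> bc_class ` rank2 \<and> openin (top_of_set rank2) {M \<in> rank2. bc_class M \<in> U}"
proof -
  have "istopology (\<lambda>U. U \<subseteq> bc_class ` rank2 \<and>
          openin (top_of_set rank2) {M \<in> rank2. bc_class M \<in> U})"
    unfolding istopology_def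
  proof (intro conjI allI impI)
    fix S T
    assume "S \<subseteq> bc_class ` rank2 \<and> openin (top_of_set rank2) {M \<in> rank2. bc_class M \<in> S}"
      "T \<subseteq> bc_class ` rank2 \<and> openin (top_of_set rank2) {M \<in> rank2. bc_class M \<in> T}"
    moreover have "{M \<in> rank2. bc_class M \<in> S \<inter> T} =
        {M \<in> rank2. bc_class M \<in> S} \<inter> {M \<in> rank2. bc_class M \<in> T}"
      by auto
    ultimately show "S \<inter> T \<subseteq> bc_class ` rank2"
      "openin (top_of_set rank2) {M \<in> rank2. bc_class M \<in> S \<inter> T}"
      by (auto intro: openin_Int)
  next
    fix K
    assume K: "\<forall>S\<in>K. S \<subseteq> bc_class ` rank2 \<and>
        openin (top_of_set rank2) {M \<in> rank2. bc_class M \<in> S}"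
    then show "\<Union> K \<subseteq> bc_class ` rank2"
      by blast
    have "{M \<in> rank2. bc_class M \<in> \<Union> K} = (\<Union>S\<in>K. {M \<in> rank2. bc_class M \<in> S})"
      by auto
    then show "openin (top_of_set rank2) {M \<in> rank2. bc_class M \<in> \<Union> K}"
      using K by (auto intro!: openin_Union)
  qed
  then show ?thesis
    by (simp add: quotient_topology_def topology_inverse')
qed

lemma topspace_quotient_topology: "topspace quotient_topology = bc_class ` rank2"
proof
  show "topspace quotient_topology \<subseteq> bc_class ` rank2"
    using openin_quotient_topology openin_topspace by blast
  have "{M \<in> rank2. bc_class M \<in> bc_class ` rank2} = rank2"
    by auto
  then have "openin quotient_topology (bc_class ` rank2)"
    by (simp add: openin_quotient_topology)
  then show "bc_class ` rank2 \<subseteq> topspace quotient_topology"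
    by (rule openin_subset)
qed

lemma quotient_map_bc_class: "quotient_map (top_of_set rank2) quotient_topology bc_class"
  by (auto simp: quotient_map_def topspace_quotient_topology openin_quotient_topology)

lemma topspace_BC_topology: "topspace BC_topology = BC"
  by (auto simp: BC_topology_def topspace_quotient_topology BC_def rank2_def)

type_synonym problem = "equation \<times> (complex^4^2) set"

definition SL_problems :: "nat \<Rightarrow> problem set" where
  "SL_problems N = Omega N \<times> BC"

definition SL_topology :: "nat \<Rightarrow> problem topology" where
  "SL_topology N = prod_topology (Omega_topology N) BC_topology"

lemma topspace_SL_topology: "topspace (SL_topology N) = SL_problems N"
  by (simp add: SL_topology_def SL_problems_def topspace_Omega_topology topspace_BC_topology)

definition fdiff :: "(nat \<Rightarrow> complex) \<Rightarrow> nat \<Rightarrow> complex" where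
  "fdiff y n = y (n + 1) - y n"

definition bdiff :: "(nat \<Rightarrow> complex) \<Rightarrow> nat \<Rightarrow> complex" where
  "bdiff y n = y n - y (n - 1)"

definition quasi_diff :: "equation \<Rightarrow> (nat \<Rightarrow> complex) \<Rightarrow> nat \<Rightarrow> complex" where
  "quasi_diff \<omega> y n = of_real (f_of \<omega> n) * fdiff y n"

definition satisfies_equation ::
  "nat \<Rightarrow> equation \<Rightarrow> complex \<Rightarrow> (nat \<Rightarrow> complex) \<Rightarrow> bool" where
  "satisfies_equation N \<omega> l y \<longleftrightarrow>
     (\<forall>n\<in>{1..N}. - bdiff (quasi_diff \<omega> y) n + of_real (q_of \<omega> n) * y n
                  = l * of_real (w_of \<omega> n) * y n)"

text \<open>The condition does not depend on the representative \<open>(A, B)\<close> of the class; see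
  \<open>satisfies_bc_bc_class\<close> below.\<close>

definition satisfies_bc ::
  "nat \<Rightarrow> equation \<Rightarrow> (complex^4^2) set \<Rightarrow> (nat \<Rightarrow> complex) \<Rightarrow> bool" where
  "satisfies_bc N \<omega> C y \<longleftrightarrow>
     (\<exists>A B. augment A B \<in> C \<and>
        A *v vector [y 0, quasi_diff \<omega> y 0] + B *v vector [y N, quasi_diff \<omega> y N] = 0)"

text \<open>A tuple \<open>(y\<^sub>0, \<dots>, y\<^sub>N\<^sub>+\<^sub>1)\<close> is represented by the sequence extending it by zero.\<close>

definition solutions :: "nat \<Rightarrow> problem \<Rightarrow> complex \<Rightarrow> (nat \<Rightarrow> complex) set" where
  "solutions N p l =
     {y. (\<forall>n > N + 1. y n = 0) \<and> satisfies_equation N (fst p) l y \<and> satisfies_bc N (fst p) (snd p) y}"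

interpretation cseq: vector_space "\<lambda>(c::complex) (y::nat \<Rightarrow> complex) n. c * y n"
  by unfold_locales (auto simp: fun_eq_iff algebra_simps)

definition eigenvalues :: "nat \<Rightarrow> problem \<Rightarrow> complex set" where
  "eigenvalues N p = {l. \<exists>y\<in>solutions N p l. y \<noteq> 0}"

definition eig_multiplicity :: "nat \<Rightarrow> problem \<Rightarrow> complex \<Rightarrow> nat" where
  "eig_multiplicity N p l = cseq.dim (solutions N p l)"

definition num_eigenvalues :: "nat \<Rightarrow> problem \<Rightarrow> nat" where
  "num_eigenvalues N p = (\<Sum>l\<in>eigenvalues N p. eig_multiplicity N p l)"

definition has_exactly :: "nat \<Rightarrow> problem \<Rightarrow> nat \<Rightarrow> bool" where
  "has_exactly N p k \<longleftrightarrow> finite (eigenvalues N p) \<and> num_eigenvalues N p = k"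

text \<open>All eigenvalues are real, so \<open>Re\<close> only changes the type.\<close>

definition eigenvalue_list :: "nat \<Rightarrow> problem \<Rightarrow> real list" where
  "eigenvalue_list N p =
     sorted_list_of_multiset (\<Sum>l\<in>eigenvalues N p. replicate_mset (eig_multiplicity N p l) (Re l))"

text \<open>Meaningful only for \<open>n < num_eigenvalues N p\<close>.\<close>

definition nth_eigenvalue :: "nat \<Rightarrow> nat \<Rightarrow> problem \<Rightarrow> real" where
  "nth_eigenvalue N n p = eigenvalue_list N p ! n"

text \<open>The domain of \<open>\<lambda>\<^sub>n\<close> is the set of problems with more than \<open>n\<close> eigenvalues. By definition,
  \<^const>\<open>topcontinuous_at\<close> fails at points outside the topological space, that is, at points where
  \<open>\<lambda>\<^sub>n\<close> is not defined.\<close>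

definition eigenvalue_continuous_at :: "nat \<Rightarrow> nat \<Rightarrow> problem \<Rightarrow> bool" where
  "eigenvalue_continuous_at N n p \<longleftrightarrow>
     topcontinuous_at (subtopology (SL_topology N) {p'. n < num_eigenvalues N p'})
       euclideanreal (nth_eigenvalue N n) p"

definition O13 :: "real \<Rightarrow> real \<Rightarrow> complex \<Rightarrow> (complex^4^2) set" where
  "O13 a12 b22 z = bc_class (vector [vector [1, of_real a12, 0, cnj z],
                                     vector [0, z, -1, of_real b22]])"

definition O14 :: "real \<Rightarrow> real \<Rightarrow> complex \<Rightarrow> (complex^4^2) set" where
  "O14 a12 b21 z = bc_class (vector [vector [1, of_real a12, cnj z, 0],
                                     vector [0, z, of_real b21, 1]])"

definition O23 :: "real \<Rightarrow> real \<Rightarrow> complex \<Rightarrow> (complex^4^2) set" where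
  "O23 a11 b22 z = bc_class (vector [vector [of_real a11, -1, 0, cnj z],
                                     vector [z, 0, -1, of_real b22]])"

definition O24 :: "real \<Rightarrow> real \<Rightarrow> complex \<Rightarrow> (complex^4^2) set" where
  "O24 a11 b21 z = bc_class (vector [vector [of_real a11, -1, cnj z, 0],
                                     vector [z, 0, of_real b21, 1]])"

definition P13 :: "nat \<Rightarrow> problem set" where
  "P13 N = {(\<omega>, O13 a12 b22 z) | \<omega> a12 b22 z.
              \<omega> \<in> Omega N \<and> (a12 - 1 / f_of \<omega> 0) * b22 = (cmod z)\<^sup>2}"

definition P14 :: "nat \<Rightarrow> problem set" where
  "P14 N = {(\<omega>, O14 a12 b21 z) | \<omega> a12 b21 z. \<omega> \<in> Omega N \<and> a12 = 1 / f_of \<omega> 0}"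

definition P23 :: "nat \<Rightarrow> problem set" where
  "P23 N = {(\<omega>, O23 a11 b22 z) | \<omega> a11 b22 z.
              \<omega> \<in> Omega N \<and> (a11 + f_of \<omega> 0) * b22 = (cmod z)\<^sup>2}"

definition P24 :: "nat \<Rightarrow> problem set" where
  "P24 N = {(\<omega>, O24 a11 b21 z) | \<omega> a11 b21 z. \<omega> \<in> Omega N \<and> a11 = - f_of \<omega> 0}"

definition P_exc :: "nat \<Rightarrow> problem set" where
  "P_exc N = P13 N \<union> P14 N \<union> P23 N \<union> P24 N"

definition P5 :: "nat \<Rightarrow> problem set" where
  "P5 N = {(\<omega>, bc_class (vector [vector [1, of_real (1 / f_of \<omega> 0), 0, 0],
                                 vector [0, 0, 1, 0]])) | \<omega>. \<omega> \<in> Omega N}"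

lemma vector_4 [simp]:
  "(vector [a,b,c,d] :: ('a::zero)^4) $ 1 = a"
  "(vector [a,b,c,d] :: ('a::zero)^4) $ 2 = b"
  "(vector [a,b,c,d] :: ('a::zero)^4) $ 3 = c"
  "(vector [a,b,c,d] :: ('a::zero)^4) $ 4 = d"
  unfolding vector_def by simp_all

lemma augment_mult: "T ** augment A B = augment (T ** A) (T ** B)"
  by (simp add: vec_eq_iff augment_def matrix_matrix_mult_def forall_2 forall_4 sum_2)

lemma augment_eq_iff: "augment A B = augment C D \<longleftrightarrow> A = C \<and> B = D"
  by (auto simp: vec_eq_iff augment_def forall_2 forall_4)

lemma satisfies_bc_bc_class:
  "satisfies_bc N \<omega> (bc_class (augment A B)) y \<longleftrightarrow>
     A *v vector [y 0, quasi_diff \<omega> y 0] + B *v vector [y N, quasi_diff \<omega> y N] = 0"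
  (is "?L \<longleftrightarrow> A *v ?u + B *v ?v = 0")
proof
  assume ?L
  then obtain T :: "complex^2^2" where T: "invertible T" and eq: "(T ** A) *v ?u + (T ** B) *v ?v = 0"
    unfolding satisfies_bc_def bc_class_def mem_Collect_eq augment_mult augment_eq_iff by blast
  obtain S where S: "S ** T = mat 1"
    using T by (auto simp: invertible_def)
  have "T *v (A *v ?u + B *v ?v) = 0"
    using eq by (simp add: matrix_vector_mul_assoc matrix_vector_right_distrib)
  then have "S *v (T *v (A *v ?u + B *v ?v)) = 0"
    by (simp only: matrix_vector_mult_0_right)
  then show "A *v ?u + B *v ?v = 0"
    by (simp only: matrix_vector_mul_assoc[of S T] S matrix_vector_mul_lid)
next
  have "augment A B \<in> bc_class (augment A B)"
    unfolding bc_class_def by (rule CollectI, rule exI[of _ "mat 1"]) (auto simp: invertible_def)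
  then show "A *v ?u + B *v ?v = 0 \<Longrightarrow> ?L"
    by (auto simp: satisfies_bc_def)
qed

lemma subspace_solutions:
  assumes "C \<in> BC"
  shows "cseq.subspace (solutions N (\<omega>, C) l)"
proof -
  obtain A B where C: "C = bc_class (augment A B)"
    using assms by (auto simp: BC_def)
  have q: "quasi_diff \<omega> 0 n = 0"
    "quasi_diff \<omega> (x + y) n = quasi_diff \<omega> x n + quasi_diff \<omega> y n"
    "quasi_diff \<omega> (\<lambda>n. c * x n) n = c * quasi_diff \<omega> x n" for x y c n
    by (simp_all add: quasi_diff_def fdiff_def algebra_simps)
  have eq: "satisfies_equation N \<omega> l 0"
    "satisfies_equation N \<omega> l x \<Longrightarrow> satisfies_equation N \<omega> l y \<Longrightarrow> satisfies_equation N \<omega> l (x + y)"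
    "satisfies_equation N \<omega> l x \<Longrightarrow> satisfies_equation N \<omega> l (\<lambda>n. c * x n)" for x y c
  proof -
    show "satisfies_equation N \<omega> l 0"
      by (simp add: satisfies_equation_def bdiff_def q)
    assume x: "satisfies_equation N \<omega> l x"
    show "satisfies_equation N \<omega> l (\<lambda>n. c * x n)"
      unfolding satisfies_equation_def
    proof
      fix n assume "n \<in> {1..N}"
      with x have "- bdiff (quasi_diff \<omega> x) n + of_real (q_of \<omega> n) * x n
          = l * of_real (w_of \<omega> n) * x n"
        by (auto simp: satisfies_equation_def)
      from arg_cong[OF this, of "(*) c"]
      show "- bdiff (quasi_diff \<omega> (\<lambda>n. c * x n)) n + of_real (q_of \<omega> n) * (c * x n)
          = l * of_real (w_of \<omega> n) * (c * x n)"
        by (simp add: bdiff_def q algebra_simps)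
    qed
    assume y: "satisfies_equation N \<omega> l y"
    show "satisfies_equation N \<omega> l (x + y)"
      using x y by (simp add: satisfies_equation_def bdiff_def q algebra_simps)
  qed
  let ?bc = "\<lambda>y. A *v vector [y 0, quasi_diff \<omega> y 0] + B *v vector [y N, quasi_diff \<omega> y N]"
  have add: "?bc (x + y) = ?bc x + ?bc y" and scale: "?bc (\<lambda>n. c * x n) = c *s ?bc x"
    and zero: "?bc 0 = 0" for x y c
    by (simp_all add: vec_eq_iff forall_2 matrix_vector_mult_def sum_2 q algebra_simps)
  have mem: "y \<in> solutions N (\<omega>, C) l \<longleftrightarrow>
      (\<forall>n > N + 1. y n = 0) \<and> satisfies_equation N \<omega> l y \<and> ?bc y = 0" for y
    unfolding solutions_def C mem_Collect_eq fst_conv snd_conv satisfies_bc_bc_class ..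
  show ?thesis
  proof (rule cseq.subspaceI)
    show "0 \<in> solutions N (\<omega>, C) l"
      unfolding mem using eq(1) zero by simp
  next
    fix x y assume "x \<in> solutions N (\<omega>, C) l" "y \<in> solutions N (\<omega>, C) l"
    then show "x + y \<in> solutions N (\<omega>, C) l"
      unfolding mem add using eq(2)[of x y] by simp
  next
    fix c x assume "x \<in> solutions N (\<omega>, C) l"
    then show "(\<lambda>n. c * x n) \<in> solutions N (\<omega>, C) l"
      unfolding mem scale using eq(3)[of x c] by simp
  qed
qed

lemma rank_two:
  fixes M :: "complex^4^2"
  assumes "\<And>c d. c *s M$1 + d *s M$2 = 0 \<Longrightarrow> c = 0 \<and> d = 0"
  shows "rank M = 2"
proof -
  have ne: "M$1 \<noteq> M$2"
    using assms[of 1 "-1"] by (auto simp: vec_eq_iff)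
  have "M$2 \<noteq> 0"
    using assms[of 0 1] by (auto simp: vec_eq_iff)
  moreover have "M$1 \<notin> vec.span {M$2}"
  proof
    assume "M$1 \<in> vec.span {M$2}"
    then obtain k where "M$1 = k *s M$2"
      by (auto simp: vec.span_singleton)
    then show False
      using assms[of 1 "-k"] by (auto simp: vec_eq_iff)
  qed
  ultimately have "vec.independent {M$1, M$2}"
    using ne by (simp add: vec.independent_insert)
  then have "vec.dim {M$1, M$2} = 2"
    using ne by (simp add: vec.dim_eq_card_independent)
  moreover have "rows M = {M$1, M$2}"
    by (auto simp: rows_def row_def) (metis exhaust_2)
  ultimately show ?thesis
    by (simp add: row_rank_def_gen)
qed

lemma bc_classI:
  assumes "\<And>c d. c *s M$1 + d *s M$2 = 0 \<Longrightarrow> c = 0 \<and> d = 0"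
    and "M = augment A B"
    and "A ** J_mat ** adjoint_matrix A = B ** J_mat ** adjoint_matrix B"
  shows "bc_class M \<in> BC"
  using rank_two[OF assms(1)] assms(2,3) by (auto simp: BC_def)

lemma charts_in_BC: "O13 a b z \<in> BC" "O14 a b z \<in> BC" "O23 a b z \<in> BC" "O24 a b z \<in> BC"
proof -
  note defs = augment_def adjoint_matrix_def J_mat_def vec_eq_iff forall_2 forall_4
    matrix_matrix_mult_def sum_2
  show "O13 a b z \<in> BC" unfolding O13_def
    by (rule bc_classI[where A = "vector [vector [1, of_real a], vector [0, z]]"
          and B = "vector [vector [0, cnj z], vector [-1, of_real b]]"]) (auto simp: defs)
  show "O14 a b z \<in> BC" unfolding O14_def
    by (rule bc_classI[where A = "vector [vector [1, of_real a], vector [0, z]]"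
          and B = "vector [vector [cnj z, 0], vector [of_real b, 1]]"]) (auto simp: defs)
  show "O23 a b z \<in> BC" unfolding O23_def
    by (rule bc_classI[where A = "vector [vector [of_real a, -1], vector [z, 0]]"
          and B = "vector [vector [0, cnj z], vector [-1, of_real b]]"]) (auto simp: defs)
  show "O24 a b z \<in> BC" unfolding O24_def
    by (rule bc_classI[where A = "vector [vector [of_real a, -1], vector [z, 0]]"
          and B = "vector [vector [cnj z, 0], vector [of_real b, 1]]"]) (auto simp: defs)
qed

lemma P_exc_subset: "P_exc N \<subseteq> SL_problems N"
  by (auto simp: P_exc_def P13_def P14_def P23_def P24_def SL_problems_def charts_in_BC)

lemma P5_subset: "P5 N \<subseteq> P_exc N"
proof -
  have "bc_class (vector [vector [1, of_real r, 0, 0], vector [0, 0, 1, 0]]) = O13 r 0 0"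
    (is "bc_class ?M = _") for r
  proof -
    let ?D = "vector [vector [1, 0], vector [0, -1]] :: complex^2^2"
    let ?M' = "vector [vector [1, of_real r, 0, cnj 0], vector [0, 0, -1, of_real 0]] :: complex^4^2"
    have DD: "?D ** ?D = mat 1" and M: "?M = ?D ** ?M'" "?M' = ?D ** ?M"
      by (simp_all add: vec_eq_iff forall_2 forall_4 matrix_matrix_mult_def sum_2 mat_def)
    have inv: "invertible ?D"
      using DD by (auto simp: invertible_def)
    have "bc_class (?D ** X) \<subseteq> bc_class X" for X
      unfolding bc_class_def by (auto simp: matrix_mul_assoc intro: invertible_mult inv)
    from this[of ?M] this[of ?M'] show ?thesis
      unfolding O13_def M(1)[symmetric] M(2)[symmetric] by blast
  qed
  then have "P5 N \<subseteq> P13 N"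
    unfolding P5_def P13_def by (fastforce simp del: of_real_divide)
  then show ?thesis
    by (auto simp: P_exc_def)
qed

end

theory Submission
  imports Defs
begin

text \<open>Eliminate \<open>y\<^sub>0\<close> and \<open>y\<^sub>N\<^sub>+\<^sub>1\<close>: with \<open>a = (y\<^sub>1, y\<^sub>N)\<close> and \<open>b = (f\<^sub>0 \<Delta>y\<^sub>0, - f\<^sub>N \<Delta>y\<^sub>N)\<close> the
  boundary condition becomes \<open>X a + Y b = 0\<close>, a Lagrangian plane. It can be normalised to
  \<open>a \<in> K\<close>, \<open>b - S a \<in> K\<^sup>\<bottom>\<close> for a subspace \<open>K\<close> of \<open>\<complex>\<^sup>2\<close> and a Hermitian \<open>S\<close>, and then the problem
  is the eigenvalue problem of a Hermitian pencil (a Jacobi matrix plus the corner entries \<open>S\<close>,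
  against the diagonal weight) on the vectors with \<open>a \<in> K\<close>. So there are \<open>N - codim K\<close>
  eigenvalues; \<open>\<P>\<close> is the set where \<open>K\<close> is proper, that is \<open>det Y = 0\<close>, and \<open>\<P>\<^sub>5\<close> the set where
  \<open>K = 0\<close>, that is \<open>Y = 0\<close>. Off \<open>\<P>\<close> one has \<open>S = - Y\<^sup>-\<^sup>1 X\<close>, which depends continuously on the
  problem, and the minimax principle makes the \<open>\<lambda>\<^sub>n\<close> continuous. At a point of \<open>\<P>\<close>, replacing the
  constraint \<open>a \<in> K\<close> by a penalty \<open>- 1/\<epsilon>\<close> on \<open>K\<^sup>\<bottom>\<close> gives problems off \<open>\<P>\<close> that converge to
  the given one as \<open>\<epsilon> \<rightarrow> 0+\<close>, with an additional eigenvalue tending to \<open>- \<infinity>\<close>; hence \<open>\<lambda>\<^sub>n\<close> is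
  pushed down to at most \<open>\<lambda>\<^sub>n\<^sub>-\<^sub>1\<close> of the limit.\<close>

section \<open>Hermitian forms on finite sequences\<close>

text \<open>The unknowns \<open>a\<close>, \<open>b\<close> are chosen because only
  \<open>y_1, ..., y_N\<close> carry a weight: a form that kept \<open>y_0\<close> or
  \<open>y_{N+1}\<close> would be degenerate on the weight side. Since
  \<open>y_1 = y_0 + (1/f_0) (f_0 \<Delta>y_0)\<close>, passing from \<open>y_0\<close> to
  \<open>y_1\<close> is a column operation with factor \<open>1/f_0\<close>; this is the origin of
  the numbers \<open>1/f_0\<close> and \<open>-f_0\<close> in the four charts.

  The \<open>f_n\<close> may have either sign, so the stiffness form is indefinite in general and
  only the weight is positive. Estimates are therefore made on \<open>H - c W\<close> at a fixed
  level \<open>c\<close>: "\<open>\<lambda>_n\<close> lies below \<open>c\<close>" becomes a sign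
  condition on a subspace, and perturbations of \<open>H\<close> and \<open>W\<close> are measured
  together by one matrix norm.

  The penalty pushes \<open>\<lambda>_n\<close> only below those \<open>c\<close> that exceed
  \<open>\<lambda>_{n-1}\<close> of the limit problem. This contradicts continuity as soon as such a
  \<open>c\<close> can be taken below \<open>\<lambda>_n\<close> of the limit, that is, for
  \<open>n = 0\<close> or \<open>\<lambda>_{n-1} < \<lambda>_n\<close> there. Hence the last claim
  sets aside the points of coincidence \<open>\<lambda>_{n-1} = \<lambda>_n\<close>, where this
  argument finds no jump.\<close>

definition supp_space :: "nat \<Rightarrow> (nat \<Rightarrow> complex) set" where
  "supp_space N = {x. \<forall>n. n \<notin> {1..N} \<longrightarrow> x n = 0}"

definition form :: "nat \<Rightarrow> (nat \<Rightarrow> nat \<Rightarrow> complex) \<Rightarrow> (nat \<Rightarrow> complex) \<Rightarrow> (nat \<Rightarrow> complex) \<Rightarrow> complex" where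
  "form N H x y = (\<Sum>i=1..N. \<Sum>j=1..N. H i j * x j * cnj (y i))"

definition hermitian :: "nat \<Rightarrow> (nat \<Rightarrow> nat \<Rightarrow> complex) \<Rightarrow> bool" where
  "hermitian N H \<longleftrightarrow> (\<forall>i\<in>{1..N}. \<forall>j\<in>{1..N}. H j i = cnj (H i j))"

definition positive_form :: "nat \<Rightarrow> (nat \<Rightarrow> nat \<Rightarrow> complex) \<Rightarrow> bool" where
  "positive_form N W \<longleftrightarrow> (\<forall>x\<in>supp_space N. x \<noteq> 0 \<longrightarrow> 0 < Re (form N W x x))"

lemma sum_fun_apply: "sum f A n = (\<Sum>a\<in>A. f a n)"
  for f :: "'a \<Rightarrow> nat \<Rightarrow> complex"
  by (induction A rule: infinite_finite_induct) auto

lemma subspace_supp_space: "cseq.subspace (supp_space N)"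
  by (auto simp: cseq.subspace_def supp_space_def)

lemma supp_space_subset_span:
  "supp_space N \<subseteq> cseq.span ((\<lambda>k n. if n = k then 1 else 0) ` {1..N})"
proof
  fix x assume "x \<in> supp_space N"
  then have "x = (\<Sum>k\<in>{1..N}. (\<lambda>n. x k * (if n = k then 1 else 0)))"
    by (auto simp: fun_eq_iff sum_fun_apply supp_space_def if_distrib cong: if_cong)
  also have "\<dots> \<in> cseq.span ((\<lambda>k n. if n = k then 1 else 0) ` {1..N})"
    by (intro cseq.span_sum cseq.span_scale cseq.span_base) auto
  finally show "x \<in> cseq.span ((\<lambda>k n. if n = k then 1 else 0) ` {1..N})" .
qed

lemma finite_independent:
  assumes "cseq.independent B" "B \<subseteq> supp_space N"
  shows "finite B"
proof -
  have "B \<subseteq> cseq.span ((\<lambda>k n. if n = k then 1 else 0) ` {1..N})"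
    using assms(2) supp_space_subset_span[of N] by auto
  from cseq.independent_span_bound[OF _ assms(1) this] show ?thesis
    by auto
qed

lemma subspace_combine:
  "cseq.subspace V \<Longrightarrow> x \<in> V \<Longrightarrow> y \<in> V \<Longrightarrow> x + (\<lambda>n. c * y n) \<in> V"
  by (intro cseq.subspace_add cseq.subspace_scale)

lemma form_add_left: "form N H (x + y) z = form N H x z + form N H y z"
  by (simp add: form_def algebra_simps sum.distrib)

lemma form_add_right: "form N H x (y + z) = form N H x y + form N H x z"
  by (simp add: form_def algebra_simps sum.distrib)

lemma form_scale_left: "form N H (\<lambda>n. c * x n) z = c * form N H x z"
  by (simp add: form_def algebra_simps sum_distrib_left)

lemma form_scale_right: "form N H x (\<lambda>n. c * z n) = cnj c * form N H x z"
  by (simp add: form_def algebra_simps sum_distrib_left)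

lemma form_zero_left [simp]: "form N H 0 z = 0"
  by (simp add: form_def)

lemma form_sum_left: "form N H (\<Sum>k\<in>K. f k) z = (\<Sum>k\<in>K. form N H (f k) z)"
  by (induction K rule: infinite_finite_induct)
    (simp_all only: sum.infinite sum.empty sum.insert form_add_left form_zero_left not_False_eq_True)

lemma form_combine:
  "form N (\<lambda>i j. H i j - c * W i j) x z = form N H x z - c * form N W x z"
proof -
  have "form N (\<lambda>i j. H i j - c * W i j) x z =
      (\<Sum>i=1..N. \<Sum>j=1..N. H i j * x j * cnj (z i) - c * (W i j * x j * cnj (z i)))"
    unfolding form_def by (intro sum.cong refl) (simp add: left_diff_distrib)
  also have "\<dots> = form N H x z - c * form N W x z"
    unfolding form_def sum_subtractf by (simp add: sum_distrib_left)
  finally show ?thesis .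
qed

lemma hermitianD:
  "hermitian N H \<Longrightarrow> i \<in> {1..N} \<Longrightarrow> j \<in> {1..N} \<Longrightarrow> H j i = cnj (H i j)"
  unfolding hermitian_def by blast

lemma form_cnj:
  assumes "hermitian N H"
  shows "form N H y x = cnj (form N H x y)"
proof -
  have "form N H y x = (\<Sum>i=1..N. \<Sum>j=1..N. H j i * y i * cnj (x j))"
    unfolding form_def by (rule sum.swap)
  also have "\<dots> = (\<Sum>i=1..N. \<Sum>j=1..N. cnj (H i j * x j * cnj (y i)))"
    by (intro sum.cong refl, subst hermitianD[OF assms]) auto
  also have "\<dots> = cnj (form N H x y)"
    by (simp add: form_def)
  finally show ?thesis .
qed

lemma form_self_real:
  assumes "hermitian N H"
  shows "form N H x x = of_real (Re (form N H x x))"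
  using form_cnj[OF assms, of x x] by (simp add: complex_eq_iff)

lemma hermitian_combine:
  assumes "hermitian N H" "hermitian N W"
  shows "hermitian N (\<lambda>i j. H i j - of_real c * W i j)"
  unfolding hermitian_def
proof (intro ballI)
  fix i j assume "i \<in> {1..N}" "j \<in> {1..N}"
  from hermitianD[OF assms(1) this] hermitianD[OF assms(2) this]
  show "H j i - of_real c * W j i = cnj (H i j - of_real c * W i j)"
    by (metis complex_cnj_diff complex_cnj_mult complex_cnj_complex_of_real)
qed

lemma continuous_on_coordinate: "continuous_on S (\<lambda>x::nat \<Rightarrow> complex. x i)"
  by (rule continuous_on_product_then_coordinatewise) (rule continuous_on_id)

lemma continuous_on_form: "continuous_on S (\<lambda>x. form N H x x)"
  unfolding form_def by (intro continuous_intros continuous_on_coordinate)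

lemma continuous_on_form_left: "continuous_on S (\<lambda>x. form N H x z)"
  unfolding form_def by (intro continuous_intros continuous_on_coordinate)

text \<open>Otherwise \<open>x - s (x, z) z\<close> would have negative value for small \<open>s > 0\<close>.\<close>

lemma semidefinite_null:
  assumes H: "hermitian N F" and V: "cseq.subspace V"
    and psd: "\<And>z. z \<in> V \<Longrightarrow> 0 \<le> Re (form N F z z)"
    and x: "x \<in> V" "form N F x x = 0" and z: "z \<in> V"
  shows "form N F x z = 0"
proof (rule ccontr)
  define b where "b = form N F x z"
  define c where "c = Re (form N F z z)"
  assume "form N F x z \<noteq> 0"
  then have b: "0 < (cmod b)\<^sup>2" by (simp add: b_def)
  \<comment> \<open>This choice gives \<open>s * c < 1\<close> also when \<open>c = 0\<close>, so
    the factor \<open>s * c - 2\<close> in the value at \<open>u\<close> is negative.\<close>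
  define s where "s = 1 / (c + 1)"
  have c0: "0 \<le> c" using psd[OF z] by (simp add: c_def)
  have s: "0 < s" "s * c < 1" using c0 by (auto simp: s_def)
  define u where "u = x + (\<lambda>n. (- of_real s * b) * z n)"
  have uV: "u \<in> V"
    unfolding u_def using V x z by (intro cseq.subspace_add cseq.subspace_scale)
  have zx: "form N F z x = cnj b" unfolding b_def by (rule form_cnj[OF H])
  have zz: "form N F z z = of_real c" unfolding c_def by (rule form_self_real[OF H])
  have "form N F u u = (- of_real s * cnj b) * b + (- of_real s * b) * cnj b
      + (of_real s * b) * (of_real s * cnj b) * of_real c"
    unfolding u_def form_add_left form_add_right form_scale_left form_scale_right zx zz x(2)
      b_def[symmetric]
    by (simp add: algebra_simps)
  also have "\<dots> = (b * cnj b) * of_real (s * (s * c - 2))"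
    by (simp add: algebra_simps)
  also have "\<dots> = of_real ((cmod b)\<^sup>2 * s * (s * c - 2))"
    unfolding complex_norm_square[symmetric] of_real_mult[symmetric] by (simp only: mult.assoc)
  finally have "Re (form N F u u) = (cmod b)\<^sup>2 * s * (s * c - 2)" by simp
  moreover have "\<dots> < 0"
    using b s by (intro mult_pos_neg) auto
  ultimately show False using psd[OF uV] by simp
qed

text \<open>The quotient of the two forms is continuous and homogeneous of degree zero, so its
  minimum over the compact unit sphere of \<open>V\<close> is a minimum over all nonzero vectors of
  \<open>V\<close>.\<close>

lemma rayleigh_minimum:
  assumes V: "cseq.subspace V" "V \<subseteq> supp_space N" "closed V" and ne: "\<exists>x\<in>V. x \<noteq> 0"
    and H: "hermitian N H" and W: "hermitian N W" "positive_form N W"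
  obtains x \<mu> where "x \<in> V" "x \<noteq> 0" "form N H x x = of_real \<mu> * form N W x x"
    "\<And>z. z \<in> V \<Longrightarrow> \<mu> * Re (form N W z z) \<le> Re (form N H z z)"
proof -
  define nn where "nn = (\<lambda>x::nat \<Rightarrow> complex. \<Sum>i=1..N. (cmod (x i))\<^sup>2)"
  \<comment> \<open>A product of unit discs and single points, compact by Tychonoff. It contains the
    Euclidean unit sphere of \<open>supp_space N\<close>, so compactness of the sphere reduces to
    closedness.\<close>
  define K where "K = Pi\<^sub>E UNIV (\<lambda>n. if n \<in> {1..N} then cball (0::complex) 1 else {0})"
  have "compactin (product_topology (\<lambda>_. euclidean) UNIV) K"
    unfolding K_def by (subst compactin_PiE) auto
  then have K: "compact K"
    by (simp add: euclidean_product_topology)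
  define S where "S = K \<inter> (V \<inter> {x. nn x = 1})"
  have "closed {x. nn x = 1}"
    unfolding nn_def by (intro closed_Collect_eq continuous_intros continuous_on_coordinate)
  then have S: "compact S"
    unfolding S_def using K V by (intro compact_Int_closed closed_Int)
  have W_nz: "Re (form N W x x) > 0" if "x \<in> V" "x \<noteq> 0" for x
    using W that V by (auto simp: positive_form_def)
  have normalise: "\<exists>s>0. (\<lambda>n. of_real s * z n) \<in> S" if z: "z \<in> V" "z \<noteq> 0" for z
  proof -
    have zs: "\<And>n. n \<notin> {1..N} \<Longrightarrow> z n = 0" using z V by (auto simp: supp_space_def)
    have nz: "nn z > 0"
    proof -
      obtain i where "z i \<noteq> 0" using z by (auto simp: fun_eq_iff)
      with zs have "i \<in> {1..N}" by auto
      with \<open>z i \<noteq> 0\<close> show ?thesis unfolding nn_def by (intro sum_pos2[where i=i]) auto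
    qed
    define s where "s = 1 / sqrt (nn z)"
    have s: "s > 0" using nz by (simp add: s_def)
    define u where "u = (\<lambda>n. of_real s * z n)"
    have "nn u = s\<^sup>2 * nn z"
      by (simp add: nn_def u_def norm_mult power_mult_distrib sum_distrib_left)
    also have "\<dots> = 1" using nz by (simp add: s_def power_divide)
    finally have nu: "nn u = 1" .
    have "cmod (u i) \<le> 1" if "i \<in> {1..N}" for i
    proof -
      have "(cmod (u i))\<^sup>2 \<le> nn u"
        unfolding nn_def using that by (intro member_le_sum) auto
      then show ?thesis using nu by (simp add: power_le_one_iff)
    qed
    then have "u \<in> K" unfolding K_def using zs by (auto simp: u_def)
    moreover have "u \<in> V" unfolding u_def using V z by (intro cseq.subspace_scale)
    ultimately show ?thesis using s nu u_def by (auto simp: S_def)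
  qed
  have S_nz: "x \<in> V \<and> x \<noteq> 0" if "x \<in> S" for x
    using that by (auto simp: S_def nn_def)
  have "S \<noteq> {}" using ne normalise by blast
  define R where "R = (\<lambda>x. Re (form N H x x) / Re (form N W x x))"
  have "continuous_on S R"
    unfolding R_def using W_nz S_nz by (intro continuous_intros continuous_on_form) force
  from continuous_attains_inf[OF S \<open>S \<noteq> {}\<close> this]
  obtain x where x: "x \<in> S" "\<And>y. y \<in> S \<Longrightarrow> R x \<le> R y" by blast
  show thesis
  proof (rule that[of x "R x"])
    show "x \<in> V" "x \<noteq> 0" using S_nz x by auto
    then have "R x * Re (form N W x x) = Re (form N H x x)"
      using W_nz[of x] by (simp add: R_def)
    then show "form N H x x = of_real (R x) * form N W x x"
      by (metis form_self_real[OF H] form_self_real[OF W(1)] of_real_mult)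
    show "R x * Re (form N W z z) \<le> Re (form N H z z)" if "z \<in> V" for z
    proof (cases "z = 0")
      case False
      then obtain s where s: "s > 0" "(\<lambda>n. of_real s * z n) \<in> S"
        using normalise \<open>z \<in> V\<close> by blast
      have "R (\<lambda>n. of_real s * z n) = R z"
        using s by (simp add: R_def form_scale_left form_scale_right)
      then have "R x \<le> R z" using x(2)[OF s(2)] by simp
      then show ?thesis using W_nz[OF that False] by (simp add: R_def field_simps)
    qed simp
  qed
qed

section \<open>Dimension counts for kernels of linear functionals\<close>

text \<open>A vector outside the kernel, adjoined to a basis of the kernel, gives a basis of
  \<open>V\<close>: every \<open>x\<close> differs from a multiple of \<open>x0\<close> by a kernel
  element.\<close>

lemma dim_kernel:
  assumes V: "cseq.subspace V" "V \<subseteq> supp_space N"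
    and add: "\<And>x y. \<phi> (x + y) = \<phi> x + \<phi> y" and scale: "\<And>c x. \<phi> (\<lambda>n. c * x n) = c * \<phi> x"
  shows "cseq.subspace {x \<in> V. \<phi> x = (0::complex)}"
    and "x0 \<in> V \<Longrightarrow> \<phi> x0 \<noteq> 0 \<Longrightarrow> cseq.dim V = Suc (cseq.dim {x \<in> V. \<phi> x = 0})"
proof -
  let ?K = "{x \<in> V. \<phi> x = 0}"
  have z: "\<phi> 0 = 0" using add[of 0 0] by simp
  show K: "cseq.subspace ?K"
    using V(1) z unfolding cseq.subspace_def by (auto simp: add scale)
  assume x0: "x0 \<in> V" "\<phi> x0 \<noteq> 0"
  obtain B where B: "B \<subseteq> ?K" "cseq.independent B" "?K \<subseteq> cseq.span B" "card B = cseq.dim ?K"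
    using cseq.basis_exists by blast
  have fin: "finite B" using B V by (intro finite_independent[of B N]) auto
  have "cseq.span B \<subseteq> ?K" using B(1) K by (rule cseq.span_minimal)
  then have "x0 \<notin> cseq.span B" using x0 by auto
  then have ind: "cseq.independent (insert x0 B)" and "x0 \<notin> B"
    using B cseq.independent_insertI cseq.span_base by blast+
  have "V \<subseteq> cseq.span (insert x0 B)"
  proof
    fix x assume x: "x \<in> V"
    define c where "c = - \<phi> x / \<phi> x0"
    define u where "u = x + (\<lambda>n. c * x0 n)"
    have "\<phi> u = \<phi> x + c * \<phi> x0" unfolding u_def add scale ..
    then have "\<phi> u = 0" using x0 by (simp add: c_def)
    moreover have "u \<in> V" unfolding u_def using x x0 V
      by (intro cseq.subspace_add cseq.subspace_scale)
    ultimately have "u \<in> cseq.span (insert x0 B)"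
      using B(3) cseq.span_mono[OF subset_insertI] by fast
    then have "u + (\<lambda>n. (-c) * x0 n) \<in> cseq.span (insert x0 B)"
      by (intro cseq.span_add[OF _ cseq.span_scale[OF cseq.span_base]]) auto
    also have "u + (\<lambda>n. (-c) * x0 n) = x" by (auto simp: u_def fun_eq_iff)
    finally show "x \<in> cseq.span (insert x0 B)" .
  qed
  then have "cseq.dim V = card (insert x0 B)"
    using x0 B ind by (intro cseq.dim_unique) auto
  then show "cseq.dim V = Suc (cseq.dim ?K)"
    using fin \<open>x0 \<notin> B\<close> B by simp
qed

lemma dim_kernel_ge:
  assumes V: "cseq.subspace V" "V \<subseteq> supp_space N"
    and add: "\<And>x y. \<phi> (x + y) = \<phi> x + \<phi> y" and scale: "\<And>c x. \<phi> (\<lambda>n. c * x n) = c * \<phi> x"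
  shows "cseq.dim V \<le> Suc (cseq.dim {x \<in> V. \<phi> x = (0::complex)})"
proof (cases "\<exists>x0\<in>V. \<phi> x0 \<noteq> 0")
  case True
  then show ?thesis using dim_kernel(2)[OF assms] by auto
next
  case False
  then have "{x \<in> V. \<phi> x = 0} = V" by auto
  then show ?thesis by simp
qed

text \<open>Each functional lowers the dimension by at most one. This is the dimension count behind
  the minimax bounds; with \<open>I\<close> empty it merely provides a nonzero vector.\<close>

lemma nontrivial_common_zero:
  assumes add: "\<And>k x y. \<phi> k (x + y) = \<phi> k x + \<phi> k y"
    and scale: "\<And>k c x. \<phi> k (\<lambda>n. c * x n) = c * \<phi> k x"
    and "finite I" "cseq.subspace V" "V \<subseteq> supp_space N" "card I < cseq.dim V"
  shows "\<exists>x\<in>V. x \<noteq> 0 \<and> (\<forall>k\<in>I. \<phi> k x = (0::complex))"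
  using assms(3-)
proof (induction I arbitrary: V rule: finite_induct)
  case empty
  show ?case
  proof (rule ccontr)
    assume "\<not> ?case"
    then have "V \<subseteq> cseq.span {}" unfolding cseq.span_empty by blast
    then have "cseq.dim V \<le> card ({}::(nat \<Rightarrow> complex) set)" by (rule cseq.dim_le_card) simp
    then show False using empty by simp
  qed
next
  case (insert k I)
  let ?V = "{x \<in> V. \<phi> k x = 0}"
  have "cseq.dim V \<le> Suc (cseq.dim ?V)"
    using insert add scale by (intro dim_kernel_ge[where N=N]) auto
  then have "card I < cseq.dim ?V" using insert by simp
  moreover have "cseq.subspace ?V"
    using insert add scale by (intro dim_kernel(1)[where N=N]) auto
  ultimately have "\<exists>x\<in>?V. x \<noteq> 0 \<and> (\<forall>k\<in>I. \<phi> k x = 0)"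
    using insert by (intro insert.IH) auto
  then show ?case by blast
qed

text \<open>A \<open>W\<close>-orthonormal basis of eigenvectors of the form compressed to
  \<open>V\<close>. The eigenvalue relation is tested against \<open>V\<close> only, since
  \<open>V\<close> need not be invariant under the matrices; this is the weak form of a constrained
  problem.\<close>

definition spectral_basis ::
  "nat \<Rightarrow> (nat \<Rightarrow> complex) set \<Rightarrow> (nat \<Rightarrow> nat \<Rightarrow> complex) \<Rightarrow> (nat \<Rightarrow> nat \<Rightarrow> complex) \<Rightarrow>
    nat \<Rightarrow> (nat \<Rightarrow> nat \<Rightarrow> complex) \<Rightarrow> (nat \<Rightarrow> real) \<Rightarrow> bool" where
  "spectral_basis N V H W d y \<mu> \<longleftrightarrow>
     (\<forall>i<d. y i \<in> V) \<and>
     (\<forall>i<d. \<forall>j<d. form N W (y i) (y j) = (if i = j then 1 else 0)) \<and>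
     (\<forall>i<d. \<forall>z\<in>V. form N H (y i) z = of_real (\<mu> i) * form N W (y i) z) \<and>
     (\<forall>x\<in>V. x = (\<Sum>i<d. (\<lambda>n. form N W x (y i) * y i n))) \<and>
     (\<forall>i j. i \<le> j \<longrightarrow> j < d \<longrightarrow> \<mu> i \<le> \<mu> j)"

text \<open>Induction on the dimension: the Rayleigh minimiser is an eigenvector, and its
  \<open>W\<close>-orthogonal complement in \<open>V\<close> supplies the others. Minimality over
  the larger space gives the ordering.\<close>

lemma spectral_basis_exists:
  assumes V: "cseq.subspace V" "V \<subseteq> supp_space N" "closed V"
    and H: "hermitian N H" and W: "hermitian N W" "positive_form N W"
  shows "\<exists>y \<mu>. spectral_basis N V H W (cseq.dim V) y \<mu>"
  using V
proof (induction "cseq.dim V" arbitrary: V)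
  case 0
  obtain B where B: "B \<subseteq> V" "cseq.independent B" "V \<subseteq> cseq.span B" "card B = cseq.dim V"
    using cseq.basis_exists by blast
  then have "finite B" using 0 by (intro finite_independent[of B N]) auto
  then have "B = {}" using B 0 by simp
  then have "V \<subseteq> {0}" using B(3) by simp
  then show ?case using 0 by (auto simp: spectral_basis_def fun_eq_iff)
next
  case (Suc d)
  have "\<exists>x\<in>V. x \<noteq> 0"
    using nontrivial_common_zero[of "\<lambda>k x. 0::complex" "{}" V N] Suc by auto
  from rayleigh_minimum[OF Suc.prems this H W]
  obtain x0 \<mu>0 where x0: "x0 \<in> V" "x0 \<noteq> 0" "form N H x0 x0 = of_real \<mu>0 * form N W x0 x0"
    and min: "\<And>z. z \<in> V \<Longrightarrow> \<mu>0 * Re (form N W z z) \<le> Re (form N H z z)" by blast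
  define a where "a = 1 / sqrt (Re (form N W x0 x0))"
  define e where "e = (\<lambda>n. of_real a * x0 n)"
  have pos: "Re (form N W x0 x0) > 0" using W(2) x0 Suc.prems by (auto simp: positive_form_def)
  have eV: "e \<in> V" unfolding e_def using x0 Suc.prems by (intro cseq.subspace_scale)
  have "form N W e e = of_real (a * a) * form N W x0 x0"
    by (simp add: e_def form_scale_left form_scale_right)
  also have "\<dots> = of_real (a * a * Re (form N W x0 x0))"
    by (subst form_self_real[OF W(1)]) simp
  also have "a * a * Re (form N W x0 x0) = 1"
    using pos by (simp add: a_def)
  finally have ee: "form N W e e = 1" by simp
  have eH: "form N H e z = of_real \<mu>0 * form N W e z" if "z \<in> V" for z
  proof -
    \<comment> \<open>By minimality \<open>H - \<mu>0 W\<close> is semidefinite on \<open>V\<close>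
      and vanishes at \<open>e\<close>; hence \<open>e\<close> is orthogonal to all of
      \<open>V\<close> for this form.\<close>
    have "form N (\<lambda>i j. H i j - of_real \<mu>0 * W i j) e z = 0"
    proof (rule semidefinite_null[OF hermitian_combine[OF H W(1)] Suc.prems(1) _ eV _ that])
      show "0 \<le> Re (form N (\<lambda>i j. H i j - of_real \<mu>0 * W i j) z z)" if "z \<in> V" for z
        using min[OF that] by (simp add: form_combine)
      show "form N (\<lambda>i j. H i j - of_real \<mu>0 * W i j) e e = 0"
        using x0(3) by (simp add: form_combine e_def form_scale_left form_scale_right)
    qed
    then show ?thesis by (simp add: form_combine)
  qed
  let ?V = "{x \<in> V. form N W x e = 0}"
  have ker: "cseq.subspace ?V" "cseq.dim V = Suc (cseq.dim ?V)"
    using dim_kernel[of V N "\<lambda>x. form N W x e"] Suc.prems eV ee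
    by (auto simp: form_add_left form_scale_left)
  have "closed {x. form N W x e = 0}"
    by (intro closed_Collect_eq continuous_intros continuous_on_form_left)
  then have "closed (V \<inter> {x. form N W x e = 0})" using Suc.prems by (intro closed_Int)
  moreover have "V \<inter> {x. form N W x e = 0} = ?V" by auto
  ultimately have cl: "closed ?V" by simp
  have d: "d = cseq.dim ?V" using Suc ker by simp
  obtain y \<mu> where sb: "spectral_basis N ?V H W d y \<mu>"
    using Suc.hyps(1)[OF d ker(1) _ cl] Suc.prems d by auto
  note sb = sb[unfolded spectral_basis_def]
  define y' where "y' = case_nat e y"
  define \<mu>' where "\<mu>' = case_nat \<mu>0 \<mu>"
  have y0: "form N W (y i) e = 0" "form N W e (y i) = 0" "y i \<in> V" if "i < d" for i
  proof -
    show 1: "form N W (y i) e = 0" "y i \<in> V" using sb that by auto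
    show "form N W e (y i) = 0" using form_cnj[OF W(1), of e "y i"] 1 by simp
  qed
  have "spectral_basis N V H W (Suc d) y' \<mu>'"
    unfolding spectral_basis_def
  proof (intro conjI allI impI ballI)
    fix i assume "i < Suc d"
    then show "y' i \<in> V" using sb eV by (cases i) (auto simp: y'_def)
    fix z assume z: "z \<in> V"
    show "form N H (y' i) z = of_real (\<mu>' i) * form N W (y' i) z"
    proof (cases i)
      case 0 then show ?thesis using eH z by (simp add: y'_def \<mu>'_def)
    next
      case (Suc k)
      then have k: "k < d" using \<open>i < Suc d\<close> by simp
      \<comment> \<open>The relation for \<open>y k\<close> is known only against the complement of
        \<open>e\<close>. Removing the \<open>e\<close>-component of \<open>z\<close> leads there,
        and that component contributes zero to both forms.\<close>
      define c where "c = - form N W z e"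
      define u where "u = z + (\<lambda>n. c * e n)"
      have "form N W u e = 0"
        unfolding u_def form_add_left form_scale_left ee by (simp add: c_def)
      then have u: "u \<in> ?V"
        unfolding u_def using subspace_combine[OF Suc.prems(1) z eV] by simp
      have "form N H (y k) e = cnj (form N H e (y k))" by (rule form_cnj[OF H])
      also have "\<dots> = 0" using eH y0[OF k] by simp
      finally have "form N H (y k) e = 0" .
      moreover have "form N H (y k) u = of_real (\<mu> k) * form N W (y k) u"
        using sb k u by auto
      ultimately show ?thesis using Suc y0[OF k]
        by (simp add: u_def form_add_right form_scale_right y'_def \<mu>'_def)
    qed
  next
    fix i j assume "i < Suc d" "j < Suc d"
    then show "form N W (y' i) (y' j) = (if i = j then 1 else 0)"
      using sb ee y0 by (cases i; cases j) (auto simp: y'_def)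
  next
    fix x assume x: "x \<in> V"
    define c where "c = - form N W x e"
    define u where "u = x + (\<lambda>n. c * e n)"
    have "form N W u e = 0"
      unfolding u_def form_add_left form_scale_left ee by (simp add: c_def)
    then have u: "u \<in> ?V"
      unfolding u_def using subspace_combine[OF Suc.prems(1) x eV] by simp
    then have "u = (\<Sum>i<d. (\<lambda>n. form N W u (y i) * y i n))" using sb by blast
    also have "\<dots> = (\<Sum>i<d. (\<lambda>n. form N W x (y i) * y i n))"
      using y0 by (intro sum.cong refl) (auto simp: u_def form_add_left form_scale_left)
    finally have "x = (\<lambda>n. form N W x e * e n) + (\<Sum>i<d. (\<lambda>n. form N W x (y i) * y i n))"
      by (auto simp: u_def c_def fun_eq_iff algebra_simps eq_diff_eq)
    then show "x = (\<Sum>i<Suc d. (\<lambda>n. form N W x (y' i) * y' i n))"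
      by (simp add: sum.lessThan_Suc_shift y'_def del: sum.lessThan_Suc)
  next
    fix i j assume ij: "i \<le> j" "j < Suc d"
    show "\<mu>' i \<le> \<mu>' j"
    proof (cases i)
      case (Suc k)
      then show ?thesis using ij sb by (cases j) (auto simp: \<mu>'_def)
    next
      case 0
      show ?thesis
      proof (cases j)
        case (Suc k)
        then have k: "k < d" using ij by simp
        then have "y k \<in> ?V" "form N W (y k) (y k) = 1" using sb by auto
        moreover have "form N H (y k) (y k) = of_real (\<mu> k) * form N W (y k) (y k)"
          using sb k by blast
        ultimately have "\<mu>0 \<le> \<mu> k" using min[of "y k"] by simp
        then show ?thesis using 0 Suc by (simp add: \<mu>'_def)
      qed (simp add: 0)
    qed
  qed
  then show ?case using Suc by auto
qed

section \<open>Minimax bounds and perturbation\<close>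

lemma spectral_basisD:
  assumes "spectral_basis N V H W d y \<mu>"
  shows "i < d \<Longrightarrow> y i \<in> V"
    and "i < d \<Longrightarrow> j < d \<Longrightarrow> form N W (y i) (y j) = (if i = j then 1 else 0)"
    and "i < d \<Longrightarrow> z \<in> V \<Longrightarrow> form N H (y i) z = of_real (\<mu> i) * form N W (y i) z"
    and "x \<in> V \<Longrightarrow> x = (\<Sum>i<d. (\<lambda>n. form N W x (y i) * y i n))"
    and "i \<le> j \<Longrightarrow> j < d \<Longrightarrow> \<mu> i \<le> \<mu> j"
  using assms unfolding spectral_basis_def by blast+

text \<open>Parseval's identities for the basis. The first allows an arbitrary form
  \<open>F\<close>, because it uses only the expansion of \<open>x\<close>.\<close>

lemma spectral_basis_form:
  assumes sb: "spectral_basis N V H W d y \<mu>" and W: "hermitian N W" and x: "x \<in> V"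
  shows "form N F x z = (\<Sum>i<d. form N W x (y i) * form N F (y i) z)"
    and "Re (form N W x x) = (\<Sum>i<d. (cmod (form N W x (y i)))\<^sup>2)"
    and "Re (form N H x x) = (\<Sum>i<d. \<mu> i * (cmod (form N W x (y i)))\<^sup>2)"
proof -
  have 1: "form N F x z = (\<Sum>i<d. form N W x (y i) * form N F (y i) z)" for F z
    by (subst spectral_basisD(4)[OF sb x]) (simp only: form_sum_left form_scale_left)
  show "form N F x z = (\<Sum>i<d. form N W x (y i) * form N F (y i) z)" by (rule 1)
  have 2: "form N W x (y i) * form N W (y i) x = of_real ((cmod (form N W x (y i)))\<^sup>2)" for i
    by (subst form_cnj[OF W, of "y i" x]) (simp only: complex_norm_square)
  show "Re (form N W x x) = (\<Sum>i<d. (cmod (form N W x (y i)))\<^sup>2)"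
    unfolding 1[of W x] 2 by simp
  have "form N H x x = (\<Sum>i<d. of_real (\<mu> i) * (form N W x (y i) * form N W (y i) x))"
    unfolding 1[of H x] by (intro sum.cong refl) (simp add: spectral_basisD(3)[OF sb _ x])
  then show "Re (form N H x x) = (\<Sum>i<d. \<mu> i * (cmod (form N W x (y i)))\<^sup>2)"
    unfolding 2 by simp
qed

lemma spectral_basis_inj:
  assumes sb: "spectral_basis N V H W d y \<mu>"
  shows "inj_on y {..<d}"
proof (rule inj_onI)
  fix i j assume ij: "i \<in> {..<d}" "j \<in> {..<d}" "y i = y j"
  then have "form N W (y i) (y j) = 1" using spectral_basisD(2)[OF sb, of j j] by simp
  then show "i = j" using spectral_basisD(2)[OF sb, of i j] ij by (auto split: if_splits)
qed

lemma spectral_basis_independent: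
  assumes sb: "spectral_basis N V H W d y \<mu>" and I: "I \<subseteq> {..<d}"
  shows "cseq.independent (y ` I)"
proof -
  have fin: "finite (y ` I)" using I finite_subset by blast
  have "u (y k) = 0" if k: "k \<in> I" and s: "(\<Sum>v\<in>y ` I. (\<lambda>n. u v * v n)) = 0" for u k
  proof -
    have "0 = form N W (\<Sum>v\<in>y ` I. (\<lambda>n. u v * v n)) (y k)"
      unfolding s by simp
    also have "\<dots> = (\<Sum>v\<in>y ` I. u v * form N W v (y k))"
      by (simp only: form_sum_left form_scale_left)
    also have "\<dots> = (\<Sum>i\<in>I. u (y i) * form N W (y i) (y k))"
      by (subst sum.reindex) (use inj_on_subset[OF spectral_basis_inj[OF sb] I] in auto)
    also have "\<dots> = (\<Sum>i\<in>I. if i = k then u (y k) else 0)"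
    proof (intro sum.cong refl)
      fix i assume "i \<in> I"
      then have "form N W (y i) (y k) = (if i = k then 1 else 0)"
        using I k by (intro spectral_basisD(2)[OF sb]) auto
      then show "u (y i) * form N W (y i) (y k) = (if i = k then u (y k) else 0)" by simp
    qed
    also have "\<dots> = u (y k)" using k finite_subset[OF I] by simp
    finally show ?thesis by simp
  qed
  then show ?thesis
    unfolding cseq.dependent_finite[OF fin] by blast
qed

lemma spectral_basis_dim:
  assumes sb: "spectral_basis N V H W d y \<mu>" and I: "I \<subseteq> {..<d}"
  shows "cseq.dim (cseq.span (y ` I)) = card I"
proof -
  have "cseq.dim (cseq.span (y ` I)) = card (y ` I)"
    by (rule cseq.dim_span_eq_card_independent[OF spectral_basis_independent[OF assms]])
  also have "\<dots> = card I"
    by (rule card_image[OF inj_on_subset[OF spectral_basis_inj[OF sb] I]])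
  finally show ?thesis .
qed

lemma spectral_basis_span:
  assumes sb: "spectral_basis N V H W d y \<mu>" and V: "cseq.subspace V" and I: "I \<subseteq> {..<d}"
  shows "cseq.span (y ` I) = {x \<in> V. \<forall>j<d. j \<notin> I \<longrightarrow> form N W x (y j) = 0}" (is "_ = ?R")
proof
  have "cseq.subspace ?R"
    using V unfolding cseq.subspace_def by (simp add: form_add_left form_scale_left)
  moreover have "y i \<in> ?R" if "i \<in> I" for i
    using spectral_basisD(1,2)[OF sb] I that by auto
  ultimately show "cseq.span (y ` I) \<subseteq> ?R"
    by (intro cseq.span_minimal) auto
  show "?R \<subseteq> cseq.span (y ` I)"
  proof
    fix x assume x: "x \<in> ?R"
    then have "x = (\<Sum>i<d. (\<lambda>n. form N W x (y i) * y i n))"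
      using spectral_basisD(4)[OF sb] by blast
    also have "\<dots> = (\<Sum>i\<in>I. (\<lambda>n. form N W x (y i) * y i n))"
      by (rule sum.mono_neutral_right) (use x I in \<open>auto simp: fun_eq_iff\<close>)
    also have "\<dots> \<in> cseq.span (y ` I)"
      by (intro cseq.span_sum cseq.span_scale cseq.span_base) auto
    finally show "x \<in> cseq.span (y ` I)" .
  qed
qed

text \<open>Testing a weak solution against \<open>y j\<close> gives \<open>(l - \<mu> j)\<close>
  times its \<open>j\<close>-th coefficient equal to zero, so only the coefficients with
  \<open>\<mu> j = l\<close> survive. This makes the multiplicity of \<open>l\<close> the number of
  its occurrences in \<open>\<mu>\<close>.\<close>

lemma weak_eigenspace:
  assumes sb: "spectral_basis N V H W d y \<mu>" and V: "cseq.subspace V"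
    and H: "hermitian N H" and W: "hermitian N W"
  shows "{x \<in> V. \<forall>z\<in>V. form N H x z = l * form N W x z} = cseq.span (y ` {i. i < d \<and> of_real (\<mu> i) = l})"
    (is "?L = _")
proof -
  \<comment> \<open>The eigenvalue relation with \<open>y j\<close> moved to the second slot;
    Hermitian symmetry and the reality of \<open>\<mu> j\<close> allow this.\<close>
  have *: "form N H x (y j) = of_real (\<mu> j) * form N W x (y j)" if "x \<in> V" "j < d" for x j
    using arg_cong[OF spectral_basisD(3)[OF sb that(2,1)], of cnj]
    by (simp flip: form_cnj[OF H] form_cnj[OF W])
  have "?L = {x \<in> V. \<forall>j<d. of_real (\<mu> j) \<noteq> l \<longrightarrow> form N W x (y j) = 0}"
  proof (intro Collect_cong conj_cong refl iffI ballI allI impI)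
    fix x j assume x: "x \<in> V" and eq: "\<forall>z\<in>V. form N H x z = l * form N W x z"
      and j: "j < d" "of_real (\<mu> j) \<noteq> l"
    have "l * form N W x (y j) = of_real (\<mu> j) * form N W x (y j)"
      using eq * x j spectral_basisD(1)[OF sb] by metis
    then show "form N W x (y j) = 0" using j by simp
  next
    fix x z assume x: "x \<in> V" and eq: "\<forall>j<d. of_real (\<mu> j) \<noteq> l \<longrightarrow> form N W x (y j) = 0"
      and z: "z \<in> V"
    have "form N W x (y i) * form N H (y i) z = l * (form N W x (y i) * form N W (y i) z)" if "i < d" for i
      using eq that spectral_basisD(3)[OF sb that z] by (cases "of_real (\<mu> i) = l") auto
    then show "form N H x z = l * form N W x z"
      unfolding spectral_basis_form(1)[OF sb W x, of H z] spectral_basis_form(1)[OF sb W x, of W z]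
        sum_distrib_left by (intro sum.cong refl) auto
  qed
  also have "\<dots> = cseq.span (y ` {i. i < d \<and> of_real (\<mu> i) = l})"
    by (subst spectral_basis_span[OF sb V]) auto
  finally show ?thesis .
qed

text \<open>One half of the minimax principle: a space of dimension above \<open>n\<close> contains
  a nonzero vector orthogonal to the first \<open>n\<close> eigenvectors, and there the Rayleigh
  quotient is at least \<open>\<mu> n\<close>.\<close>

lemma spectral_upper_bound:
  assumes sb: "spectral_basis N V H W d y \<mu>" and V: "V \<subseteq> supp_space N"
    and W: "hermitian N W" "positive_form N W"
    and U: "cseq.subspace U" "U \<subseteq> V" "n < cseq.dim U" and n: "n < d"
    and neg: "\<And>x. x \<in> U \<Longrightarrow> x \<noteq> 0 \<Longrightarrow> Re (form N H x x) < c * Re (form N W x x)"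
  shows "\<mu> n < c"
proof -
  have "\<exists>x\<in>U. x \<noteq> 0 \<and> (\<forall>k\<in>{..<n}. form N W x (y k) = 0)"
    using U V by (intro nontrivial_common_zero[of "\<lambda>k x. form N W x (y k)"]) (auto simp: form_add_left form_scale_left)
  then obtain x where x: "x \<in> U" "x \<noteq> 0" "\<And>k. k < n \<Longrightarrow> form N W x (y k) = 0" by blast
  have xV: "x \<in> V" using x U by auto
  have "\<mu> n * Re (form N W x x) = (\<Sum>i<d. \<mu> n * (cmod (form N W x (y i)))\<^sup>2)"
    unfolding spectral_basis_form(2)[OF sb W(1) xV] by (simp add: sum_distrib_left)
  also have "\<dots> \<le> (\<Sum>i<d. \<mu> i * (cmod (form N W x (y i)))\<^sup>2)"
  proof (rule sum_mono)
    fix i assume "i \<in> {..<d}"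
    then show "\<mu> n * (cmod (form N W x (y i)))\<^sup>2 \<le> \<mu> i * (cmod (form N W x (y i)))\<^sup>2"
      using x(3)[of i] spectral_basisD(5)[OF sb, of n i]
      by (cases "i < n") (auto intro: mult_right_mono)
  qed
  also have "\<dots> < c * Re (form N W x x)"
    using neg[OF x(1,2)] unfolding spectral_basis_form(3)[OF sb W(1) xV] .
  finally show ?thesis
    using W(2) xV V x(2) by (auto simp: positive_form_def dest!: bspec)
qed

text \<open>The other half: \<open>U\<close> has codimension at most \<open>n\<close>, hence
  contains a nonzero vector orthogonal to the \<open>d - n - 1\<close> eigenvectors after the
  \<open>n\<close>-th, and there the Rayleigh quotient is at most \<open>\<mu> n\<close>.\<close>

lemma spectral_lower_bound:
  assumes sb: "spectral_basis N V H W d y \<mu>" and V: "V \<subseteq> supp_space N"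
    and W: "hermitian N W" "positive_form N W"
    and U: "cseq.subspace U" "U \<subseteq> V" "d \<le> cseq.dim U + n" and n: "n < d"
    and pos: "\<And>x. x \<in> U \<Longrightarrow> x \<noteq> 0 \<Longrightarrow> c * Re (form N W x x) < Re (form N H x x)"
  shows "c < \<mu> n"
proof -
  have "\<exists>x\<in>U. x \<noteq> 0 \<and> (\<forall>k\<in>{n<..<d}. form N W x (y k) = 0)"
    using U V n by (intro nontrivial_common_zero[of "\<lambda>k x. form N W x (y k)"]) (auto simp: form_add_left form_scale_left)
  then obtain x where x: "x \<in> U" "x \<noteq> 0" "\<And>k. n < k \<Longrightarrow> k < d \<Longrightarrow> form N W x (y k) = 0" by auto
  have xV: "x \<in> V" using x U by auto
  have "c * Re (form N W x x) < Re (form N H x x)" using pos[OF x(1,2)] .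
  also have "\<dots> = (\<Sum>i<d. \<mu> i * (cmod (form N W x (y i)))\<^sup>2)"
    unfolding spectral_basis_form(3)[OF sb W(1) xV] ..
  also have "\<dots> \<le> (\<Sum>i<d. \<mu> n * (cmod (form N W x (y i)))\<^sup>2)"
  proof (rule sum_mono)
    fix i assume "i \<in> {..<d}"
    then show "\<mu> i * (cmod (form N W x (y i)))\<^sup>2 \<le> \<mu> n * (cmod (form N W x (y i)))\<^sup>2"
      using x(3)[of i] spectral_basisD(5)[OF sb, of i n] n
      by (cases "n < i") (auto intro: mult_right_mono)
  qed
  also have "\<dots> = \<mu> n * Re (form N W x x)"
    unfolding spectral_basis_form(2)[OF sb W(1) xV] by (simp add: sum_distrib_left)
  finally show ?thesis
    using W(2) xV V x(2) by (auto simp: positive_form_def dest!: bspec)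
qed

section \<open>Stability of eigenvalues under perturbation of the pencil\<close>

lemma form_bound:
  "\<bar>Re (form N H x x)\<bar> \<le> (\<Sum>i=1..N. \<Sum>j=1..N. cmod (H i j)) * (\<Sum>i=1..N. (cmod (x i))\<^sup>2)"
proof -
  let ?n = "\<Sum>i=1..N. (cmod (x i))\<^sup>2"
  have "\<bar>Re (form N H x x)\<bar> \<le> cmod (form N H x x)" by (rule abs_Re_le_cmod)
  also have "\<dots> \<le> (\<Sum>i=1..N. \<Sum>j=1..N. cmod (H i j) * ?n)"
    unfolding form_def
  proof (intro order.trans[OF norm_sum] sum_mono)
    fix i j assume i: "i \<in> {1..N}" and j: "j \<in> {1..N}"
    have le: "(cmod (x k))\<^sup>2 \<le> ?n" if "k \<in> {1..N}" for k
      using that by (intro member_le_sum) auto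
    have "cmod (x j) * cmod (x i) \<le> ((cmod (x j))\<^sup>2 + (cmod (x i))\<^sup>2) / 2"
      using sum_squares_bound[of "cmod (x j)" "cmod (x i)"] by simp
    also have "\<dots> \<le> ?n" using le[OF i] le[OF j] by simp
    finally have "cmod (H i j) * (cmod (x j) * cmod (x i)) \<le> cmod (H i j) * ?n"
      by (rule mult_left_mono) simp
    then show "cmod (H i j * x j * cnj (x i)) \<le> cmod (H i j) * ?n"
      by (simp add: norm_mult mult.assoc)
  qed
  also have "\<dots> = (\<Sum>i=1..N. \<Sum>j=1..N. cmod (H i j)) * ?n"
    by (simp add: sum_distrib_right)
  finally show ?thesis .
qed

lemma closed_supp_space: "closed (supp_space N)"
proof -
  have "closed (\<Inter>n\<in>-{1..N}. {x::nat \<Rightarrow> complex. x n = 0})"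
    by (intro closed_INT ballI closed_Collect_eq continuous_on_coordinate continuous_on_const)
  moreover have "supp_space N = (\<Inter>n\<in>-{1..N}. {x. x n = 0})"
    by (auto simp: supp_space_def)
  ultimately show ?thesis by simp
qed

text \<open>The constant is the smallest eigenvalue of \<open>W\<close> relative to the identity. It
  converts the entrywise size of a perturbation into a fraction of the form of
  \<open>W\<close>.\<close>

lemma positive_form_coercive:
  assumes W: "hermitian N W" "positive_form N W"
  obtains \<kappa> where "0 < \<kappa>" "\<And>x. x \<in> supp_space N \<Longrightarrow> \<kappa> * (\<Sum>i=1..N. (cmod (x i))\<^sup>2) \<le> Re (form N W x x)"
proof (cases "\<exists>x\<in>supp_space N. x \<noteq> 0")
  case True
  let ?I = "\<lambda>i j. if i = j then 1 else 0 :: complex"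
  have I: "form N ?I x x = of_real (\<Sum>i=1..N. (cmod (x i))\<^sup>2)" for x
    unfolding of_real_sum complex_norm_square form_def
    by (simp add: if_distrib if_distribR cong: if_cong)
  have "hermitian N ?I" by (simp add: hermitian_def)
  moreover have pos: "positive_form N ?I"
    unfolding positive_form_def
  proof (intro ballI impI)
    fix x assume x: "x \<in> supp_space N" "x \<noteq> 0"
    then obtain i where "x i \<noteq> 0" by (auto simp: fun_eq_iff)
    moreover have "i \<in> {1..N}" using x \<open>x i \<noteq> 0\<close> by (auto simp: supp_space_def)
    ultimately show "0 < Re (form N ?I x x)"
      unfolding I Re_complex_of_real by (intro sum_pos2[where i = i]) auto
  qed
  ultimately obtain x \<mu> where x: "x \<in> supp_space N" "x \<noteq> 0" "form N W x x = of_real \<mu> * form N ?I x x"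
    and min: "\<And>z. z \<in> supp_space N \<Longrightarrow> \<mu> * Re (form N ?I z z) \<le> Re (form N W z z)"
    using rayleigh_minimum[OF subspace_supp_space subset_refl closed_supp_space True W(1)] by metis
  have "0 < Re (form N W x x)" "0 < Re (form N ?I x x)" using W(2) pos x by (auto simp: positive_form_def)
  then have "0 < \<mu>" unfolding x(3) by (simp add: zero_less_mult_iff)
  then show thesis using min I that by (metis Re_complex_of_real)
next
  case False
  then have "\<And>x. x \<in> supp_space N \<Longrightarrow> 1 * (\<Sum>i=1..N. (cmod (x i))\<^sup>2) \<le> Re (form N W x x)"
    by fastforce
  then show thesis using that[of 1] by auto
qed

text \<open>The span of the first \<open>n + 1\<close> unperturbed eigenvectors serves as trial
  space for the perturbed problem. On it \<open>H - c W\<close> is at most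
  \<open>-(c - \<mu> n) \<kappa>\<close> times the squared Euclidean norm, and
  \<open>\<delta>\<close> is exactly this margin.\<close>

lemma eigenvalue_less_stable:
  assumes sb: "spectral_basis N V H W d y \<mu>" and V: "cseq.subspace V" "V \<subseteq> supp_space N"
    and W: "hermitian N W" "positive_form N W" and n: "n < d" and c: "\<mu> n < c"
  obtains \<delta> where "0 < \<delta>" "\<And>H' W' y' \<mu>'. spectral_basis N V H' W' d y' \<mu>' \<Longrightarrow>
    hermitian N W' \<Longrightarrow> positive_form N W' \<Longrightarrow>
    (\<Sum>i=1..N. \<Sum>j=1..N. cmod ((H' i j - of_real c * W' i j) - (H i j - of_real c * W i j))) < \<delta> \<Longrightarrow> \<mu>' n < c"
proof -
  obtain \<kappa> where \<kappa>: "0 < \<kappa>" "\<And>x. x \<in> supp_space N \<Longrightarrow> \<kappa> * (\<Sum>i=1..N. (cmod (x i))\<^sup>2) \<le> Re (form N W x x)"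
    using positive_form_coercive[OF W] by blast
  define U where "U = cseq.span (y ` {..n})"
  have n': "{..n} \<subseteq> {..<d}" using n by auto
  have U1: "cseq.subspace U" unfolding U_def by (rule cseq.subspace_span)
  have U2: "U \<subseteq> V" "n < cseq.dim U"
    using spectral_basis_span[OF sb V(1) n'] spectral_basis_dim[OF sb n'] by (auto simp: U_def)
  note U = U1 U2
  show thesis
  proof (rule that[of "(c - \<mu> n) * \<kappa>"])
    show "0 < (c - \<mu> n) * \<kappa>" using \<kappa> c by simp
    fix H' W' y' \<mu>' assume sb': "spectral_basis N V H' W' d y' \<mu>'" and W': "hermitian N W'" "positive_form N W'"
      and d: "(\<Sum>i=1..N. \<Sum>j=1..N. cmod ((H' i j - of_real c * W' i j) - (H i j - of_real c * W i j))) < (c - \<mu> n) * \<kappa>"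
        (is "?s < _")
    show "\<mu>' n < c"
    proof (rule spectral_upper_bound[OF sb' V(2) W' U n])
      fix x assume x: "x \<in> U" "x \<noteq> 0"
      let ?F = "\<lambda>i j. (H' i j - of_real c * W' i j) - 1 * (H i j - of_real c * W i j)"
      let ?n = "\<Sum>i=1..N. (cmod (x i))\<^sup>2"
      have xV: "x \<in> V" and z: "\<And>j. j < d \<Longrightarrow> n < j \<Longrightarrow> form N W x (y j) = 0"
        using x unfolding U_def spectral_basis_span[OF sb V(1) n'] by auto
      have xs: "x \<in> supp_space N" using xV V by auto
      have npos: "0 < ?n"
      proof -
        obtain i where i: "x i \<noteq> 0" using x by (auto simp: fun_eq_iff)
        then have "i \<in> {1..N}" using xs by (auto simp: supp_space_def)
        then show ?thesis using i by (intro sum_pos2[where i = i]) auto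
      qed
      have "Re (form N H x x) \<le> \<mu> n * Re (form N W x x)"
        unfolding spectral_basis_form(2,3)[OF sb W(1) xV] sum_distrib_left
      proof (rule sum_mono)
        fix i assume "i \<in> {..<d}"
        then show "\<mu> i * (cmod (form N W x (y i)))\<^sup>2 \<le> \<mu> n * (cmod (form N W x (y i)))\<^sup>2"
          using z[of i] spectral_basisD(5)[OF sb, of i n] n
          by (cases "n < i") (auto intro: mult_right_mono)
      qed
      then have 1: "Re (form N H x x) - c * Re (form N W x x) \<le> - (c - \<mu> n) * Re (form N W x x)"
        by (simp add: algebra_simps)
      have "Re (form N ?F x x) \<le> ?s * ?n"
        using form_bound[of N ?F x] by simp
      also have "\<dots> < (c - \<mu> n) * \<kappa> * ?n"
        using d npos by (rule mult_strict_right_mono)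
      also have "\<dots> = (c - \<mu> n) * (\<kappa> * ?n)" by simp
      also have "\<dots> \<le> (c - \<mu> n) * Re (form N W x x)"
        using \<kappa>(2)[OF xs] c by (intro mult_left_mono) auto
      finally have "Re (form N ?F x x) < (c - \<mu> n) * Re (form N W x x)" .
      then show "Re (form N H' x x) < c * Re (form N W' x x)"
        using 1 unfolding form_combine by (simp add: left_diff_distrib)
    qed
  qed
qed

text \<open>The dual argument: the trial space is spanned by the eigenvectors from index
  \<open>n\<close> on, where \<open>H - c W\<close> is positive with margin
  \<open>(\<mu> n - c) \<kappa>\<close>.\<close>

lemma eigenvalue_greater_stable:
  assumes sb: "spectral_basis N V H W d y \<mu>" and V: "cseq.subspace V" "V \<subseteq> supp_space N"
    and W: "hermitian N W" "positive_form N W" and n: "n < d" and c: "c < \<mu> n"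
  obtains \<delta> where "0 < \<delta>" "\<And>H' W' y' \<mu>'. spectral_basis N V H' W' d y' \<mu>' \<Longrightarrow>
    hermitian N W' \<Longrightarrow> positive_form N W' \<Longrightarrow>
    (\<Sum>i=1..N. \<Sum>j=1..N. cmod ((H' i j - of_real c * W' i j) - (H i j - of_real c * W i j))) < \<delta> \<Longrightarrow> c < \<mu>' n"
proof -
  obtain \<kappa> where \<kappa>: "0 < \<kappa>" "\<And>x. x \<in> supp_space N \<Longrightarrow> \<kappa> * (\<Sum>i=1..N. (cmod (x i))\<^sup>2) \<le> Re (form N W x x)"
    using positive_form_coercive[OF W] by blast
  define U where "U = cseq.span (y ` {n..<d})"
  have n': "{n..<d} \<subseteq> {..<d}" by auto
  have U1: "cseq.subspace U" unfolding U_def by (rule cseq.subspace_span)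
  have U2: "U \<subseteq> V" "d \<le> cseq.dim U + n"
    using spectral_basis_span[OF sb V(1) n'] spectral_basis_dim[OF sb n'] n by (auto simp: U_def)
  note U = U1 U2
  show thesis
  proof (rule that[of "(\<mu> n - c) * \<kappa>"])
    show "0 < (\<mu> n - c) * \<kappa>" using \<kappa> c by simp
    fix H' W' y' \<mu>' assume sb': "spectral_basis N V H' W' d y' \<mu>'" and W': "hermitian N W'" "positive_form N W'"
      and d: "(\<Sum>i=1..N. \<Sum>j=1..N. cmod ((H' i j - of_real c * W' i j) - (H i j - of_real c * W i j))) < (\<mu> n - c) * \<kappa>"
        (is "?s < _")
    show "c < \<mu>' n"
    proof (rule spectral_lower_bound[OF sb' V(2) W' U n])
      fix x assume x: "x \<in> U" "x \<noteq> 0"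
      let ?F = "\<lambda>i j. (H' i j - of_real c * W' i j) - 1 * (H i j - of_real c * W i j)"
      let ?n = "\<Sum>i=1..N. (cmod (x i))\<^sup>2"
      have xV: "x \<in> V" and z: "\<And>j. j < n \<Longrightarrow> form N W x (y j) = 0"
        using x n unfolding U_def spectral_basis_span[OF sb V(1) n'] by auto
      have xs: "x \<in> supp_space N" using xV V by auto
      have npos: "0 < ?n"
      proof -
        obtain i where i: "x i \<noteq> 0" using x by (auto simp: fun_eq_iff)
        then have "i \<in> {1..N}" using xs by (auto simp: supp_space_def)
        then show ?thesis using i by (intro sum_pos2[where i = i]) auto
      qed
      have "\<mu> n * Re (form N W x x) \<le> Re (form N H x x)"
        unfolding spectral_basis_form(2,3)[OF sb W(1) xV] sum_distrib_left
      proof (rule sum_mono)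
        fix i assume "i \<in> {..<d}"
        then show "\<mu> n * (cmod (form N W x (y i)))\<^sup>2 \<le> \<mu> i * (cmod (form N W x (y i)))\<^sup>2"
          using z[of i] spectral_basisD(5)[OF sb, of n i]
          by (cases "i < n") (auto intro: mult_right_mono)
      qed
      then have 1: "(\<mu> n - c) * Re (form N W x x) \<le> Re (form N H x x) - c * Re (form N W x x)"
        by (simp add: algebra_simps)
      have "- Re (form N ?F x x) \<le> ?s * ?n"
        using form_bound[of N ?F x] by simp
      also have "\<dots> < (\<mu> n - c) * \<kappa> * ?n"
        using d npos by (rule mult_strict_right_mono)
      also have "\<dots> = (\<mu> n - c) * (\<kappa> * ?n)" by simp
      also have "\<dots> \<le> (\<mu> n - c) * Re (form N W x x)"
        using \<kappa>(2)[OF xs] c by (intro mult_left_mono) auto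
      finally have "- Re (form N ?F x x) < (\<mu> n - c) * Re (form N W x x)" .
      then show "c * Re (form N W' x x) < Re (form N H' x x)"
        using 1 unfolding form_combine by (simp add: left_diff_distrib)
    qed
  qed
qed

text \<open>On the span of \<open>x\<^sub>0\<close> and the first \<open>n\<close> eigenvectors on \<open>V\<close> the form of \<open>H - k G - c W\<close> is
  negative for large \<open>k\<close>.\<close>

lemma eigenvalue_drops:
  assumes sb: "spectral_basis N V H W d y \<mu>" and V: "cseq.subspace V" "V \<subseteq> supp_space N"
    and H: "hermitian N H" and W: "hermitian N W" "positive_form N W"
    and n: "n \<le> d" and c: "n = 0 \<or> \<mu> (n - 1) < c"
    and G: "hermitian N G" "\<And>u z. u \<in> V \<Longrightarrow> form N G u z = 0"
    and x0: "x0 \<in> supp_space N" "0 < Re (form N G x0 x0)"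
  obtains K where "\<And>k d' y' \<mu>'. K \<le> k \<Longrightarrow> n < d' \<Longrightarrow>
    spectral_basis N (supp_space N) (\<lambda>i j. H i j - of_real k * G i j) W d' y' \<mu>' \<Longrightarrow> \<mu>' n < c"
proof -
  define F where "F = (\<lambda>i j. H i j - of_real c * W i j)"
  have F: "hermitian N F" unfolding F_def by (rule hermitian_combine[OF H W(1)])
  \<comment> \<open>The amount by which the first \<open>n\<close> eigenvectors make
    \<open>H - c W\<close> negative, relative to \<open>W\<close>. For \<open>n = 0\<close> their
    span is zero and any positive number would do.\<close>
  define \<delta> where "\<delta> = (if n = 0 then 1 else c - \<mu> (n - 1))"
  have \<delta>: "0 < \<delta>" using c by (auto simp: \<delta>_def)
  define B where "B = (\<Sum>i<d. cmod (form N F (y i) x0))"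
  define f where "f = Re (form N F x0 x0)"
  define g where "g = Re (form N G x0 x0)"
  have n': "{..<n} \<subseteq> {..<d}" using n by auto
  define U where "U = cseq.span (insert x0 (y ` {..<n}))"
  note span = spectral_basis_span[OF sb V(1) n']
  have "x0 \<notin> V" using G(2)[of x0 x0] x0(2) by auto
  then have x0n: "x0 \<notin> cseq.span (y ` {..<n})" unfolding span by auto
  then have "cseq.independent (insert x0 (y ` {..<n}))"
    by (rule cseq.independent_insertI[OF _ spectral_basis_independent[OF sb n']])
  then have "cseq.dim U = card (insert x0 (y ` {..<n}))"
    unfolding U_def by (rule cseq.dim_span_eq_card_independent)
  also have "\<dots> = Suc (card (y ` {..<n}))"
    using x0n cseq.span_base by (intro card_insert_disjoint) auto
  also have "card (y ` {..<n}) = n"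
    using card_image[OF inj_on_subset[OF spectral_basis_inj[OF sb] n']] by simp
  finally have dimU: "n < cseq.dim U" by simp
  have "insert x0 (y ` {..<n}) \<subseteq> supp_space N"
    using x0(1) spectral_basisD(1)[OF sb] V(2) n by fastforce
  then have Us: "U \<subseteq> supp_space N"
    unfolding U_def by (rule cseq.span_minimal[OF _ subspace_supp_space])
  \<comment> \<open>For \<open>x = u + t x0\<close>, with \<open>s\<close> the \<open>W\<close>-norm
    of \<open>u\<close>, the value of \<open>F\<close> is at most
    \<open>-\<delta> s^2 + 2 |t| s B + |t|^2 f\<close>. Completing the square costs
    \<open>|t|^2 B^2 / \<delta>\<close>, so \<open>k g\<close> has to cover
    \<open>f + B^2 / \<delta>\<close>. The extra 1 gives strictness if \<open>t\<close> is nonzero;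
    otherwise \<open>u\<close> itself is nonzero.\<close>
  have key: "Re (form N F x x) < k * Re (form N G x x)"
    if k: "(f + B\<^sup>2 / \<delta> + 1) / g \<le> k" and x: "x \<in> U" "x \<noteq> 0" for x k
  proof -
    obtain t where "x - (\<lambda>n. t * x0 n) \<in> cseq.span (y ` {..<n})"
      using x(1) unfolding U_def cseq.span_insert by blast
    then obtain u where u: "u \<in> cseq.span (y ` {..<n})" and xu: "x = u + (\<lambda>n. t * x0 n)"
      by (metis diff_add_cancel)
    have uV: "u \<in> V" and uz: "\<And>j. j < d \<Longrightarrow> n \<le> j \<Longrightarrow> form N W u (y j) = 0"
      using u unfolding span by auto
    define s where "s = sqrt (Re (form N W u u))"
    have "0 \<le> Re (form N W u u)"
      unfolding spectral_basis_form(2)[OF sb W(1) uV] by (intro sum_nonneg) auto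
    then have s: "0 \<le> s" "s\<^sup>2 = Re (form N W u u)" by (auto simp: s_def)
    have le_s: "cmod (form N W u (y i)) \<le> s" if "i < d" for i
    proof (rule power2_le_imp_le)
      show "(cmod (form N W u (y i)))\<^sup>2 \<le> s\<^sup>2"
        unfolding s(2) spectral_basis_form(2)[OF sb W(1) uV] using that by (intro member_le_sum) auto
    qed (rule s)
    have Fux: "cmod (form N F u x0) \<le> s * B"
      unfolding spectral_basis_form(1)[OF sb W(1) uV, of F x0] B_def sum_distrib_left
      by (intro order.trans[OF norm_sum] sum_mono) (auto simp: norm_mult intro!: mult_right_mono le_s)
    have Fuu: "Re (form N F u u) \<le> - \<delta> * s\<^sup>2"
    proof (cases "n = 0")
      case True
      then have "u = 0" using u by simp
      then show ?thesis by (simp add: s(2))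
    next
      case False
      have "Re (form N H u u) \<le> \<mu> (n - 1) * Re (form N W u u)"
        unfolding spectral_basis_form(2,3)[OF sb W(1) uV] sum_distrib_left
      proof (rule sum_mono)
        fix i assume "i \<in> {..<d}"
        then show "\<mu> i * (cmod (form N W u (y i)))\<^sup>2 \<le> \<mu> (n - 1) * (cmod (form N W u (y i)))\<^sup>2"
          using uz[of i] spectral_basisD(5)[OF sb, of i "n - 1"] n False
          by (cases "n \<le> i") (auto intro!: mult_right_mono)
      qed
      then show ?thesis using False unfolding s(2) F_def form_combine \<delta>_def by (simp add: algebra_simps)
    qed
    have "form N F x x = form N F u u + (cnj t * form N F u x0 + cnj (cnj t * form N F u x0)) + t * cnj t * form N F x0 x0"
      unfolding xu form_add_left form_add_right form_scale_left form_scale_right form_cnj[OF F, of x0 u]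
      by (simp add: algebra_simps)
    moreover have "t * cnj t = of_real ((cmod t)\<^sup>2)" by (simp only: complex_norm_square)
    ultimately have "Re (form N F x x) = Re (form N F u u) + 2 * Re (cnj t * form N F u x0) + (cmod t)\<^sup>2 * f"
      by (simp add: f_def)
    moreover have "Re (cnj t * form N F u x0) \<le> cmod t * (s * B)"
      using complex_Re_le_cmod[of "cnj t * form N F u x0"] mult_left_mono[OF Fux, of "cmod t"]
      by (simp add: norm_mult)
    ultimately have 1: "Re (form N F x x) \<le> - \<delta> * s\<^sup>2 + 2 * (cmod t * (s * B)) + (cmod t)\<^sup>2 * f"
      using Fuu by simp
    have "form N G x0 u = 0" using form_cnj[OF G(1), of x0 u] G(2)[OF uV] by simp
    then have "form N G x x = t * cnj t * form N G x0 x0"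
      unfolding xu form_add_left form_add_right form_scale_left form_scale_right by (simp add: G(2)[OF uV])
    then have 2: "Re (form N G x x) = (cmod t)\<^sup>2 * g"
      unfolding \<open>t * cnj t = _\<close> by (simp add: g_def)
    have "f + B\<^sup>2 / \<delta> + 1 \<le> k * g" using k x0(2) by (simp add: g_def divide_le_eq)
    from mult_left_mono[OF this, of "(cmod t)\<^sup>2"]
    have "(cmod t)\<^sup>2 * f - k * Re (form N G x x) \<le> - ((cmod t)\<^sup>2 * (B\<^sup>2 / \<delta>)) - (cmod t)\<^sup>2"
      unfolding 2 by (simp add: algebra_simps)
    with 1 have "Re (form N F x x) - k * Re (form N G x x) \<le>
        - \<delta> * s\<^sup>2 + 2 * (cmod t * (s * B)) - ((cmod t)\<^sup>2 * (B\<^sup>2 / \<delta>)) - (cmod t)\<^sup>2" by simp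
    also have "\<dots> = - \<delta> * (s - cmod t * B / \<delta>)\<^sup>2 - (cmod t)\<^sup>2"
      using \<delta> by (simp add: field_simps power2_eq_square)
    also have "\<dots> < 0"
    proof (cases "t = 0")
      case True
      then have "x = u" unfolding xu by (simp add: fun_eq_iff)
      then have "0 < s\<^sup>2" using x(2) uV V(2) W(2) s(2) by (auto simp: positive_form_def)
      then show ?thesis using True \<delta> by simp
    next
      case False
      then have "0 < (cmod t)\<^sup>2" by simp
      moreover have "0 \<le> \<delta> * (s - cmod t * B / \<delta>)\<^sup>2" using \<delta> by simp
      ultimately show ?thesis by linarith
    qed
    finally show ?thesis by simp
  qed
  show thesis
  proof (rule that)
    fix k d' y' \<mu>' assume k: "(f + B\<^sup>2 / \<delta> + 1) / g \<le> k" and d': "n < d'"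
      and sb': "spectral_basis N (supp_space N) (\<lambda>i j. H i j - of_real k * G i j) W d' y' \<mu>'"
    show "\<mu>' n < c"
    proof (rule spectral_upper_bound[OF sb' subset_refl W _ Us dimU d'])
      show "cseq.subspace U" unfolding U_def by (rule cseq.subspace_span)
      fix x assume "x \<in> U" "x \<noteq> 0"
      from key[OF k this]
      show "Re (form N (\<lambda>i j. H i j - of_real k * G i j) x x) < c * Re (form N W x x)"
        unfolding F_def form_combine by simp
    qed
  qed
qed

section \<open>Normal form of the boundary condition\<close>

text \<open>In the unknowns \<open>a = (y\<^sub>1, y\<^sub>N)\<close> and \<open>b = (f\<^sub>0 \<Delta>y\<^sub>0, - f\<^sub>N \<Delta>y\<^sub>N)\<close> the condition given by
  \<open>bmat (1 / f\<^sub>0) X Y\<close> reads \<open>X a + Y b = 0\<close>.\<close>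

definition bmat :: "real \<Rightarrow> complex^2^2 \<Rightarrow> complex^2^2 \<Rightarrow> complex^4^2" where
  "bmat r X Y = (\<chi> i. vector [X$i$1, Y$i$1 + of_real r * X$i$1, X$i$2, - Y$i$2])"

lemma vec4_eq_iff: "(A::'a^4^2) = B \<longleftrightarrow>
   (A$1$1 = B$1$1 \<and> A$1$2 = B$1$2 \<and> A$1$3 = B$1$3 \<and> A$1$4 = B$1$4) \<and>
   (A$2$1 = B$2$1 \<and> A$2$2 = B$2$2 \<and> A$2$3 = B$2$3 \<and> A$2$4 = B$2$4)"
  by (simp add: vec_eq_iff forall_2 forall_4)

lemma mat2_eq_iff: "(A::'a^2^2) = B \<longleftrightarrow>
   (A$1$1 = B$1$1 \<and> A$1$2 = B$1$2) \<and> (A$2$1 = B$2$1 \<and> A$2$2 = B$2$2)"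
  by (simp add: vec_eq_iff forall_2)

lemma mat2_nth [simp]:
  fixes A :: "('a::semiring_1)^2^2" and B :: "'a^'n^2"
  shows "(A ** B) $ i $ j = A$i$1 * B$1$j + A$i$2 * B$2$j"
    and "(mat 1 :: 'a^2^2)$1$1 = 1" "(mat 1 :: 'a^2^2)$1$2 = 0"
        "(mat 1 :: 'a^2^2)$2$1 = 0" "(mat 1 :: 'a^2^2)$2$2 = 1"
  by (simp_all add: matrix_matrix_mult_def sum_2 mat_def)

lemma mat2_vec_nth [simp]:
  fixes A :: "('a::semiring_1)^2^2"
  shows "(A *v x) $ i = A$i$1 * x$1 + A$i$2 * x$2"
  by (simp add: matrix_vector_mult_def sum_2)

lemma adjoint_matrix_nth [simp]: "adjoint_matrix A $ i $ j = cnj (A$j$i)"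
  by (simp add: adjoint_matrix_def)

lemma bmat_nth [simp]:
  "bmat r X Y $ i $ 1 = X$i$1" "bmat r X Y $ i $ 2 = Y$i$1 + of_real r * X$i$1"
  "bmat r X Y $ i $ 3 = X$i$2" "bmat r X Y $ i $ 4 = - Y$i$2"
  by (simp_all add: bmat_def)

lemma bmat_mult: "T ** bmat r X Y = bmat r (T ** X) (T ** Y)"
  by (simp add: vec4_eq_iff algebra_simps)

lemma bmat_eq_iff: "bmat r X Y = bmat r X' Y' \<longleftrightarrow> X = X' \<and> Y = Y'"
  by (auto simp: vec4_eq_iff mat2_eq_iff)

lemma bmat_surj: obtains X Y where "M = bmat r X Y"
proof -
  have "M = bmat r (\<chi> i. vector [M$i$1, M$i$3]) (\<chi> i. vector [M$i$2 - of_real r * M$i$1, - M$i$4])"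
    by (simp add: vec4_eq_iff)
  then show thesis using that by blast
qed

lemma bmat_augment:
  "bmat r X Y = augment (\<chi> i. vector [X$i$1, Y$i$1 + of_real r * X$i$1]) (\<chi> i. vector [X$i$2, - Y$i$2])"
  by (simp add: vec4_eq_iff augment_def)

lemma satisfies_bc_bmat:
  assumes "f_of \<omega> 0 \<noteq> 0"
  shows "satisfies_bc N \<omega> (bc_class (bmat (1 / f_of \<omega> 0) X Y)) y \<longleftrightarrow>
    X *v vector [y 1, y N] + Y *v vector [quasi_diff \<omega> y 0, - quasi_diff \<omega> y N] = 0"
proof -
  have "y 1 = y 0 + of_real (1 / f_of \<omega> 0) * quasi_diff \<omega> y 0"
    using assms by (simp add: quasi_diff_def fdiff_def)
  then show ?thesis
    unfolding bmat_augment satisfies_bc_bc_class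
    by (simp add: vec_eq_iff forall_2 algebra_simps)
qed

lemma bc_class_self: "M \<in> bc_class M"
  unfolding bc_class_def by (rule CollectI, rule exI[of _ "mat 1"]) (auto simp: invertible_def)

lemma bc_class_mult:
  assumes "invertible T"
  shows "bc_class (T ** M) = bc_class M"
proof -
  obtain S where S: "S ** T = mat 1" "invertible S"
    using assms by (auto simp: invertible_def)
  have sub: "bc_class (R ** X) \<subseteq> bc_class X" if "invertible R" for R X
    unfolding bc_class_def by (auto simp: matrix_mul_assoc intro: invertible_mult that)
  have "M = S ** (T ** M)" by (simp add: matrix_mul_assoc S)
  then show ?thesis using sub[OF assms, of M] sub[OF S(2), of "T ** M"] by simp
qed

lemma bc_class_eqD:
  assumes "bc_class M = bc_class M'"
  obtains T where "invertible T" "M = T ** M'"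
  using bc_class_self[of M] assms by (auto simp: bc_class_def)

text \<open>The terms with \<open>r\<close> cancel because \<open>r\<close> is real. The sign put on
  the quasi-difference at \<open>N\<close> turns the difference of two symplectic products into the
  symmetric relation of a Lagrangian plane.\<close>

lemma selfadjoint_bmat:
  fixes X Y :: "complex^2^2"
  assumes "A = (\<chi> i. vector [X$i$1, Y$i$1 + of_real r * X$i$1])" "B = (\<chi> i. vector [X$i$2, - Y$i$2])"
  shows "A ** J_mat ** adjoint_matrix A = B ** J_mat ** adjoint_matrix B \<longleftrightarrow>
    X ** adjoint_matrix Y = Y ** adjoint_matrix X"
  unfolding assms by (auto simp: mat2_eq_iff J_mat_def algebra_simps)

lemma rank2D:
  fixes M :: "complex^4^2"
  assumes "rank M = 2" "c *s M$1 + d *s M$2 = 0"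
  shows "c = 0 \<and> d = 0"
proof (rule ccontr)
  assume cd: "\<not> (c = 0 \<and> d = 0)"
  have rows: "rows M = {M$1, M$2}"
    by (auto simp: rows_def row_def) (metis exhaust_2)
  have "\<exists>v. rows M \<subseteq> vec.span {v}"
  proof (cases "c = 0")
    case True
    then have "M$2 = 0" using cd assms(2) by (auto simp: vec_eq_iff)
    then show ?thesis unfolding rows by (intro exI[of _ "M$1"]) (auto intro: vec.span_base vec.span_zero)
  next
    case False
    have "M$1 = (- d / c) *s M$2"
      using assms(2) False by (simp add: vec_eq_iff field_simps) (simp add: add_eq_0_iff)
    then have "M$1 \<in> vec.span {M$2}" by (metis vec.span_scale vec.span_base singletonI)
    then show ?thesis unfolding rows by (intro exI[of _ "M$2"]) (auto intro: vec.span_base)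
  qed
  then obtain v where "rows M \<subseteq> vec.span {v}" by blast
  then have "vec.dim (rows M) \<le> card {v}" by (rule vec.dim_le_card) simp
  then show False using assms(1) by (simp add: row_rank_def_gen)
qed

text \<open>The shift \<open>r\<close> is at the reader's disposal:
  \<open>1 / f_of \<omega> 0\<close> is taken when a problem is solved, and 0 when only the class of
  matrices matters.\<close>

lemma BC_bmat:
  assumes "C \<in> BC"
  obtains X Y where "C = bc_class (bmat r X Y)" "rank (bmat r X Y) = 2"
    "X ** adjoint_matrix Y = Y ** adjoint_matrix X"
proof -
  obtain A B where C: "C = bc_class (augment A B)" "rank (augment A B) = 2"
    "A ** J_mat ** adjoint_matrix A = B ** J_mat ** adjoint_matrix B"
    using assms by (auto simp: BC_def)
  obtain X Y where M: "augment A B = bmat r X Y" by (rule bmat_surj)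
  from M have "A = (\<chi> i. vector [X$i$1, Y$i$1 + of_real r * X$i$1])" "B = (\<chi> i. vector [X$i$2, - Y$i$2])"
    unfolding bmat_augment augment_eq_iff by auto
  from C(3)[unfolded selfadjoint_bmat[OF this]] show thesis
    using C M that by simp
qed

lemma bmat_in_BC:
  assumes "rank (bmat r X Y) = 2" "X ** adjoint_matrix Y = Y ** adjoint_matrix X"
  shows "bc_class (bmat r X Y) \<in> BC"
  using assms selfadjoint_bmat[OF refl refl, of X Y r] unfolding BC_def bmat_augment by blast

lemma bmat_rankD:
  assumes "rank (bmat r X Y) = 2"
    and "c * X$1$1 + d * X$2$1 = 0" "c * X$1$2 + d * X$2$2 = 0"
    and "c * Y$1$1 + d * Y$2$1 = 0" "c * Y$1$2 + d * Y$2$2 = 0"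
  shows "c = 0 \<and> d = 0"
proof (rule rank2D[OF assms(1)])
  have "c * (Y$1$1 + of_real r * X$1$1) + d * (Y$2$1 + of_real r * X$2$1) =
      (c * Y$1$1 + d * Y$2$1) + of_real r * (c * X$1$1 + d * X$2$1)"
    by (simp add: algebra_simps)
  then have "c * (Y$1$1 + of_real r * X$1$1) + d * (Y$2$1 + of_real r * X$2$1) = 0"
    using assms by simp
  moreover have "c * - Y$1$2 + d * - Y$2$2 = 0"
    using assms(5) by algebra
  ultimately show "c *s bmat r X Y $ 1 + d *s bmat r X Y $ 2 = 0"
    using assms by (simp add: vec_eq_iff forall_4)
qed

lemma bmat_rankI:
  assumes "\<And>c d. c * X$1$1 + d * X$2$1 = 0 \<Longrightarrow> c * X$1$2 + d * X$2$2 = 0 \<Longrightarrow>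
    c * Y$1$1 + d * Y$2$1 = 0 \<Longrightarrow> c * Y$1$2 + d * Y$2$2 = 0 \<Longrightarrow> c = 0 \<and> d = 0"
  shows "rank (bmat r X Y) = 2"
proof (rule rank_two)
  fix c d assume "c *s bmat r X Y $ 1 + d *s bmat r X Y $ 2 = 0"
  then have z: "c * X$1$1 + d * X$2$1 = 0" "c * X$1$2 + d * X$2$2 = 0"
    "c * (Y$1$1 + of_real r * X$1$1) + d * (Y$2$1 + of_real r * X$2$1) = 0" "c * - Y$1$2 + d * - Y$2$2 = 0"
    by (simp_all add: vec_eq_iff forall_4)
  have "c * (Y$1$1 + of_real r * X$1$1) + d * (Y$2$1 + of_real r * X$2$1) =
      (c * Y$1$1 + d * Y$2$1) + of_real r * (c * X$1$1 + d * X$2$1)"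
    by (simp add: algebra_simps)
  then have "c * Y$1$1 + d * Y$2$1 = 0" using z by simp
  moreover have "c * Y$1$2 + d * Y$2$2 = 0"
    using z(4) by algebra
  ultimately show "c = 0 \<and> d = 0" using z assms by blast
qed

section \<open>Lagrangian planes in normal form\<close>

lemma det_2_complex: "det (A::complex^2^2) = A$1$1 * A$2$2 - A$1$2 * A$2$1"
  by (rule det_2)

text \<open>The condition \<open>(1 - P - S) a + P b = 0\<close> says that \<open>a\<close> lies in the range of the orthogonal
  projection \<open>P\<close> and that \<open>b - S a\<close> is orthogonal to this range.\<close>

definition normal_pair :: "complex^2^2 \<Rightarrow> complex^2^2 \<Rightarrow> bool" where
  "normal_pair P S \<longleftrightarrow> P ** P = P \<and> adjoint_matrix P = P \<and> P ** S = S \<and> adjoint_matrix S = S"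

text \<open>For \<open>|b1|^2 + |b2|^2 = 1\<close> this is the orthogonal projection onto the line
  through \<open>(cnj b1, cnj b2)\<close>; the row \<open>(b1, b2)\<close> spans its row
  space.\<close>

definition line_projection :: "complex \<Rightarrow> complex \<Rightarrow> complex^2^2" where
  "line_projection b1 b2 = vector [vector [cnj b1 * b1, cnj b1 * b2], vector [cnj b2 * b1, cnj b2 * b2]]"

lemma line_projection_nth [simp]:
  "line_projection b1 b2 $ 1 $ 1 = cnj b1 * b1" "line_projection b1 b2 $ 1 $ 2 = cnj b1 * b2"
  "line_projection b1 b2 $ 2 $ 1 = cnj b2 * b1" "line_projection b1 b2 $ 2 $ 2 = cnj b2 * b2"
  by (simp_all add: line_projection_def)

text \<open>With \<open>T\<close> the inverse of \<open>Y\<close>, multiplying the self-adjointness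
  relation by \<open>T\<close> on the left and by its adjoint on the right shows that
  \<open>T ** X\<close> is Hermitian.\<close>

lemma normal_form_invertible:
  assumes "det Y \<noteq> 0" and sa: "X ** adjoint_matrix Y = Y ** adjoint_matrix X"
  obtains T S where "invertible T" "T ** Y = mat 1" "T ** X = - S" "adjoint_matrix S = S"
proof -
  obtain T where T: "T ** Y = mat 1" "Y ** T = mat 1"
    using assms(1) invertible_det_nz[of Y] by (auto simp: invertible_def)
  have adj: "adjoint_matrix (A ** B) = adjoint_matrix B ** adjoint_matrix A" for A B
    by (simp add: mat2_eq_iff mult.commute)
  have adj1: "adjoint_matrix (mat 1) = mat 1" by (simp add: mat2_eq_iff)
  have adj_T: "adjoint_matrix Y ** adjoint_matrix T = mat 1"
    unfolding adj[symmetric] T adj1 ..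
  have "T ** X = T ** (X ** adjoint_matrix Y) ** adjoint_matrix T"
    by (simp only: matrix_mul_assoc[symmetric] adj_T matrix_mul_rid)
  also have "\<dots> = adjoint_matrix X ** adjoint_matrix T"
    unfolding sa by (simp only: matrix_mul_assoc T matrix_mul_lid)
  finally have TX: "T ** X = adjoint_matrix X ** adjoint_matrix T" .
  have "adjoint_matrix (T ** X) = T ** X"
    unfolding adj by (rule TX[symmetric])
  moreover have "adjoint_matrix (- A) = - adjoint_matrix A" for A by (simp add: mat2_eq_iff)
  ultimately have "adjoint_matrix (- (T ** X)) = - (T ** X)" by simp
  moreover have "invertible T" using T by (auto simp: invertible_def)
  ultimately show thesis using T that[of T "- (T ** X)"] by simp
qed

text \<open>Let the row \<open>u\<close> produce a unit row \<open>b = u Y\<close>, and let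
  \<open>v\<close> annihilate \<open>Y\<close> from the left. Self-adjointness makes
  \<open>v X\<close> orthogonal to \<open>b\<close>, the rank makes it nonzero, and the component of
  \<open>u X\<close> along \<open>b\<close> is a real number \<open>\<rho>\<close>. So
  \<open>u\<close> and \<open>v\<close> can be corrected to rows \<open>g\<close>, \<open>h\<close>
  such that \<open>g\<close> maps \<open>Y\<close>, \<open>X\<close> to \<open>b\<close>,
  \<open>\<rho> b\<close> and \<open>h\<close> maps them to 0 and a unit row orthogonal to
  \<open>b\<close>.\<close>

lemma normal_form_rank_one:
  assumes det: "det Y = 0" and Y: "Y \<noteq> 0"
    and rk: "rank (bmat r X Y) = 2" and sa: "X ** adjoint_matrix Y = Y ** adjoint_matrix X"
  obtains T b1 b2 \<rho> where "invertible T" "cnj b1 * b1 + cnj b2 * b2 = 1"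
    "T ** Y = line_projection b1 b2"
    "T ** X = mat 1 - line_projection b1 b2 + \<rho> *\<^sub>R line_projection b1 b2"
proof -
  have sa': "X$1$1 * cnj (Y$1$1) + X$1$2 * cnj (Y$1$2) = Y$1$1 * cnj (X$1$1) + Y$1$2 * cnj (X$1$2)"
    "X$1$1 * cnj (Y$2$1) + X$1$2 * cnj (Y$2$2) = Y$1$1 * cnj (X$2$1) + Y$1$2 * cnj (X$2$2)"
    "X$2$1 * cnj (Y$1$1) + X$2$2 * cnj (Y$1$2) = Y$2$1 * cnj (X$1$1) + Y$2$2 * cnj (X$1$2)"
    "X$2$1 * cnj (Y$2$1) + X$2$2 * cnj (Y$2$2) = Y$2$1 * cnj (X$2$1) + Y$2$2 * cnj (X$2$2)"
    using sa unfolding mat2_eq_iff by auto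
  have det': "Y$1$1 * Y$2$2 = Y$1$2 * Y$2$1" using det by (simp add: det_2_complex)
  have "\<exists>v1 v2. (v1 \<noteq> 0 \<or> v2 \<noteq> 0) \<and> v1 * Y$1$1 + v2 * Y$2$1 = 0 \<and> v1 * Y$1$2 + v2 * Y$2$2 = 0"
  proof (cases "Y$2$1 = 0 \<and> Y$1$1 = 0")
    case True
    then have "Y$2$2 \<noteq> 0 \<or> - Y$1$2 \<noteq> 0" using Y by (auto simp: mat2_eq_iff)
    then show ?thesis using True by (intro exI[of _ "Y$2$2"] exI[of _ "- Y$1$2"]) auto
  next
    case False
    then show ?thesis using det'
      by (intro exI[of _ "Y$2$1"] exI[of _ "- Y$1$1"]) (auto simp: mult.commute)
  qed
  then obtain v1 v2 where v: "v1 \<noteq> 0 \<or> v2 \<noteq> 0"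
    and vY: "v1 * Y$1$1 + v2 * Y$2$1 = 0" "v1 * Y$1$2 + v2 * Y$2$2 = 0" by blast
  have unit: "\<exists>s. cnj (s * p) * (s * p) + cnj (s * q) * (s * q) = 1" if "p \<noteq> 0 \<or> q \<noteq> 0" for p q :: complex
  proof -
    define m where "m = (cmod p)\<^sup>2 + (cmod q)\<^sup>2"
    have m: "m > 0" using that by (auto simp: m_def add_pos_nonneg add_nonneg_pos)
    have "complex_of_real m = cnj p * p + cnj q * q"
      unfolding m_def of_real_add complex_norm_square by (simp add: mult.commute)
    moreover have "complex_of_real (1 / sqrt m) * complex_of_real (1 / sqrt m) * complex_of_real m = 1"
      using m by (simp flip: of_real_mult)
    ultimately have "cnj (complex_of_real (1 / sqrt m) * p) * (complex_of_real (1 / sqrt m) * p) +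
        cnj (complex_of_real (1 / sqrt m) * q) * (complex_of_real (1 / sqrt m) * q) = 1"
      unfolding complex_cnj_mult complex_cnj_complex_of_real by algebra
    then show ?thesis by blast
  qed
  have "\<exists>u1 u2. cnj (u1 * Y$1$1 + u2 * Y$2$1) * (u1 * Y$1$1 + u2 * Y$2$1) +
      cnj (u1 * Y$1$2 + u2 * Y$2$2) * (u1 * Y$1$2 + u2 * Y$2$2) = 1"
  proof (cases "Y$1$1 \<noteq> 0 \<or> Y$1$2 \<noteq> 0")
    case True
    from unit[OF this] obtain s where "cnj (s * Y$1$1) * (s * Y$1$1) + cnj (s * Y$1$2) * (s * Y$1$2) = 1" ..
    then show ?thesis by (intro exI[of _ s] exI[of _ 0]) simp
  next
    case False
    then have "Y$2$1 \<noteq> 0 \<or> Y$2$2 \<noteq> 0" using Y by (auto simp: mat2_eq_iff)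
    from unit[OF this] obtain s where "cnj (s * Y$2$1) * (s * Y$2$1) + cnj (s * Y$2$2) * (s * Y$2$2) = 1" ..
    then show ?thesis by (intro exI[of _ 0] exI[of _ s]) simp
  qed
  then obtain u1 u2 where u: "cnj (u1 * Y$1$1 + u2 * Y$2$1) * (u1 * Y$1$1 + u2 * Y$2$1) +
      cnj (u1 * Y$1$2 + u2 * Y$2$2) * (u1 * Y$1$2 + u2 * Y$2$2) = 1" by blast
  define b1 where "b1 = u1 * Y$1$1 + u2 * Y$2$1"
  define b2 where "b2 = u1 * Y$1$2 + u2 * Y$2$2"
  have b: "cnj b1 * b1 + cnj b2 * b2 = 1" using u by (simp add: b1_def b2_def)
  define x1 where "x1 = u1 * X$1$1 + u2 * X$2$1"
  define x2 where "x2 = u1 * X$1$2 + u2 * X$2$2"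
  define a1 where "a1 = v1 * X$1$1 + v2 * X$2$1"
  define a2 where "a2 = v1 * X$1$2 + v2 * X$2$2"
  have a: "a1 \<noteq> 0 \<or> a2 \<noteq> 0"
    using bmat_rankD[OF rk _ _ vY] v unfolding a1_def a2_def by blast
  have form: "(p1 * X$1$1 + p2 * X$2$1) * cnj (q1 * Y$1$1 + q2 * Y$2$1) +
      (p1 * X$1$2 + p2 * X$2$2) * cnj (q1 * Y$1$2 + q2 * Y$2$2) =
      (p1 * Y$1$1 + p2 * Y$2$1) * cnj (q1 * X$1$1 + q2 * X$2$1) +
      (p1 * Y$1$2 + p2 * Y$2$2) * cnj (q1 * X$1$2 + q2 * X$2$2)" for p1 p2 q1 q2
    unfolding complex_cnj_add complex_cnj_mult using sa' by algebra
  have ab: "a1 * cnj b1 + a2 * cnj b2 = 0"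
    using form[of v1 v2 u1 u2] unfolding vY a1_def a2_def b1_def b2_def by simp
  have "x1 * cnj b1 + x2 * cnj b2 = cnj (x1 * cnj b1 + x2 * cnj b2)"
    using form[of u1 u2 u1 u2] unfolding b1_def b2_def x1_def x2_def by (simp add: mult.commute)
  then obtain \<rho> where \<rho>: "x1 * cnj b1 + x2 * cnj b2 = of_real \<rho>"
    by (metis Reals_cnj_iff Reals_cases)
  define \<tau> where "\<tau> = a2 * b1 - a1 * b2"
  have a\<tau>: "a1 = - \<tau> * cnj b2" "a2 = \<tau> * cnj b1"
    using ab b unfolding \<tau>_def by algebra+
  have \<tau>: "\<tau> \<noteq> 0" using a a\<tau> by auto
  \<comment> \<open>The multiple of \<open>v X\<close> that cancels the part of \<open>u X\<close>
    orthogonal to \<open>b\<close>; subtracting it does not affect \<open>u Y\<close>, as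
    \<open>v Y = 0\<close>.\<close>
  define \<kappa> where "\<kappa> = (x2 * b1 - x1 * b2) / \<tau>"
  have \<kappa>: "\<kappa> * \<tau> = x2 * b1 - x1 * b2" using \<tau> by (simp add: \<kappa>_def)
  define \<theta> where "\<theta> = 1 / \<tau>"
  have \<theta>: "\<theta> * \<tau> = 1" using \<tau> by (simp add: \<theta>_def)
  define g1 where "g1 = u1 - \<kappa> * v1"
  define g2 where "g2 = u2 - \<kappa> * v2"
  define h1 where "h1 = \<theta> * v1"
  define h2 where "h2 = \<theta> * v2"
  have gY: "g1 * Y$1$1 + g2 * Y$2$1 = b1" "g1 * Y$1$2 + g2 * Y$2$2 = b2"
    unfolding g1_def g2_def b1_def b2_def using vY by algebra+
  have hY: "h1 * Y$1$1 + h2 * Y$2$1 = 0" "h1 * Y$1$2 + h2 * Y$2$2 = 0"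
    unfolding h1_def h2_def using vY by algebra+
  have gX: "g1 * X$1$1 + g2 * X$2$1 = of_real \<rho> * b1" "g1 * X$1$2 + g2 * X$2$2 = of_real \<rho> * b2"
  proof -
    have "g1 * X$1$1 + g2 * X$2$1 = x1 - \<kappa> * a1"
      unfolding g1_def g2_def x1_def a1_def by algebra
    also have "\<kappa> * a1 = - (x2 * b1 - x1 * b2) * cnj b2" unfolding \<kappa>[symmetric] a\<tau>(1) by simp
    also have "x1 - - (x2 * b1 - x1 * b2) * cnj b2 = of_real \<rho> * b1" unfolding \<rho>[symmetric] using b by algebra
    finally show "g1 * X$1$1 + g2 * X$2$1 = of_real \<rho> * b1" .
    have "g1 * X$1$2 + g2 * X$2$2 = x2 - \<kappa> * a2"
      unfolding g1_def g2_def x2_def a2_def by algebra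
    also have "\<kappa> * a2 = (x2 * b1 - x1 * b2) * cnj b1" unfolding \<kappa>[symmetric] a\<tau>(2) by simp
    also have "x2 - (x2 * b1 - x1 * b2) * cnj b1 = of_real \<rho> * b2" unfolding \<rho>[symmetric] using b by algebra
    finally show "g1 * X$1$2 + g2 * X$2$2 = of_real \<rho> * b2" .
  qed
  have hX: "h1 * X$1$1 + h2 * X$2$1 = - cnj b2" "h1 * X$1$2 + h2 * X$2$2 = cnj b1"
  proof -
    have "h1 * X$1$1 + h2 * X$2$1 = \<theta> * a1" unfolding h1_def h2_def a1_def by algebra
    also have "\<dots> = - cnj b2" using a\<tau> \<theta> by algebra
    finally show "h1 * X$1$1 + h2 * X$2$1 = - cnj b2" .
    have "h1 * X$1$2 + h2 * X$2$2 = \<theta> * a2" unfolding h1_def h2_def a2_def by algebra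
    also have "\<dots> = cnj b1" using a\<tau> \<theta> by algebra
    finally show "h1 * X$1$2 + h2 * X$2$2 = cnj b1" .
  qed
  have D: "u1 * v2 - u2 * v1 \<noteq> 0"
  proof
    assume 0: "u1 * v2 - u2 * v1 = 0"
    have "b1 * v1 = 0" "b1 * v2 = 0" "b2 * v1 = 0" "b2 * v2 = 0"
      unfolding b1_def b2_def using 0 vY by algebra+
    then have "b1 = 0 \<and> b2 = 0" using v by auto
    then show False using b by simp
  qed
  \<comment> \<open>Columns \<open>(cnj b1, cnj b2)\<close> and \<open>(-b2, b1)\<close> times the
    rows \<open>g\<close> and \<open>h\<close>. The first product builds the projection onto the
    line, the second its complement.\<close>
  define T :: "complex^2^2" where "T = vector [vector [cnj b1 * g1 - b2 * h1, cnj b1 * g2 - b2 * h2],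
    vector [cnj b2 * g1 + b1 * h1, cnj b2 * g2 + b1 * h2]]"
  have T [simp]: "T$1$1 = cnj b1 * g1 - b2 * h1" "T$1$2 = cnj b1 * g2 - b2 * h2"
    "T$2$1 = cnj b2 * g1 + b1 * h1" "T$2$2 = cnj b2 * g2 + b1 * h2"
    by (simp_all add: T_def)
  have lin: "(p * g1 - q * h1) * m + (p * g2 - q * h2) * n = p * (g1 * m + g2 * n) - q * (h1 * m + h2 * n)"
    "(p * g1 + q * h1) * m + (p * g2 + q * h2) * n = p * (g1 * m + g2 * n) + q * (h1 * m + h2 * n)" for p q m n
    by algebra+
  show thesis
  proof (rule that[OF _ b])
    have "det T = (cnj b1 * b1 + cnj b2 * b2) * (\<theta> * (u1 * v2 - u2 * v1))"
      unfolding det_2_complex T g1_def g2_def h1_def h2_def by algebra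
    then show "invertible T" using b D \<tau> by (simp add: invertible_det_nz \<theta>_def)
    show "T ** Y = line_projection b1 b2"
      unfolding mat2_eq_iff mat2_nth T line_projection_nth lin gY hY by simp
    show "T ** X = mat 1 - line_projection b1 b2 + \<rho> *\<^sub>R line_projection b1 b2"
      unfolding mat2_eq_iff mat2_nth T line_projection_nth vector_add_component vector_minus_component
        vector_scaleR_component scaleR_conv_of_real[where 'a=complex] mat2_nth lin gX hX
      by (intro conjI; (use b in algebra | simp add: algebra_simps))
  qed
qed

lemma normal_form:
  assumes rk: "rank (bmat r X Y) = 2" and sa: "X ** adjoint_matrix Y = Y ** adjoint_matrix X"
  obtains P S where "normal_pair P S" "bc_class (bmat r X Y) = bc_class (bmat r (mat 1 - P - S) P)"
    "(det Y \<noteq> 0 \<and> P = mat 1) \<or> (Y = 0 \<and> P = 0) \<or>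
     (det Y = 0 \<and> Y \<noteq> 0 \<and> (\<exists>b1 b2. cnj b1 * b1 + cnj b2 * b2 = 1 \<and> P = line_projection b1 b2))"
proof -
  consider "det Y \<noteq> 0" | "Y = 0" | "det Y = 0" "Y \<noteq> 0" by blast
  then show thesis
  proof cases
    case 1
    from normal_form_invertible[OF this sa] obtain T S where
      T: "invertible T" "T ** Y = mat 1" "T ** X = - S" and S: "adjoint_matrix S = S" by metis
    have "normal_pair (mat 1) S"
      using S by (simp add: normal_pair_def mat2_eq_iff)
    moreover have "bc_class (bmat r X Y) = bc_class (bmat r (mat 1 - mat 1 - S) (mat 1))"
      using bc_class_mult[OF T(1), of "bmat r X Y"] T by (simp add: bmat_mult)
    ultimately show thesis using 1 by (intro that[of "mat 1" S]) auto
  next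
    case 2
    have "det X \<noteq> 0"
    proof
      assume "det X = 0"
      then have det: "X$1$1 * X$2$2 = X$1$2 * X$2$1" by (simp add: det_2_complex)
      have *: "c = 0 \<and> d = 0" if "c * X$1$1 + d * X$2$1 = 0" "c * X$1$2 + d * X$2$2 = 0" for c d
        using bmat_rankD[OF rk that] 2 by simp
      have "X$2$1 = 0 \<and> - X$1$1 = 0" "X$2$2 = 0 \<and> - X$1$2 = 0"
        by (intro *; use det in \<open>simp add: mult.commute\<close>)+
      then show False using *[of 1 1] by simp
    qed
    then obtain T where T: "T ** X = mat 1" "X ** T = mat 1"
      using invertible_det_nz[of X] by (auto simp: invertible_def)
    then have "invertible T" by (auto simp: invertible_def)
    moreover have "T ** Y = 0" using 2 by (simp add: mat2_eq_iff)
    ultimately have "bc_class (bmat r X Y) = bc_class (bmat r (mat 1 - 0 - 0) 0)"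
      using bc_class_mult[of T "bmat r X Y"] T by (simp add: bmat_mult)
    moreover have "normal_pair 0 0"
      by (simp add: normal_pair_def mat2_eq_iff)
    ultimately show thesis using 2 by (intro that[of 0 0]) auto
  next
    case 3
    from normal_form_rank_one[OF this rk sa] obtain T b1 b2 \<rho> where
      T: "invertible T" and b: "cnj b1 * b1 + cnj b2 * b2 = 1"
      and TY: "T ** Y = line_projection b1 b2"
      and TX: "T ** X = mat 1 - line_projection b1 b2 + \<rho> *\<^sub>R line_projection b1 b2" .
    let ?P = "line_projection b1 b2" and ?S = "- (\<rho> *\<^sub>R line_projection b1 b2)"
    have PP: "?P ** ?P = ?P"
      unfolding mat2_eq_iff mat2_nth line_projection_nth by (intro conjI; use b in algebra)
    have aP: "adjoint_matrix ?P = ?P" by (simp add: mat2_eq_iff mult.commute)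
    have "?P ** ?S = - (\<rho> *\<^sub>R (?P ** ?P))"
      by (simp add: mat2_eq_iff algebra_simps)
    then have "normal_pair ?P ?S"
      using PP aP by (simp add: normal_pair_def) (simp add: mat2_eq_iff)
    moreover have "bc_class (bmat r X Y) = bc_class (bmat r (mat 1 - ?P - ?S) ?P)"
      using bc_class_mult[OF T(1), of "bmat r X Y"] TX TY by (simp add: bmat_mult)
    ultimately show thesis using 3 b by (intro that[of ?P ?S]) auto
  qed
qed

lemma selfadjoint_mult:
  assumes "X ** adjoint_matrix Y = Y ** adjoint_matrix X"
  shows "(T ** X) ** adjoint_matrix (T ** Y) = (T ** Y) ** adjoint_matrix (T ** X)"
proof -
  have adj: "adjoint_matrix (A ** B) = adjoint_matrix B ** adjoint_matrix A" for A B
    by (simp add: mat2_eq_iff mult.commute)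
  have "(T ** X) ** adjoint_matrix (T ** Y) = T ** (X ** adjoint_matrix Y) ** adjoint_matrix T"
    by (simp add: adj matrix_mul_assoc)
  also have "\<dots> = (T ** Y) ** adjoint_matrix (T ** X)"
    unfolding assms by (simp add: adj matrix_mul_assoc)
  finally show ?thesis .
qed

section \<open>The four charts and the exceptional set\<close>

text \<open>The diagonal matrix of \<open>d\<close>, \<open>e\<close> times the inverse of the
  matrix with columns \<open>p\<close> and \<open>q\<close>. It brings the two pivot columns of a
  chart to their prescribed values.\<close>

lemma columns_to:
  fixes p1 p2 q1 q2 :: complex
  assumes "p1 * q2 - p2 * q1 \<noteq> 0" "d \<noteq> 0" "e \<noteq> 0"
  obtains T :: "complex^2^2" where "invertible T"
    "T$1$1 * p1 + T$1$2 * p2 = d" "T$2$1 * p1 + T$2$2 * p2 = 0"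
    "T$1$1 * q1 + T$1$2 * q2 = 0" "T$2$1 * q1 + T$2$2 * q2 = e"
proof -
  define k where "k = 1 / (p1 * q2 - p2 * q1)"
  have k: "k * (p1 * q2 - p2 * q1) = 1" using assms by (simp add: k_def)
  define T :: "complex^2^2" where "T = vector [vector [d * k * q2, - d * k * q1], vector [- e * k * p2, e * k * p1]]"
  have T [simp]: "T$1$1 = d * k * q2" "T$1$2 = - d * k * q1" "T$2$1 = - e * k * p2" "T$2$2 = e * k * p1"
    by (simp_all add: T_def)
  have "det T = d * e * k"
    unfolding det_2_complex T using k by algebra
  moreover have "k \<noteq> 0" using assms by (simp add: k_def)
  ultimately have "invertible T" using assms by (simp add: invertible_det_nz)
  then show thesis
  proof (rule that)
    show "T$1$1 * p1 + T$1$2 * p2 = d" "T$2$1 * p1 + T$2$2 * p2 = 0"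
      "T$1$1 * q1 + T$1$2 * q2 = 0" "T$2$1 * q1 + T$2$2 * q2 = e"
      unfolding T using k by algebra+
  qed
qed

text \<open>The four minors take one column from each end, and belong to the four charts. If all
  vanish, self-adjointness also kills the two minors within one end, and a matrix whose six minors
  vanish cannot have rank 2.\<close>

lemma chart_minor_nonzero:
  assumes rk: "rank (bmat r X Y) = 2" and sa: "X ** adjoint_matrix Y = Y ** adjoint_matrix X"
  shows "X$1$1 * X$2$2 - X$2$1 * X$1$2 \<noteq> 0 \<or> X$1$1 * Y$2$2 - X$2$1 * Y$1$2 \<noteq> 0 \<or>
    Y$1$1 * X$2$2 - Y$2$1 * X$1$2 \<noteq> 0 \<or> Y$1$1 * Y$2$2 - Y$2$1 * Y$1$2 \<noteq> 0"
proof (rule ccontr)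
  assume "\<not> ?thesis"
  then have m: "X$1$1 * X$2$2 - X$2$1 * X$1$2 = 0" "X$1$1 * Y$2$2 - X$2$1 * Y$1$2 = 0"
    "Y$1$1 * X$2$2 - Y$2$1 * X$1$2 = 0" "Y$1$1 * Y$2$2 - Y$2$1 * Y$1$2 = 0" by auto
  have sa': "X$1$1 * cnj (Y$1$1) + X$1$2 * cnj (Y$1$2) = Y$1$1 * cnj (X$1$1) + Y$1$2 * cnj (X$1$2)"
    "X$1$1 * cnj (Y$2$1) + X$1$2 * cnj (Y$2$2) = Y$1$1 * cnj (X$2$1) + Y$1$2 * cnj (X$2$2)"
    "X$2$1 * cnj (Y$1$1) + X$2$2 * cnj (Y$1$2) = Y$2$1 * cnj (X$1$1) + Y$2$2 * cnj (X$1$2)"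
    "X$2$1 * cnj (Y$2$1) + X$2$2 * cnj (Y$2$2) = Y$2$1 * cnj (X$2$1) + Y$2$2 * cnj (X$2$2)"
    using sa unfolding mat2_eq_iff by auto
  \<comment> \<open>Were these two columns independent, both remaining columns would vanish, as all
    their minors with these two do. Self-adjointness then reduces to the left end alone and forces
    the minor to be zero after all.\<close>
  have m5: "X$1$1 * Y$2$1 - X$2$1 * Y$1$1 = 0"
  proof (rule ccontr)
    assume D: "\<not> ?thesis"
    have "(X$1$1 * Y$2$1 - X$2$1 * Y$1$1) * t = 0" if "t \<in> {X$1$2, X$2$2, Y$1$2, Y$2$2}" for t
      using that m unfolding insert_iff empty_iff by (elim disjE FalseE; hypsubst; algebra)
    then have "X$1$2 = 0" "X$2$2 = 0" "Y$1$2 = 0" "Y$2$2 = 0" using D by auto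
    with sa' have "X$1$1 * cnj (Y$1$1) = Y$1$1 * cnj (X$1$1)" "X$1$1 * cnj (Y$2$1) = Y$1$1 * cnj (X$2$1)"
      "X$2$1 * cnj (Y$1$1) = Y$2$1 * cnj (X$1$1)" "X$2$1 * cnj (Y$2$1) = Y$2$1 * cnj (X$2$1)"
      by simp_all
    then have "(X$1$1 * Y$2$1 - X$2$1 * Y$1$1) * cnj (Y$1$1) = 0" "(X$1$1 * Y$2$1 - X$2$1 * Y$1$1) * cnj (Y$2$1) = 0"
      by algebra+
    then show False using D by auto
  qed
  have m6: "X$1$2 * Y$2$2 - X$2$2 * Y$1$2 = 0"
  proof (rule ccontr)
    assume D: "\<not> ?thesis"
    have "(X$1$2 * Y$2$2 - X$2$2 * Y$1$2) * t = 0" if "t \<in> {X$1$1, X$2$1, Y$1$1, Y$2$1}" for t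
      using that m unfolding insert_iff empty_iff by (elim disjE FalseE; hypsubst; algebra)
    then have "X$1$1 = 0" "X$2$1 = 0" "Y$1$1 = 0" "Y$2$1 = 0" using D by auto
    with sa' have "X$1$2 * cnj (Y$1$2) = Y$1$2 * cnj (X$1$2)" "X$1$2 * cnj (Y$2$2) = Y$1$2 * cnj (X$2$2)"
      "X$2$2 * cnj (Y$1$2) = Y$2$2 * cnj (X$1$2)" "X$2$2 * cnj (Y$2$2) = Y$2$2 * cnj (X$2$2)"
      by simp_all
    then have "(X$1$2 * Y$2$2 - X$2$2 * Y$1$2) * cnj (Y$1$2) = 0" "(X$1$2 * Y$2$2 - X$2$2 * Y$1$2) * cnj (Y$2$2) = 0"
      by algebra+
    then show False using D by auto
  qed
  note rkD = bmat_rankD[OF rk]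
  have "X$2$1 = 0 \<and> - X$1$1 = 0" by (rule rkD; use m m5 in \<open>simp add: algebra_simps\<close>)
  moreover have "X$2$2 = 0 \<and> - X$1$2 = 0" by (rule rkD; use m m6 in \<open>simp add: algebra_simps\<close>)
  moreover have "Y$2$1 = 0 \<and> - Y$1$1 = 0" by (rule rkD; use m m5 in \<open>simp add: algebra_simps\<close>)
  moreover have "Y$2$2 = 0 \<and> - Y$1$2 = 0" by (rule rkD; use m m6 in \<open>simp add: algebra_simps\<close>)
  ultimately show False using rkD[of 1 1] by simp
qed

text \<open>Row operations normalise the pivot columns of a nonzero minor; self-adjointness then
  makes the diagonal parameters real and the off-diagonal ones conjugate up to sign.\<close>

lemma BC_chart_cases:
  assumes "C \<in> BC"
  obtains a b z where "C = O13 a b z" | a b z where "C = O14 a b z"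
    | a b z where "C = O23 a b z" | a b z where "C = O24 a b z"
proof -
  obtain X Y where C: "C = bc_class (bmat 0 X Y)" "rank (bmat 0 X Y) = 2"
    "X ** adjoint_matrix Y = Y ** adjoint_matrix X"
    using BC_bmat[OF assms] by metis
  have real: "t = cnj t \<Longrightarrow> t = of_real (Re t)" for t :: complex
    by (simp add: complex_eq_iff)
  have tr: "C = bc_class (bmat 0 (T ** X) (T ** Y)) \<and>
      (T ** X) ** adjoint_matrix (T ** Y) = (T ** Y) ** adjoint_matrix (T ** X)" if "invertible T" for T
    using bc_class_mult[OF that, of "bmat 0 X Y"] selfadjoint_mult[OF C(3)] C(1) by (simp add: bmat_mult)
  note [simp del] = mat2_nth(1)
  from chart_minor_nonzero[OF C(2,3)] consider
    "X$1$1 * X$2$2 - X$2$1 * X$1$2 \<noteq> 0" | "X$1$1 * Y$2$2 - X$2$1 * Y$1$2 \<noteq> 0" |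
    "Y$1$1 * X$2$2 - Y$2$1 * X$1$2 \<noteq> 0" | "Y$1$1 * Y$2$2 - Y$2$1 * Y$1$2 \<noteq> 0" by blast
  then show thesis
  proof cases
    case 1
    then obtain T :: "complex^2^2" where T: "invertible T" and
      e: "(T ** X)$1$1 = 1" "(T ** X)$2$1 = 0" "(T ** X)$1$2 = 0" "(T ** X)$2$2 = -1"
      using columns_to[of "X$1$1" "X$2$2" "X$2$1" "X$1$2" 1 "-1"] by (auto simp: mat2_nth(1))
    define X' Y' where XY: "X' = T ** X" "Y' = T ** Y"
    note t = tr[OF T, folded XY] and e = e[folded XY]
    have s: "Y'$1$1 = cnj (Y'$1$1)" "Y'$2$2 = cnj (Y'$2$2)" "- Y'$1$2 = cnj (Y'$2$1)"
      using t by (auto simp: mat2_eq_iff mat2_nth(1) e)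
    have "C = O13 (Re (Y'$1$1)) (- Re (Y'$2$2)) (Y'$2$1)"
      unfolding O13_def t[THEN conjunct1] by (rule arg_cong[of _ _ bc_class])
        (use real[OF s(1), symmetric] real[OF s(2), symmetric] s(3) in \<open>simp add: vec4_eq_iff e\<close>)
    then show thesis by (rule that(1))
  next
    case 2
    then obtain T :: "complex^2^2" where T: "invertible T" and
      e: "(T ** X)$1$1 = 1" "(T ** X)$2$1 = 0" "(T ** Y)$1$2 = 0" "(T ** Y)$2$2 = -1"
      using columns_to[of "X$1$1" "Y$2$2" "X$2$1" "Y$1$2" 1 "-1"] by (auto simp: mat2_nth(1))
    define X' Y' where XY: "X' = T ** X" "Y' = T ** Y"
    note t = tr[OF T, folded XY] and e = e[folded XY]
    have s: "Y'$1$1 = cnj (Y'$1$1)" "X'$2$2 = cnj (X'$2$2)" "X'$1$2 = cnj (Y'$2$1)"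
      using t by (auto simp: mat2_eq_iff mat2_nth(1) e)
    have "C = O14 (Re (Y'$1$1)) (Re (X'$2$2)) (Y'$2$1)"
      unfolding O14_def t[THEN conjunct1] by (rule arg_cong[of _ _ bc_class])
        (use real[OF s(1), symmetric] real[OF s(2), symmetric] s(3) in \<open>simp add: vec4_eq_iff e\<close>)
    then show thesis by (rule that(2))
  next
    case 3
    then obtain T :: "complex^2^2" where T: "invertible T" and
      e: "(T ** Y)$1$1 = -1" "(T ** Y)$2$1 = 0" "(T ** X)$1$2 = 0" "(T ** X)$2$2 = -1"
      using columns_to[of "Y$1$1" "X$2$2" "Y$2$1" "X$1$2" "-1" "-1"] by (auto simp: mat2_nth(1))
    define X' Y' where XY: "X' = T ** X" "Y' = T ** Y"
    note t = tr[OF T, folded XY] and e = e[folded XY]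
    have s: "X'$1$1 = cnj (X'$1$1)" "Y'$2$2 = cnj (Y'$2$2)" "Y'$1$2 = - cnj (X'$2$1)"
      using t by (auto simp: mat2_eq_iff mat2_nth(1) e)
    have "C = O23 (Re (X'$1$1)) (- Re (Y'$2$2)) (X'$2$1)"
      unfolding O23_def t[THEN conjunct1] by (rule arg_cong[of _ _ bc_class])
        (use real[OF s(1), symmetric] real[OF s(2), symmetric] s(3) in \<open>simp add: vec4_eq_iff e\<close>)
    then show thesis by (rule that(3))
  next
    case 4
    then obtain T :: "complex^2^2" where T: "invertible T" and
      e: "(T ** Y)$1$1 = -1" "(T ** Y)$2$1 = 0" "(T ** Y)$1$2 = 0" "(T ** Y)$2$2 = -1"
      using columns_to[of "Y$1$1" "Y$2$2" "Y$2$1" "Y$1$2" "-1" "-1"] by (auto simp: mat2_nth(1))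
    define X' Y' where XY: "X' = T ** X" "Y' = T ** Y"
    note t = tr[OF T, folded XY] and e = e[folded XY]
    have s: "X'$1$1 = cnj (X'$1$1)" "X'$2$2 = cnj (X'$2$2)" "X'$1$2 = cnj (X'$2$1)"
      using t[THEN conjunct2, unfolded mat2_eq_iff mat2_nth(1) adjoint_matrix_nth e
          complex_cnj_minus complex_cnj_one complex_cnj_zero] by algebra+
    have "C = O24 (Re (X'$1$1)) (Re (X'$2$2)) (X'$2$1)"
      unfolding O24_def t[THEN conjunct1] by (rule arg_cong[of _ _ bc_class])
        (use real[OF s(1), symmetric] real[OF s(2), symmetric] s(3) in \<open>simp add: vec4_eq_iff e\<close>)
    then show thesis by (rule that(4))
  qed
qed

lemma chart_bmat:
  "O13 a b z = bc_class (bmat r (vector [vector [1, 0], vector [0, -1]])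
     (vector [vector [of_real (a - r), - cnj z], vector [z, - of_real b]]))"
  "O14 a b z = bc_class (bmat r (vector [vector [1, cnj z], vector [0, of_real b]])
     (vector [vector [of_real (a - r), 0], vector [z, -1]]))"
  "O23 a b z = bc_class (bmat r (vector [vector [of_real a, 0], vector [z, -1]])
     (vector [vector [of_real (- 1 - r * a), - cnj z], vector [- of_real r * z, - of_real b]]))"
  "O24 a b z = bc_class (bmat r (vector [vector [of_real a, cnj z], vector [z, of_real b]])
     (vector [vector [of_real (- 1 - r * a), 0], vector [- of_real r * z, -1]]))"
  unfolding O13_def O14_def O23_def O24_def
  by (rule arg_cong[of _ _ bc_class], simp add: vec4_eq_iff)+

lemma det_zero_bc_class:
  assumes "bc_class (bmat r X Y) = bc_class (bmat r X' Y')"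
  shows "det Y = 0 \<longleftrightarrow> det Y' = 0"
proof -
  obtain T where T: "invertible T" "bmat r X Y = T ** bmat r X' Y'"
    using bc_class_eqD[OF assms] by blast
  then have "det Y = det T * det Y'" by (simp add: bmat_mult bmat_eq_iff det_mul)
  then show ?thesis using T by (simp add: invertible_det_nz)
qed

lemma f_of_nonzero: "\<omega> \<in> Omega N \<Longrightarrow> n \<le> N \<Longrightarrow> f_of \<omega> n \<noteq> 0"
  by (auto simp: Omega_def f_of_def PiE_iff)

text \<open>With \<open>f = f_of \<omega> 0\<close>, the determinant of the \<open>Y\<close> part of
  a chart is, up to a nonzero factor, \<open>(a - 1/f) b - |z|^2\<close>, \<open>a - 1/f\<close>,
  \<open>(a + f) b - |z|^2\<close> or \<open>a + f\<close>; its vanishing does not depend on the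
  representative.\<close>

lemma P_exc_iff_det:
  assumes \<omega>: "\<omega> \<in> Omega N" and C: "bc_class (bmat (1 / f_of \<omega> 0) X Y) \<in> BC"
  shows "(\<omega>, bc_class (bmat (1 / f_of \<omega> 0) X Y)) \<in> P_exc N \<longleftrightarrow> det Y = 0"
proof -
  define f where "f = f_of \<omega> 0"
  have f: "f \<noteq> 0" using f_of_nonzero[OF \<omega>] by (simp add: f_def)
  let ?r = "1 / f"
  let ?C = "bc_class (bmat ?r X Y)"
  have d: "?C = O13 a b z \<Longrightarrow> det Y = 0 \<longleftrightarrow> (a - 1 / f) * b = (cmod z)\<^sup>2"
    "?C = O14 a b z \<Longrightarrow> det Y = 0 \<longleftrightarrow> a = 1 / f"
    "?C = O23 a b z \<Longrightarrow> det Y = 0 \<longleftrightarrow> (a + f) * b = (cmod z)\<^sup>2"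
    "?C = O24 a b z \<Longrightarrow> det Y = 0 \<longleftrightarrow> a = - f" for a b z
  proof -
    have r: "complex_of_real x = 0 \<longleftrightarrow> x = 0" for x by simp
    have n: "cnj z * z = of_real ((cmod z)\<^sup>2)" by (simp only: complex_norm_square mult.commute)
    assume "?C = O13 a b z"
    from det_zero_bc_class[OF this[unfolded chart_bmat(1)[of _ _ _ ?r]]]
    have "det Y = 0 \<longleftrightarrow> - (of_real ((a - ?r) * b) - cnj z * z) = 0"
      by (simp add: det_2_complex)
    also have "\<dots> \<longleftrightarrow> (a - 1 / f) * b = (cmod z)\<^sup>2"
      unfolding n neg_equal_0_iff_equal of_real_diff[symmetric] r by simp
    finally show "det Y = 0 \<longleftrightarrow> (a - 1 / f) * b = (cmod z)\<^sup>2" .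
  next
    assume "?C = O14 a b z"
    from det_zero_bc_class[OF this[unfolded chart_bmat(2)[of _ _ _ ?r]]]
    have "det Y = 0 \<longleftrightarrow> complex_of_real (a - ?r) = 0"
      by (simp add: det_2_complex del: of_real_diff of_real_divide)
    then show "det Y = 0 \<longleftrightarrow> a = 1 / f" unfolding of_real_eq_0_iff by simp
  next
    have n: "cnj z * z = of_real ((cmod z)\<^sup>2)" by (simp only: complex_norm_square mult.commute)
    assume "?C = O23 a b z"
    from det_zero_bc_class[OF this[unfolded chart_bmat(3)[of _ _ _ ?r]]]
    have "det Y = 0 \<longleftrightarrow> of_real ((1 + ?r * a) * b) - of_real ?r * (cnj z * z) = 0"
      by (simp add: det_2_complex algebra_simps)
    also have "\<dots> \<longleftrightarrow> (1 + ?r * a) * b - ?r * (cmod z)\<^sup>2 = 0"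
      unfolding n of_real_mult[symmetric] of_real_diff[symmetric] of_real_eq_0_iff ..
    also have "(1 + ?r * a) * b - ?r * (cmod z)\<^sup>2 = ((a + f) * b - (cmod z)\<^sup>2) / f"
      using f by (simp add: field_simps)
    also have "\<dots> = 0 \<longleftrightarrow> (a + f) * b = (cmod z)\<^sup>2"
      using f by simp
    finally show "det Y = 0 \<longleftrightarrow> (a + f) * b = (cmod z)\<^sup>2" .
  next
    assume "?C = O24 a b z"
    from det_zero_bc_class[OF this[unfolded chart_bmat(4)[of _ _ _ ?r]]]
    have "det Y = 0 \<longleftrightarrow> complex_of_real (1 + ?r * a) = 0"
      by (simp add: det_2_complex algebra_simps eq_neg_iff_add_eq_0 minus_equation_iff)
    then show "det Y = 0 \<longleftrightarrow> a = - f" unfolding of_real_eq_0_iff using f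
      by (simp add: field_simps eq_neg_iff_add_eq_0)
  qed
  show ?thesis
    unfolding f_def[symmetric]
  proof
    assume "(\<omega>, ?C) \<in> P_exc N"
    then show "det Y = 0"
      unfolding P_exc_def P13_def P14_def P23_def P24_def using d by (auto simp: f_def)
  next
    assume 0: "det Y = 0"
    from C[folded f_def] show "(\<omega>, ?C) \<in> P_exc N"
    proof (cases rule: BC_chart_cases)
      case (1 a b z)
      from d(1)[OF this, THEN iffD1, OF 0] this \<omega> have "(\<omega>, ?C) \<in> P13 N"
        unfolding P13_def mem_Collect_eq prod.inject f_def by blast
      then show ?thesis by (simp add: P_exc_def)
    next
      case (2 a b z)
      from d(2)[OF this, THEN iffD1, OF 0] this \<omega> have "(\<omega>, ?C) \<in> P14 N"
        unfolding P14_def mem_Collect_eq prod.inject f_def by blast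
      then show ?thesis by (simp add: P_exc_def)
    next
      case (3 a b z)
      from d(3)[OF this, THEN iffD1, OF 0] this \<omega> have "(\<omega>, ?C) \<in> P23 N"
        unfolding P23_def mem_Collect_eq prod.inject f_def by blast
      then show ?thesis by (simp add: P_exc_def)
    next
      case (4 a b z)
      from d(4)[OF this, THEN iffD1, OF 0] this \<omega> have "(\<omega>, ?C) \<in> P24 N"
        unfolding P24_def mem_Collect_eq prod.inject f_def by blast
      then show ?thesis by (simp add: P_exc_def)
    qed
  qed
qed

text \<open>For \<open>Y = 0\<close> the normal form has \<open>P = 0\<close>, and
  \<open>P ** S = S\<close> then forces \<open>S = 0\<close>; so each equation leaves a single
  class.\<close>

lemma P5_iff_zero:
  assumes \<omega>: "\<omega> \<in> Omega N" and rk: "rank (bmat (1 / f_of \<omega> 0) X Y) = 2"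
    and sa: "X ** adjoint_matrix Y = Y ** adjoint_matrix X"
  shows "(\<omega>, bc_class (bmat (1 / f_of \<omega> 0) X Y)) \<in> P5 N \<longleftrightarrow> Y = 0"
proof -
  let ?r = "1 / f_of \<omega> 0"
  have "vector [vector [1, of_real r, 0, 0], vector [0, 0, 1, 0]] = bmat r (mat 1) 0" for r
    by (simp add: vec4_eq_iff)
  then have 5: "P5 N = {(\<omega>, bc_class (bmat (1 / f_of \<omega> 0) (mat 1) 0)) | \<omega>. \<omega> \<in> Omega N}"
    unfolding P5_def by (simp only:)
  show ?thesis
  proof
    assume "(\<omega>, bc_class (bmat ?r X Y)) \<in> P5 N"
    then have "bc_class (bmat ?r X Y) = bc_class (bmat ?r (mat 1) 0)"
      unfolding 5 mem_Collect_eq prod.inject by blast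
    then obtain T where "bmat ?r X Y = T ** bmat ?r (mat 1) 0" by (rule bc_class_eqD)
    then show "Y = 0" by (simp add: bmat_mult bmat_eq_iff mat2_eq_iff)
  next
    assume Y: "Y = 0"
    obtain P S where n: "normal_pair P S" "bc_class (bmat ?r X Y) = bc_class (bmat ?r (mat 1 - P - S) P)"
      "(det Y \<noteq> 0 \<and> P = mat 1) \<or> (Y = 0 \<and> P = 0) \<or> (det Y = 0 \<and> Y \<noteq> 0 \<and>
        (\<exists>b1 b2. cnj b1 * b1 + cnj b2 * b2 = 1 \<and> P = line_projection b1 b2))"
      by (rule normal_form[OF rk sa])
    have "det Y = 0" using Y by (simp add: det_2_complex)
    then have P: "P = 0" using n(3) Y by blast
    have "S = 0" using n(1) P by (simp add: normal_pair_def mat2_eq_iff)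
    then show "(\<omega>, bc_class (bmat ?r X Y)) \<in> P5 N"
      using n(2) P \<omega> unfolding 5 mem_Collect_eq prod.inject by (intro exI[of _ \<omega>]) simp
  qed
qed

section \<open>Weak form of the problem\<close>

definition row_value :: "nat \<Rightarrow> (nat \<Rightarrow> nat \<Rightarrow> complex) \<Rightarrow> (nat \<Rightarrow> complex) \<Rightarrow> nat \<Rightarrow> complex" where
  "row_value N H x i = (\<Sum>j=1..N. H i j * x j)"

text \<open>The couplings of \<open>y_1\<close> to \<open>y_0\<close> and of \<open>y_N\<close> to
  \<open>y_{N+1}\<close> are left out, on the diagonal too. They reappear as the boundary unknowns
  \<open>b\<close>, which keeps the matrix independent of \<open>f_0\<close> and
  \<open>f_N\<close>.\<close>

definition jacobi :: "nat \<Rightarrow> equation \<Rightarrow> nat \<Rightarrow> nat \<Rightarrow> complex" where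
  "jacobi N \<omega> i j =
     (if j = i then of_real (q_of \<omega> i + (if 1 < i then f_of \<omega> (i - 1) else 0) + (if i < N then f_of \<omega> i else 0)) else 0)
     - (if j = Suc i then of_real (f_of \<omega> i) else 0) - (if i = Suc j then of_real (f_of \<omega> j) else 0)"

definition corner :: "nat \<Rightarrow> complex^2^2 \<Rightarrow> nat \<Rightarrow> nat \<Rightarrow> complex" where
  "corner N S i j =
     (if i = 1 then (if j = 1 then S$1$1 else 0) + (if j = N then S$1$2 else 0) else 0) +
     (if i = N then (if j = 1 then S$2$1 else 0) + (if j = N then S$2$2 else 0) else 0)"

definition stiffness :: "nat \<Rightarrow> equation \<Rightarrow> complex^2^2 \<Rightarrow> nat \<Rightarrow> nat \<Rightarrow> complex" where
  "stiffness N \<omega> S i j = jacobi N \<omega> i j + corner N S i j"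

definition weight :: "equation \<Rightarrow> nat \<Rightarrow> nat \<Rightarrow> complex" where
  "weight \<omega> i j = (if j = i then of_real (w_of \<omega> i) else 0)"

definition ends :: "nat \<Rightarrow> (nat \<Rightarrow> complex) \<Rightarrow> complex^2" where
  "ends N x = vector [x 1, x N]"

definition form_domain :: "nat \<Rightarrow> complex^2^2 \<Rightarrow> (nat \<Rightarrow> complex) set" where
  "form_domain N P = {x \<in> supp_space N. P *v ends N x = ends N x}"

lemma ends_nth [simp]: "ends N x $ 1 = x 1" "ends N x $ 2 = x N"
  by (simp_all add: ends_def)

lemma form_row: "form N H x z = (\<Sum>i=1..N. row_value N H x i * cnj (z i))"
  by (simp add: form_def row_value_def sum_distrib_right)

lemma row_jacobi:
  assumes "i \<in> {1..N}"
  shows "row_value N (jacobi N \<omega>) x i = of_real (q_of \<omega> i) * x i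
    + (if 1 < i then of_real (f_of \<omega> (i - 1)) * (x i - x (i - 1)) else 0)
    - (if i < N then of_real (f_of \<omega> i) * (x (i + 1) - x i) else 0)"
proof -
  have 1: "(\<Sum>j=1..N. (if j = i then c else 0) * x j) = c * x i" for c
    using assms by (simp add: if_distrib if_distribR cong: if_cong)
  have 2: "(\<Sum>j=1..N. (if j = Suc i then c else 0) * x j) = (if i < N then c * x (i + 1) else 0)" for c
    using assms by (simp add: if_distrib if_distribR cong: if_cong)
  have "(\<Sum>j=1..N. (if i = Suc j then of_real (f_of \<omega> j) else 0) * x j) =
      (\<Sum>j=1..N. if j = i - 1 then (if 1 < i then of_real (f_of \<omega> (i - 1)) * x (i - 1) else 0) else 0)"
    using assms by (intro sum.cong) auto
  also have "\<dots> = (if 1 < i then of_real (f_of \<omega> (i - 1)) * x (i - 1) else 0)"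
    using assms by auto
  finally have 3: "(\<Sum>j=1..N. (if i = Suc j then of_real (f_of \<omega> j) else 0) * x j) =
      (if 1 < i then of_real (f_of \<omega> (i - 1)) * x (i - 1) else 0)" .
  show ?thesis
    unfolding row_value_def jacobi_def left_diff_distrib sum_subtractf 1 2 3
    by (simp add: algebra_simps)
qed

lemma row_corner:
  assumes "2 \<le> N" "i \<in> {1..N}"
  shows "row_value N (corner N S) x i =
    (if i = 1 then (S *v ends N x)$1 else 0) + (if i = N then (S *v ends N x)$2 else 0)"
proof -
  have 1: "(\<Sum>j=1..N. (if j = k then c else 0) * x j) = c * x k" if "k \<in> {1..N}" for c k
    using that by (simp add: if_distrib if_distribR cong: if_cong)
  have k: "1 \<in> {1..N}" "N \<in> {1..N}" using assms by auto
  show ?thesis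
    unfolding row_value_def corner_def using 1[OF k(1)] 1[OF k(2)] assms
    by (cases "i = 1"; cases "i = N") (simp_all add: distrib_right sum.distrib)
qed

lemma row_stiffness: "row_value N (stiffness N \<omega> S) x i = row_value N (jacobi N \<omega>) x i + row_value N (corner N S) x i"
  by (simp add: row_value_def stiffness_def distrib_right sum.distrib)

lemma row_weight: "i \<in> {1..N} \<Longrightarrow> row_value N (weight \<omega>) x i = of_real (w_of \<omega> i) * x i"
  by (simp add: row_value_def weight_def if_distrib if_distribR cong: if_cong)

lemma row_restrict: "row_value N H (\<lambda>n. if n \<in> {1..N} then y n else 0) i = row_value N H y i"
  by (auto simp: row_value_def intro!: sum.cong)

lemma hermitian_weight: "hermitian N (weight \<omega>)"
  by (simp add: hermitian_def weight_def)

lemma hermitian_jacobi: "hermitian N (jacobi N \<omega>)"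
  by (auto simp: hermitian_def jacobi_def)

lemma hermitian_corner:
  assumes "adjoint_matrix S = S" "2 \<le> N"
  shows "hermitian N (corner N S)"
proof -
  have "cnj (S$1$1) = S$1$1" "cnj (S$1$2) = S$2$1" "cnj (S$2$1) = S$1$2" "cnj (S$2$2) = S$2$2"
    using assms(1) unfolding mat2_eq_iff adjoint_matrix_nth by simp_all
  then show ?thesis
    using assms(2) by (auto simp: hermitian_def corner_def)
qed

lemma hermitian_stiffness:
  assumes "adjoint_matrix S = S" "2 \<le> N"
  shows "hermitian N (stiffness N \<omega> S)"
  unfolding hermitian_def stiffness_def
proof (intro ballI)
  fix i j assume "i \<in> {1..N}" "j \<in> {1..N}"
  from hermitianD[OF hermitian_jacobi this] hermitianD[OF hermitian_corner[OF assms] this]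
  show "jacobi N \<omega> j i + corner N S j i = cnj (jacobi N \<omega> i j + corner N S i j)"
    by (metis complex_cnj_add)
qed

lemma w_of_pos: "\<omega> \<in> Omega N \<Longrightarrow> i \<in> {1..N} \<Longrightarrow> 0 < w_of \<omega> i"
  by (auto simp: Omega_def w_of_def PiE_iff)

lemma positive_weight:
  assumes "\<omega> \<in> Omega N"
  shows "positive_form N (weight \<omega>)"
  unfolding positive_form_def
proof (intro ballI impI)
  fix x assume x: "x \<in> supp_space N" "x \<noteq> 0"
  then obtain i where i: "x i \<noteq> 0" by (auto simp: fun_eq_iff)
  then have iN: "i \<in> {1..N}" using x by (auto simp: supp_space_def)
  have "form N (weight \<omega>) x x = (\<Sum>i=1..N. of_real (w_of \<omega> i) * (x i * cnj (x i)))"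
    unfolding form_row by (intro sum.cong refl) (simp add: row_weight)
  also have "\<dots> = of_real (\<Sum>i=1..N. w_of \<omega> i * (cmod (x i))\<^sup>2)"
    unfolding complex_norm_square[symmetric] by simp
  finally have "Re (form N (weight \<omega>) x x) = (\<Sum>i=1..N. w_of \<omega> i * (cmod (x i))\<^sup>2)" by simp
  also have "0 < \<dots>"
    using i iN w_of_pos[OF assms] by (intro sum_pos2[where i = i]) (auto intro!: mult_nonneg_nonneg less_imp_le[OF w_of_pos[OF assms]])
  finally show "0 < Re (form N (weight \<omega>) x x)" .
qed

lemma subspace_form_domain: "cseq.subspace (form_domain N P)"
proof -
  have 1: "ends N (x + y) = ends N x + ends N y" "ends N (\<lambda>n. c * x n) = c *s ends N x" "ends N 0 = 0"
    for x y and c :: complex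
    by (simp_all add: vec_eq_iff forall_2)
  show ?thesis
    using subspace_supp_space[of N] unfolding cseq.subspace_def form_domain_def mem_Collect_eq 1
    by (simp add: matrix_vector_right_distrib vector_scalar_commute)
qed

lemma closed_form_domain: "closed (form_domain N P)"
proof -
  have "form_domain N P = supp_space N \<inter> ({x. P$1$1 * x 1 + P$1$2 * x N = x 1} \<inter> {x. P$2$1 * x 1 + P$2$2 * x N = x N})"
    by (auto simp: form_domain_def vec_eq_iff forall_2)
  then show ?thesis
    by (auto intro!: closed_Int closed_supp_space closed_Collect_eq continuous_intros continuous_on_coordinate)
qed

lemma form_domain_subset: "form_domain N P \<subseteq> supp_space N"
  by (auto simp: form_domain_def)

text \<open>Applying \<open>P\<close> removes the part \<open>a - P a\<close> and leaves
  \<open>P b = S a\<close>; substituting this back gives \<open>P a = a\<close>.\<close>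

lemma normal_pair_condition:
  assumes "normal_pair P S"
  shows "(mat 1 - P - S) *v a + P *v b = 0 \<longleftrightarrow> P *v a = a \<and> P *v b = S *v a"
proof
  have P: "P *v (P *v x) = P *v x" "P *v (S *v x) = S *v x" for x
    using assms by (simp_all only: normal_pair_def matrix_vector_mul_assoc)
  have expand: "(mat 1 - P - S) *v a = a - P *v a - S *v a"
    by (simp add: matrix_vector_mult_diff_rdistrib)
  assume 0: "(mat 1 - P - S) *v a + P *v b = 0"
  then have "P *v (a - P *v a - S *v a + P *v b) = P *v 0" unfolding expand by simp
  then have "P *v b = S *v a"
    by (simp add: matrix_vector_mult_diff_distrib matrix_vector_right_distrib P)
  moreover from this 0 have "P *v a = a" unfolding expand by simp
  ultimately show "P *v a = a \<and> P *v b = S *v a" by simp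
next
  assume "P *v a = a \<and> P *v b = S *v a"
  then show "(mat 1 - P - S) *v a + P *v b = 0"
    by (simp add: matrix_vector_mult_diff_rdistrib)
qed

text \<open>For a solution \<open>y\<close> the residuals in rows \<open>1\<close> and \<open>N\<close> are \<open>f\<^sub>0 \<Delta>y\<^sub>0\<close> and \<open>- f\<^sub>N \<Delta>y\<^sub>N\<close>, and the
  others vanish; so \<open>y\<close> is determined by its entries \<open>y\<^sub>1, \<dots>, y\<^sub>N\<close>.\<close>

definition residual :: "nat \<Rightarrow> equation \<Rightarrow> complex \<Rightarrow> (nat \<Rightarrow> complex) \<Rightarrow> nat \<Rightarrow> complex" where
  "residual N \<omega> l x i = l * of_real (w_of \<omega> i) * x i - row_value N (jacobi N \<omega>) x i"

lemma satisfies_equation_residual: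
  assumes "2 \<le> N"
  shows "satisfies_equation N \<omega> l y \<longleftrightarrow> (\<forall>i\<in>{1..N}. residual N \<omega> l y i =
    (if i = 1 then quasi_diff \<omega> y 0 else 0) + (if i = N then - quasi_diff \<omega> y N else 0))"
  unfolding satisfies_equation_def
proof (intro ball_cong refl)
  fix i assume i: "i \<in> {1..N}"
  define r where "r = (if i = 1 then quasi_diff \<omega> y 0 else 0) + (if i = N then - quasi_diff \<omega> y N else 0)"
  have row: "row_value N (jacobi N \<omega>) y i = of_real (q_of \<omega> i) * y i
      + quasi_diff \<omega> y (i - 1) - quasi_diff \<omega> y i - r"
    unfolding row_jacobi[OF i] quasi_diff_def fdiff_def r_def using i assms by auto
  have eq: "- (v - u) + q = p \<longleftrightarrow> p - (q + u - v - r) = r" for u v p q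
  proof -
    have "p - (q + u - v - r) - r = p - (- (v - u) + q)" by simp
    then show ?thesis by (metis eq_iff_diff_eq_0)
  qed
  show "(- bdiff (quasi_diff \<omega> y) i + of_real (q_of \<omega> i) * y i = l * of_real (w_of \<omega> i) * y i) \<longleftrightarrow>
      residual N \<omega> l y i = (if i = 1 then quasi_diff \<omega> y 0 else 0) + (if i = N then - quasi_diff \<omega> y N else 0)"
    unfolding residual_def bdiff_def row r_def[symmetric] by (rule eq)
qed

definition weak_solutions :: "nat \<Rightarrow> equation \<Rightarrow> complex^2^2 \<Rightarrow> complex^2^2 \<Rightarrow> complex \<Rightarrow> (nat \<Rightarrow> complex) set" where
  "weak_solutions N \<omega> P S l = {x \<in> form_domain N P. \<forall>z\<in>form_domain N P.
     form N (stiffness N \<omega> S) x z = l * form N (weight \<omega>) x z}"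

lemma sum_ends:
  fixes N :: nat
  assumes "2 \<le> N" "\<And>i. i \<in> {1<..<N} \<Longrightarrow> g i = (0::complex)"
  shows "(\<Sum>i=1..N. g i) = g 1 + g N"
proof -
  have "(\<Sum>i=1..N. g i) = (\<Sum>i\<in>{1,N}. g i)"
    using assms by (intro sum.mono_neutral_right) auto
  then show ?thesis using assms by simp
qed

text \<open>Unit vectors at interior indices are admissible test functions and force the interior
  residuals to vanish. Afterwards only the end values of test functions matter: they range over the
  range of \<open>P\<close>, and as \<open>P\<close> is Hermitian, orthogonality to it means being
  annihilated by \<open>P\<close>.\<close>

lemma weak_solutions_iff:
  assumes N: "2 \<le> N" and PS: "normal_pair P S" and x: "x \<in> supp_space N"
  shows "x \<in> weak_solutions N \<omega> P S l \<longleftrightarrow> P *v ends N x = ends N x \<and>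
    (\<forall>i\<in>{1<..<N}. residual N \<omega> l x i = 0) \<and> P *v ends N (residual N \<omega> l x) = S *v ends N x"
    (is "?L \<longleftrightarrow> ?R")
proof -
  \<comment> \<open>The row-wise defect of the strong equation including the corner terms; pairing
    it with a test function gives the defect of the weak equation.\<close>
  define g where "g = (\<lambda>i. residual N \<omega> l x i -
    ((if i = 1 then (S *v ends N x)$1 else 0) + (if i = N then (S *v ends N x)$2 else 0)))"
  have P: "P$1$1 = cnj (P$1$1)" "P$2$1 = cnj (P$1$2)" "P$1$2 = cnj (P$2$1)" "P$2$2 = cnj (P$2$2)"
    using PS unfolding normal_pair_def mat2_eq_iff adjoint_matrix_nth by simp_all
  have PP: "P *v (P *v u) = P *v u" and PSu: "P *v (S *v u) = S *v u" for u
    using PS by (simp_all only: normal_pair_def matrix_vector_mul_assoc)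
  have weak: "l * form N (weight \<omega>) x z - form N (stiffness N \<omega> S) x z = (\<Sum>i=1..N. g i * cnj (z i))" for z
    unfolding form_row sum_distrib_left sum_subtractf[symmetric]
  proof (intro sum.cong refl)
    fix i assume i: "i \<in> {1..N}"
    show "l * (row_value N (weight \<omega>) x i * cnj (z i)) - row_value N (stiffness N \<omega> S) x i * cnj (z i) = g i * cnj (z i)"
      unfolding row_weight[OF i] row_stiffness row_corner[OF N i] g_def residual_def by (simp only: algebra_simps)
  qed
  have g_ends: "ends N g = ends N (residual N \<omega> l x) - S *v ends N x"
    using N by (simp add: vec_eq_iff forall_2 g_def)
  have g_int: "g i = residual N \<omega> l x i" if "i \<in> {1<..<N}" for i
    using that by (simp add: g_def)
  have weak': "x \<in> weak_solutions N \<omega> P S l \<longleftrightarrow> P *v ends N x = ends N x \<and>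
      (\<forall>z\<in>form_domain N P. (\<Sum>i=1..N. g i * cnj (z i)) = 0)"
    unfolding weak[symmetric] weak_solutions_def form_domain_def using x by auto
  show ?thesis
  proof
    assume ?L
    then have Px: "P *v ends N x = ends N x"
      and w: "\<And>z. z \<in> form_domain N P \<Longrightarrow> (\<Sum>i=1..N. g i * cnj (z i)) = 0"
      unfolding weak' by auto
    have 1: "g i = 0" if "i \<in> {1<..<N}" for i
    proof -
      let ?z = "\<lambda>n. if n = i then 1 else 0 :: complex"
      have "ends N ?z = 0" using that by (auto simp: vec_eq_iff forall_2)
      then have "?z \<in> form_domain N P"
        using that by (auto simp: form_domain_def supp_space_def)
      from w[OF this] show ?thesis
        using that by (simp add: if_distrib if_distribR cong: if_cong)
    qed
    have 2: "P *v ends N g = 0"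
    proof -
      have col: "g 1 * cnj p1 + g N * cnj p2 = 0" if "P *v vector [p1, p2] = vector [p1, p2]" for p1 p2
      proof -
        let ?z = "\<lambda>n. if n = 1 then p1 else if n = N then p2 else 0"
        have "ends N ?z = vector [p1, p2]" using N by (simp add: vec_eq_iff forall_2)
        then have "?z \<in> form_domain N P"
          using N that by (auto simp: form_domain_def supp_space_def)
        from w[OF this] show ?thesis
          using 1 N by (subst (asm) sum_ends[OF N]) auto
      qed
      \<comment> \<open>By idempotence the columns of \<open>P\<close> are themselves admissible end
        values.\<close>
      have "P *v vector [P$1$1, P$2$1] = vector [P$1$1, P$2$1]" "P *v vector [P$1$2, P$2$2] = vector [P$1$2, P$2$2]"
        using PS by (simp_all add: normal_pair_def mat2_eq_iff vec_eq_iff forall_2)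
      from this[THEN col] have "g 1 * P$1$1 + g N * P$1$2 = 0" "g 1 * P$2$1 + g N * P$2$2 = 0"
        using P by metis+
      then show ?thesis by (simp add: vec_eq_iff forall_2 mult.commute)
    qed
    then show ?R
      unfolding g_ends matrix_vector_mult_diff_distrib PSu using Px 1 g_int by simp
  next
    assume R: ?R
    then have 1: "\<And>i. i \<in> {1<..<N} \<Longrightarrow> g i = 0" using g_int by simp
    have 2: "P *v ends N g = 0"
      unfolding g_ends matrix_vector_mult_diff_distrib PSu using R by simp
    show ?L
      unfolding weak'
    proof (intro conjI ballI)
      show "P *v ends N x = ends N x" using R by simp
      fix z assume "z \<in> form_domain N P"
      then have z: "P$1$1 * z 1 + P$1$2 * z N = z 1" "P$2$1 * z 1 + P$2$2 * z N = z N"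
        by (auto simp: form_domain_def vec_eq_iff forall_2)
      have z': "cnj (z 1) = P$1$1 * cnj (z 1) + P$2$1 * cnj (z N)" "cnj (z N) = P$1$2 * cnj (z 1) + P$2$2 * cnj (z N)"
        using arg_cong[OF z(1), of cnj] arg_cong[OF z(2), of cnj] P unfolding complex_cnj_add complex_cnj_mult
        by metis+
      have g: "P$1$1 * g 1 + P$1$2 * g N = 0" "P$2$1 * g 1 + P$2$2 * g N = 0"
        using 2 by (auto simp: vec_eq_iff forall_2)
      have "(\<Sum>i=1..N. g i * cnj (z i)) = g 1 * cnj (z 1) + g N * cnj (z N)"
        using 1 by (intro sum_ends[OF N]) auto
      also have "\<dots> = 0" using z' g by algebra
      finally show "(\<Sum>i=1..N. g i * cnj (z i)) = 0" .
    qed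
  qed
qed

lemma dim_linear_image:
  assumes add: "\<And>x y. R (x + y) = R x + R y" and scale: "\<And>c x. R (\<lambda>n. c * x n) = (\<lambda>n. c * R x n)"
    and V: "cseq.subspace V" and inj: "inj_on R V"
  shows "cseq.dim (R ` V) = cseq.dim V"
proof -
  interpret p: vector_space_pair "\<lambda>(c::complex) (y::nat \<Rightarrow> complex) n. c * y n" "\<lambda>(c::complex) (y::nat \<Rightarrow> complex) n. c * y n"
    by unfold_locales
  have lin: "Vector_Spaces.linear (\<lambda>(c::complex) (y::nat \<Rightarrow> complex) n. c * y n) (\<lambda>(c::complex) (y::nat \<Rightarrow> complex) n. c * y n) R"
    by unfold_locales (auto simp: add scale)
  obtain B where B: "B \<subseteq> V" "cseq.independent B" "V \<subseteq> cseq.span B" "card B = cseq.dim V"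
    using cseq.basis_exists by blast
  have span: "cseq.span B = V" using B(1,3) V cseq.span_minimal by blast
  have "cseq.independent (R ` B)"
    by (rule p.linear_independent_injective_image[OF lin B(2)]) (simp add: span inj)
  moreover have "cseq.span (R ` B) = R ` V"
    using p.linear_span_image[OF lin, of B] span by simp
  ultimately have "cseq.dim (R ` V) = card (R ` B)"
    by (metis cseq.dim_span cseq.dim_eq_card_independent)
  also have "\<dots> = card B" using inj B(1) by (intro card_image inj_on_subset[OF inj])
  finally show ?thesis using B by simp
qed

lemma solutions_iff:
  assumes N: "2 \<le> N" and \<omega>: "\<omega> \<in> Omega N" and PS: "normal_pair P S"
  shows "y \<in> solutions N (\<omega>, bc_class (bmat (1 / f_of \<omega> 0) (mat 1 - P - S) P)) l \<longleftrightarrow>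
    (\<forall>n>N + 1. y n = 0) \<and>
    (\<forall>i\<in>{1..N}. residual N \<omega> l y i =
      (if i = 1 then quasi_diff \<omega> y 0 else 0) + (if i = N then - quasi_diff \<omega> y N else 0)) \<and>
    P *v ends N y = ends N y \<and> P *v vector [quasi_diff \<omega> y 0, - quasi_diff \<omega> y N] = S *v ends N y"
proof -
  have f0: "f_of \<omega> 0 \<noteq> 0" using f_of_nonzero[OF \<omega>] by simp
  show ?thesis
    unfolding solutions_def mem_Collect_eq fst_conv snd_conv satisfies_bc_bmat[OF f0]
      satisfies_equation_residual[OF N] ends_def[symmetric] normal_pair_condition[OF PS] ..
qed

text \<open>Restriction to \<open>{1..N}\<close> loses nothing: \<open>f_0\<close> and
  \<open>f_N\<close> are nonzero, so \<open>y_0\<close> and \<open>y_{N+1}\<close> are recovered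
  from the residuals in rows 1 and \<open>N\<close>.\<close>

lemma solutions_weak_solutions:
  fixes l :: complex
  assumes N: "2 \<le> N" and \<omega>: "\<omega> \<in> Omega N" and PS: "normal_pair P S"
  defines "R \<equiv> \<lambda>y n. if n \<in> {1..N} then y n else (0::complex)"
    and "Sol \<equiv> solutions N (\<omega>, bc_class (bmat (1 / f_of \<omega> 0) (mat 1 - P - S) P)) l"
  shows "R ` Sol = weak_solutions N \<omega> P S l" "inj_on R Sol"
proof -
  have f: "f_of \<omega> 0 \<noteq> 0" "f_of \<omega> N \<noteq> 0" using f_of_nonzero[OF \<omega>] by auto
  note iff = solutions_iff[OF N \<omega> PS, of _ l, folded Sol_def]
  have resR: "residual N \<omega> l (R y) i = residual N \<omega> l y i" if "i \<in> {1..N}" for y i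
    using that unfolding residual_def R_def row_restrict by simp
  have endsR: "ends N (R y) = ends N y" for y
    using N by (simp add: R_def vec_eq_iff forall_2)
  have Rs: "R y \<in> supp_space N" for y by (auto simp: R_def supp_space_def)
  have to_weak: "R y \<in> weak_solutions N \<omega> P S l" if "y \<in> Sol" for y
  proof -
    note y = that[unfolded iff]
    have "ends N (residual N \<omega> l (R y)) = vector [quasi_diff \<omega> y 0, - quasi_diff \<omega> y N]"
      using y N by (simp add: vec_eq_iff forall_2 resR)
    then show ?thesis
      unfolding weak_solutions_iff[OF N PS Rs] endsR using y by (auto simp: resR)
  qed
  have from_weak: "\<exists>y\<in>Sol. R y = x" if x: "x \<in> weak_solutions N \<omega> P S l" for x
  proof -
    have xs: "x \<in> supp_space N" using x by (simp add: weak_solutions_def form_domain_def)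
    note w = x[unfolded weak_solutions_iff[OF N PS xs]]
    \<comment> \<open>The end entries solve \<open>f_0 (x_1 - y_0) = residual_1\<close> and
      \<open>-f_N (y_{N+1} - x_N) = residual_N\<close>.\<close>
    define y where "y = (\<lambda>n. if n = 0 then x 1 - residual N \<omega> l x 1 / of_real (f_of \<omega> 0)
      else if n = N + 1 then x N - residual N \<omega> l x N / of_real (f_of \<omega> N) else x n)"
    have "R y = x" using xs N by (auto simp: R_def y_def supp_space_def fun_eq_iff)
    then have res: "residual N \<omega> l y i = residual N \<omega> l x i" if "i \<in> {1..N}" for i
      using resR[OF that, of y] by simp
    have e: "ends N y = ends N x" using endsR[of y] \<open>R y = x\<close> by simp
    have q: "quasi_diff \<omega> y 0 = residual N \<omega> l x 1" "- quasi_diff \<omega> y N = residual N \<omega> l x N"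
      using f N by (simp_all add: quasi_diff_def fdiff_def y_def)
    have "vector [quasi_diff \<omega> y 0, - quasi_diff \<omega> y N] = ends N (residual N \<omega> l x)"
      unfolding q ends_def ..
    moreover have "y n = 0" if "n > N + 1" for n using xs that by (auto simp: y_def supp_space_def)
    moreover have "residual N \<omega> l y i = (if i = 1 then quasi_diff \<omega> y 0 else 0) + (if i = N then - quasi_diff \<omega> y N else 0)"
      if "i \<in> {1..N}" for i
      unfolding res[OF that] q using w N that by auto
    ultimately have "y \<in> Sol" unfolding iff e using w by auto
    then show ?thesis using \<open>R y = x\<close> by blast
  qed
  show "R ` Sol = weak_solutions N \<omega> P S l" using to_weak from_weak by blast
  show "inj_on R Sol"
  proof (rule inj_onI)
    fix y z assume y: "y \<in> Sol" and z: "z \<in> Sol" and eq: "R y = R z"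
    have mid: "y n = z n" if "n \<in> {1..N}" for n using fun_cong[OF eq, of n] that by (simp add: R_def)
    have res: "residual N \<omega> l y i = residual N \<omega> l z i" if "i \<in> {1..N}" for i
      using resR[OF that, of y] resR[OF that, of z] eq by simp
    have "residual N \<omega> l y 1 = quasi_diff \<omega> y 0" "residual N \<omega> l z 1 = quasi_diff \<omega> z 0"
      "residual N \<omega> l y N = - quasi_diff \<omega> y N" "residual N \<omega> l z N = - quasi_diff \<omega> z N"
      using y z N unfolding iff by auto
    then have "quasi_diff \<omega> y 0 = quasi_diff \<omega> z 0" "quasi_diff \<omega> y N = quasi_diff \<omega> z N"
      using res[of 1] res[of N] N by auto
    then have "y 0 = z 0" "y (N + 1) = z (N + 1)"
      using f mid[of 1] mid[of N] N by (simp_all add: quasi_diff_def fdiff_def)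
    moreover have "y n = z n" if "n > N + 1" for n using y z that unfolding iff by auto
    ultimately show "y = z" using mid
      by (metis (no_types, lifting) ext atLeastAtMost_iff less_one linorder_not_less not_less_eq_eq Suc_eq_plus1 le_antisym)
  qed
qed

lemma sum_singleton_mset: "(\<Sum>i\<in>A. {#a#}) = replicate_mset (card A) a"
  by (induction A rule: infinite_finite_induct) auto

lemma sum_mset_lessThan: "(\<Sum>i<d. {#g i#}) = mset (map g [0..<d])"
  by (induction d) auto

text \<open>Multiplicities are cardinalities of the fibres of \<open>\<mu>\<close>, so summing over
  distinct eigenvalues regroups a sum over indices. The list of eigenvalues with multiplicity is
  then \<open>\<mu>\<close> itself, which is already sorted.\<close>

lemma problem_spectrum:
  assumes N: "2 \<le> N" and \<omega>: "\<omega> \<in> Omega N" and PS: "normal_pair P S"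
    and C: "C = bc_class (bmat (1 / f_of \<omega> 0) (mat 1 - P - S) P)" "C \<in> BC"
  obtains y \<mu> where
    "spectral_basis N (form_domain N P) (stiffness N \<omega> S) (weight \<omega>) (cseq.dim (form_domain N P)) y \<mu>"
    "has_exactly N (\<omega>, C) (cseq.dim (form_domain N P))"
    "\<And>n. n < cseq.dim (form_domain N P) \<Longrightarrow> nth_eigenvalue N n (\<omega>, C) = \<mu> n"
proof -
  have H: "hermitian N (stiffness N \<omega> S)"
    using PS N by (intro hermitian_stiffness) (simp_all add: normal_pair_def)
  define d where "d = cseq.dim (form_domain N P)"
  obtain y \<mu> where sb: "spectral_basis N (form_domain N P) (stiffness N \<omega> S) (weight \<omega>) d y \<mu>"
    using spectral_basis_exists[OF subspace_form_domain form_domain_subset closed_form_domain H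
        hermitian_weight positive_weight[OF \<omega>]] unfolding d_def by blast
  define R where "R = (\<lambda>y n. if n \<in> {1..N} then y n else (0::complex))"
  let ?f = "\<lambda>i. complex_of_real (\<mu> i)"
  have image: "R ` solutions N (\<omega>, C) l = weak_solutions N \<omega> P S l"
    and inj: "inj_on R (solutions N (\<omega>, C) l)" for l
    unfolding C(1) R_def by (rule solutions_weak_solutions[OF N \<omega> PS])+
  have dim: "cseq.dim (solutions N (\<omega>, C) l) = cseq.dim (weak_solutions N \<omega> P S l)" for l
    unfolding image[symmetric]
    by (rule dim_linear_image[symmetric, OF _ _ subspace_solutions[OF C(2)] inj]) (auto simp: R_def fun_eq_iff)
  have weak: "weak_solutions N \<omega> P S l = cseq.span (y ` {i. i < d \<and> ?f i = l})" for l
    unfolding weak_solutions_def by (rule weak_eigenspace[OF sb subspace_form_domain H hermitian_weight])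
  have mult: "eig_multiplicity N (\<omega>, C) l = card {i \<in> {..<d}. ?f i = l}" for l
    unfolding eig_multiplicity_def dim weak by (subst spectral_basis_dim[OF sb]) (auto simp: lessThan_def Collect_conj_eq)
  have eig: "eigenvalues N (\<omega>, C) = ?f ` {..<d}"
  proof (intro set_eqI iffI)
    fix l assume "l \<in> eigenvalues N (\<omega>, C)"
    then obtain u where u: "u \<in> solutions N (\<omega>, C) l" "u \<noteq> 0" by (auto simp: eigenvalues_def)
    have "{i. i < d \<and> ?f i = l} \<noteq> {}"
    proof
      assume 0: "{i. i < d \<and> ?f i = l} = {}"
      have im: "R ` solutions N (\<omega>, C) l = {0}" unfolding image weak 0 by simp
      have z: "0 \<in> solutions N (\<omega>, C) l"
        by (rule cseq.subspace_0[OF subspace_solutions[OF C(2)]])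
      have "R u = 0" "R 0 = 0" using imageI[OF u(1), of R] imageI[OF z, of R] unfolding im by blast+
      then have "R u = R 0" by (rule trans[OF _ sym])
      from inj_onD[OF inj this u(1) z] show False using u(2) by contradiction
    qed
    then show "l \<in> ?f ` {..<d}" by auto
  next
    fix l assume "l \<in> ?f ` {..<d}"
    then obtain i where i: "i < d" "?f i = l" by auto
    then have "y i \<in> R ` solutions N (\<omega>, C) l" unfolding image weak by (intro cseq.span_base) auto
    then obtain u where u: "u \<in> solutions N (\<omega>, C) l" "y i = R u" by auto
    have "y i \<noteq> 0"
    proof
      assume "y i = 0"
      then show False using spectral_basisD(2)[OF sb i(1) i(1)] by simp
    qed
    then have "u \<noteq> 0" using u(2) by (auto simp: R_def fun_eq_iff split: if_splits)
    then show "l \<in> eigenvalues N (\<omega>, C)" using u by (auto simp: eigenvalues_def)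
  qed
  have "num_eigenvalues N (\<omega>, C) = (\<Sum>l\<in>?f ` {..<d}. \<Sum>i\<in>{i \<in> {..<d}. ?f i = l}. 1)"
    unfolding num_eigenvalues_def mult eig by simp
  also have "\<dots> = (\<Sum>i<d. 1)" by (rule sum.image_gen[symmetric]) simp
  finally have num: "num_eigenvalues N (\<omega>, C) = d" by simp
  have "(\<Sum>l\<in>eigenvalues N (\<omega>, C). replicate_mset (eig_multiplicity N (\<omega>, C) l) (Re l)) =
      (\<Sum>l\<in>?f ` {..<d}. \<Sum>i\<in>{i \<in> {..<d}. ?f i = l}. {#\<mu> i#})"
    unfolding eig
  proof (intro sum.cong refl)
    fix l
    have "(\<Sum>i\<in>{i \<in> {..<d}. ?f i = l}. {#\<mu> i#}) = (\<Sum>i\<in>{i \<in> {..<d}. ?f i = l}. {#Re l#})"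
      by (intro sum.cong refl) auto
    then show "replicate_mset (eig_multiplicity N (\<omega>, C) l) (Re l) = (\<Sum>i\<in>{i \<in> {..<d}. ?f i = l}. {#\<mu> i#})"
      unfolding sum_singleton_mset mult by simp
  qed
  also have "\<dots> = (\<Sum>i<d. {#\<mu> i#})" by (rule sum.image_gen[symmetric]) simp
  also have "\<dots> = mset (map \<mu> [0..<d])" by (rule sum_mset_lessThan)
  finally have list: "eigenvalue_list N (\<omega>, C) = sort (map \<mu> [0..<d])"
    unfolding eigenvalue_list_def by (simp only: sorted_list_of_multiset_mset)
  have "sorted (map \<mu> [0..<d])"
    using spectral_basisD(5)[OF sb] by (auto simp: sorted_iff_nth_mono)
  then have list': "eigenvalue_list N (\<omega>, C) = map \<mu> [0..<d]"
    unfolding list by (rule sorted_sort_id)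
  show thesis
  proof (rule that[OF sb[unfolded d_def]])
    show "has_exactly N (\<omega>, C) (cseq.dim (form_domain N P))"
      using num eig by (simp add: has_exactly_def d_def)
    show "nth_eigenvalue N n (\<omega>, C) = \<mu> n" if "n < cseq.dim (form_domain N P)" for n
      using that by (simp add: nth_eigenvalue_def list' d_def)
  qed
qed

section \<open>Counting eigenvalues and continuity\<close>

lemma unit_in_supp_space: "k \<in> {1..N} \<Longrightarrow> (\<lambda>n. if n = k then 1 else 0) \<in> supp_space N"
  by (auto simp: supp_space_def)

lemma dim_supp_space: "cseq.dim (supp_space N) = N"
proof (induction N)
  case 0
  have "cseq.dim (supp_space 0) \<le> card ((\<lambda>k n. if n = k then 1 else 0 :: complex) ` {1..0::nat})"
    by (rule cseq.dim_le_card[OF supp_space_subset_span]) simp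
  then show ?case by simp
next
  case (Suc N)
  have "cseq.dim (supp_space (Suc N)) = Suc (cseq.dim {x \<in> supp_space (Suc N). x (Suc N) = 0})"
    by (rule dim_kernel(2)[OF subspace_supp_space subset_refl _ _ unit_in_supp_space[of "Suc N"]]) auto
  also have "{x \<in> supp_space (Suc N). x (Suc N) = 0} = supp_space N"
    by (auto simp: supp_space_def le_Suc_eq)
  finally show ?case using Suc by simp
qed

lemma form_domain_one: "form_domain N (mat 1) = supp_space N"
  by (simp add: form_domain_def)

lemma dim_form_domain_zero:
  assumes "2 \<le> N"
  shows "cseq.dim (form_domain N 0) = N - 2"
proof -
  let ?V = "{x \<in> supp_space N. x 1 = 0}"
  have "cseq.dim (supp_space N) = Suc (cseq.dim ?V)"
    by (rule dim_kernel(2)[OF subspace_supp_space subset_refl _ _ unit_in_supp_space[of 1]]) (use assms in auto)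
  moreover have "cseq.subspace ?V"
    by (rule dim_kernel(1)[OF subspace_supp_space subset_refl]) auto
  then have "cseq.dim ?V = Suc (cseq.dim {x \<in> ?V. x N = 0})"
    by (rule dim_kernel(2)[where N = N and ?x0.0 = "\<lambda>n. if n = N then 1 else 0"])
      (use assms unit_in_supp_space[of N N] in auto)
  moreover have "{x \<in> ?V. x N = 0} = form_domain N 0"
    by (auto simp: form_domain_def vec_eq_iff forall_2)
  ultimately show ?thesis using dim_supp_space[of N] by simp
qed

text \<open>To be fixed by the projection, the end values must be proportional to
  \<open>(cnj b1, cnj b2)\<close>, which is a single nontrivial linear equation.\<close>

lemma dim_form_domain_line:
  assumes N: "2 \<le> N" and b: "cnj b1 * b1 + cnj b2 * b2 = 1"
  shows "cseq.dim (form_domain N (line_projection b1 b2)) = N - 1"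
proof -
  let ?\<phi> = "\<lambda>x::nat \<Rightarrow> complex. - cnj b2 * x 1 + cnj b1 * x N"
  have line: "cnj b1 * b1 * p + cnj b1 * b2 * q = p \<and> cnj b2 * b1 * p + cnj b2 * b2 * q = q \<longleftrightarrow>
      - cnj b2 * p + cnj b1 * q = 0" for p q
  proof
    assume "cnj b1 * b1 * p + cnj b1 * b2 * q = p \<and> cnj b2 * b1 * p + cnj b2 * b2 * q = q"
    then have "p = cnj b1 * (b1 * p + b2 * q)" "q = cnj b2 * (b1 * p + b2 * q)"
      by (simp_all add: algebra_simps)
    then obtain s where "p = cnj b1 * s" "q = cnj b2 * s" by blast
    then show "- cnj b2 * p + cnj b1 * q = 0" by simp
  next
    assume 0: "- cnj b2 * p + cnj b1 * q = 0"
    show "cnj b1 * b1 * p + cnj b1 * b2 * q = p \<and> cnj b2 * b1 * p + cnj b2 * b2 * q = q"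
      by (intro conjI; use b 0 in algebra)
  qed
  have "\<exists>x0\<in>supp_space N. ?\<phi> x0 \<noteq> 0"
  proof (cases "b2 = 0")
    case True
    then have "?\<phi> (\<lambda>n. if n = N then 1 else 0) \<noteq> 0" using b N by auto
    then show ?thesis using unit_in_supp_space[of N N] N by fastforce
  next
    case False
    then have "?\<phi> (\<lambda>n. if n = 1 then 1 else 0) \<noteq> 0" using N by auto
    then show ?thesis using unit_in_supp_space[of 1 N] N by fastforce
  qed
  then obtain x0 where x0: "x0 \<in> supp_space N" "?\<phi> x0 \<noteq> 0" by blast
  have "cseq.dim (supp_space N) = Suc (cseq.dim {x \<in> supp_space N. ?\<phi> x = 0})"
    by (rule dim_kernel(2)[where \<phi> = ?\<phi>, OF subspace_supp_space subset_refl _ _ x0]) (auto simp: algebra_simps)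
  also have "{x \<in> supp_space N. ?\<phi> x = 0} = form_domain N (line_projection b1 b2)"
    unfolding form_domain_def vec_eq_iff forall_2 mat2_vec_nth ends_nth line_projection_nth line ..
  finally show ?thesis using dim_supp_space[of N] by simp
qed

lemma problem_normal_form:
  assumes N: "2 \<le> N" and \<omega>: "\<omega> \<in> Omega N" and C: "C \<in> BC"
  obtains P S where "normal_pair P S" "C = bc_class (bmat (1 / f_of \<omega> 0) (mat 1 - P - S) P)"
    "((\<omega>, C) \<notin> P_exc N \<and> P = mat 1 \<and> cseq.dim (form_domain N P) = N) \<or>
     ((\<omega>, C) \<in> P5 N \<and> P \<noteq> mat 1 \<and> cseq.dim (form_domain N P) = N - 2) \<or>
     ((\<omega>, C) \<in> P_exc N - P5 N \<and> P \<noteq> mat 1 \<and> cseq.dim (form_domain N P) = N - 1)"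
proof -
  obtain X Y where CXY: "C = bc_class (bmat (1 / f_of \<omega> 0) X Y)" "rank (bmat (1 / f_of \<omega> 0) X Y) = 2"
    "X ** adjoint_matrix Y = Y ** adjoint_matrix X"
    using BC_bmat[OF C] by metis
  obtain P S where n: "normal_pair P S"
    "bc_class (bmat (1 / f_of \<omega> 0) X Y) = bc_class (bmat (1 / f_of \<omega> 0) (mat 1 - P - S) P)"
    and cases: "(det Y \<noteq> 0 \<and> P = mat 1) \<or> (Y = 0 \<and> P = 0) \<or>
     (det Y = 0 \<and> Y \<noteq> 0 \<and> (\<exists>b1 b2. cnj b1 * b1 + cnj b2 * b2 = 1 \<and> P = line_projection b1 b2))"
    by (rule normal_form[OF CXY(2,3)])
  have exc: "(\<omega>, C) \<in> P_exc N \<longleftrightarrow> det Y = 0"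
    using P_exc_iff_det[OF \<omega>, of X Y] C CXY(1) by simp
  have five: "(\<omega>, C) \<in> P5 N \<longleftrightarrow> Y = 0"
    using P5_iff_zero[OF \<omega> CXY(2,3)] CXY(1) by simp
  have ne: "P \<noteq> mat 1" if "det P = 0" using that by auto
  have "((\<omega>, C) \<notin> P_exc N \<and> P = mat 1 \<and> cseq.dim (form_domain N P) = N) \<or>
     ((\<omega>, C) \<in> P5 N \<and> P \<noteq> mat 1 \<and> cseq.dim (form_domain N P) = N - 2) \<or>
     ((\<omega>, C) \<in> P_exc N - P5 N \<and> P \<noteq> mat 1 \<and> cseq.dim (form_domain N P) = N - 1)"
    using cases
  proof (elim disjE)
    assume "det Y \<noteq> 0 \<and> P = mat 1"
    then show ?thesis using exc by (simp add: form_domain_one dim_supp_space)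
  next
    assume "Y = 0 \<and> P = 0"
    then show ?thesis using five dim_form_domain_zero[OF N] ne by (simp add: det_2_complex)
  next
    assume *: "det Y = 0 \<and> Y \<noteq> 0 \<and> (\<exists>b1 b2. cnj b1 * b1 + cnj b2 * b2 = 1 \<and> P = line_projection b1 b2)"
    then obtain b1 b2 where b: "cnj b1 * b1 + cnj b2 * b2 = 1" and P: "P = line_projection b1 b2" by blast
    have "det P = 0" unfolding P det_2_complex line_projection_nth by algebra
    then show ?thesis using * five exc ne dim_form_domain_line[OF N b] P by simp
  qed
  then show thesis using n CXY(1) by (intro that) auto
qed

lemma num_eigenvalues_exact: "has_exactly N p k \<Longrightarrow> num_eigenvalues N p = k"
  by (simp add: has_exactly_def)

lemma eigenvalue_count:
  assumes N: "2 \<le> N" and p: "p \<in> SL_problems N"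
  shows "p \<in> P5 N \<Longrightarrow> has_exactly N p (N - 2)"
    and "p \<in> P_exc N - P5 N \<Longrightarrow> has_exactly N p (N - 1)"
    and "p \<notin> P_exc N \<Longrightarrow> has_exactly N p N"
proof -
  obtain \<omega> C where pC: "p = (\<omega>, C)" "\<omega> \<in> Omega N" "C \<in> BC" using p by (auto simp: SL_problems_def)
  obtain P S where n: "normal_pair P S" "C = bc_class (bmat (1 / f_of \<omega> 0) (mat 1 - P - S) P)" and cases:
    "((\<omega>, C) \<notin> P_exc N \<and> P = mat 1 \<and> cseq.dim (form_domain N P) = N) \<or>
     ((\<omega>, C) \<in> P5 N \<and> P \<noteq> mat 1 \<and> cseq.dim (form_domain N P) = N - 2) \<or>
     ((\<omega>, C) \<in> P_exc N - P5 N \<and> P \<noteq> mat 1 \<and> cseq.dim (form_domain N P) = N - 1)"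
    by (rule problem_normal_form[OF N pC(2,3)])
  have "has_exactly N p (cseq.dim (form_domain N P))"
    unfolding pC(1) by (rule problem_spectrum[OF N pC(2) n pC(3)])
  then show "p \<in> P5 N \<Longrightarrow> has_exactly N p (N - 2)" "p \<in> P_exc N - P5 N \<Longrightarrow> has_exactly N p (N - 1)"
    "p \<notin> P_exc N \<Longrightarrow> has_exactly N p N"
    using cases P5_subset[of N] unfolding pC(1) by auto
qed

section \<open>Neighbourhoods of problems and continuity off the exceptional set\<close>

text \<open>Bridges two product topologies: over the finite index ranges for
  \<open>Omega_topology\<close>, over all of \<open>nat\<close> for \<open>open\<close>. On
  \<open>Omega N\<close> the extra coordinates are constantly \<open>undefined\<close>, hence
  continuous.\<close>

lemma openin_Omega_topology:
  assumes "open A"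
  shows "openin (Omega_topology N) (A \<inter> Omega N)"
proof -
  let ?T = "\<lambda>K. product_topology (\<lambda>_. euclideanreal) K"
  let ?X = "subtopology (prod_topology (?T {0..N}) (prod_topology (?T {1..N}) (?T {1..N}))) (Omega N)"
  have comp: "continuous_map ?X euclidean g"
    if g: "continuous_map ?X (?T K) g" and ext: "\<And>\<omega>. \<omega> \<in> Omega N \<Longrightarrow> g \<omega> \<in> extensional K" for g K
  proof -
    have "continuous_map ?X euclideanreal (\<lambda>\<omega>. g \<omega> k)" for k
    proof (cases "k \<in> K")
      case True
      from continuous_map_compose[OF g continuous_map_product_projection[OF True]]
      show ?thesis by (simp add: o_def)
    next
      case False
      have "continuous_map ?X euclideanreal (\<lambda>_. undefined)" by simp
      then show ?thesis
        by (rule continuous_map_eq) (use ext False in \<open>auto simp: extensional_def\<close>)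
    qed
    then show ?thesis
      unfolding euclidean_product_topology[symmetric] continuous_map_componentwise_UNIV by blast
  qed
  have f: "continuous_map ?X (?T {0..N}) fst"
    "continuous_map ?X (prod_topology (?T {1..N}) (?T {1..N})) snd"
    by (intro continuous_map_from_subtopology continuous_map_fst continuous_map_snd)+
  have s: "continuous_map ?X (?T {1..N}) (fst \<circ> snd)" "continuous_map ?X (?T {1..N}) (snd \<circ> snd)"
    by (rule continuous_map_compose[OF f(2)], rule continuous_map_fst continuous_map_snd)+
  have "continuous_map ?X euclidean fst"
    by (rule comp[OF f(1)]) (auto simp: Omega_def PiE_iff)
  moreover have "continuous_map ?X euclidean (fst \<circ> snd)"
    by (rule comp[OF s(1)]) (auto simp: Omega_def PiE_iff)
  moreover have "continuous_map ?X euclidean (snd \<circ> snd)"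
    by (rule comp[OF s(2)]) (auto simp: Omega_def PiE_iff)
  ultimately have "continuous_map ?X (prod_topology euclidean (prod_topology euclidean euclidean)) (\<lambda>\<omega>. \<omega>)"
    by (simp add: continuous_map_pairwise o_def del: prod_topology_euclidean)
  then have "continuous_map ?X euclidean (\<lambda>\<omega>. \<omega>)" by simp
  then have "openin ?X {\<omega> \<in> topspace ?X. \<omega> \<in> A}"
    by (rule openin_continuous_map_preimage) (use assms in simp)
  moreover have "?X = Omega_topology N" by (simp add: Omega_topology_def)
  ultimately have "openin (Omega_topology N) {\<omega> \<in> topspace (Omega_topology N). \<omega> \<in> A}" by (simp only:)
  moreover have "{\<omega> \<in> topspace (Omega_topology N). \<omega> \<in> A} = A \<inter> Omega N"
    by (auto simp: topspace_Omega_topology)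
  ultimately show ?thesis by simp
qed

lemma rank2_mult:
  fixes T :: "complex^2^2" and M :: "complex^4^2"
  assumes T: "invertible T" and M: "rank M = 2"
  shows "rank (T ** M) = 2"
proof (rule rank_two)
  fix c d assume "c *s (T ** M)$1 + d *s (T ** M)$2 = 0"
  then have "(c * T$1$1 + d * T$2$1) *s M$1 + (c * T$1$2 + d * T$2$2) *s M$2 = 0"
    by (simp add: vec_eq_iff forall_4 algebra_simps)
  from rank2D[OF M this] have 0: "c * T$1$1 + d * T$2$1 = 0" "c * T$1$2 + d * T$2$2 = 0" by auto
  have "c * det T = 0" "d * det T = 0" unfolding det_2_complex using 0 by algebra+
  then show "c = 0 \<and> d = 0" using T by (simp add: invertible_det_nz)
qed

text \<open>A quotient by a group of homeomorphisms is an open map: the saturation of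
  \<open>B\<close> is the union of its preimages under all invertible left multiplications.\<close>

lemma openin_bc_class_image:
  assumes "open B"
  shows "openin quotient_topology (bc_class ` (B \<inter> rank2))"
proof -
  let ?K = "\<Union>T\<in>{T :: complex^2^2. invertible T}. (\<lambda>M :: complex^4^2. T ** M) -` B"
  have "continuous_on UNIV (\<lambda>M::complex^4^2. T ** M)" for T :: "complex^2^2"
    unfolding matrix_matrix_mult_def by (intro continuous_intros)
  then have "open ?K" using assms by (intro open_UN ballI open_vimage)
  moreover have "{M \<in> rank2. bc_class M \<in> bc_class ` (B \<inter> rank2)} = rank2 \<inter> ?K"
  proof (intro set_eqI iffI)
    fix M assume "M \<in> {M \<in> rank2. bc_class M \<in> bc_class ` (B \<inter> rank2)}"
    then obtain M' where M: "M \<in> rank2" "M' \<in> B" "bc_class M' = bc_class M" by auto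
    obtain T where T: "invertible T" "M' = T ** M" by (rule bc_class_eqD[OF M(3)])
    show "M \<in> rank2 \<inter> ?K" using M(1,2) T by auto
  next
    fix M assume "M \<in> rank2 \<inter> ?K"
    then obtain T where T: "M \<in> rank2" "invertible T" "T ** M \<in> B" by auto
    have "rank M = 2" using T(1) by (simp only: rank2_def mem_Collect_eq)
    then have "T ** M \<in> rank2" unfolding rank2_def mem_Collect_eq by (rule rank2_mult[OF T(2)])
    then have "T ** M \<in> B \<inter> rank2" using T(3) by blast
    from image_eqI[where f = bc_class, OF bc_class_mult[OF T(2), of M, symmetric] this]
    show "M \<in> {M \<in> rank2. bc_class M \<in> bc_class ` (B \<inter> rank2)}" using T(1) by blast
  qed
  ultimately show ?thesis
    unfolding openin_quotient_topology by (auto simp: openin_open)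
qed

lemma openin_SL_topology:
  assumes "open A" "open B"
  shows "openin (SL_topology N) ((A \<inter> Omega N) \<times> (bc_class ` (B \<inter> rank2) \<inter> BC))"
  unfolding SL_topology_def BC_topology_def
  using openin_Omega_topology[OF assms(1)] openin_bc_class_image[OF assms(2)]
  by (auto simp: openin_prod_Times_iff intro: openin_subtopology_Int)

definition X_of :: "complex^4^2 \<Rightarrow> complex^2^2" where
  "X_of M = (\<chi> i. vector [M$i$1, M$i$3])"

definition Y_of :: "real \<Rightarrow> complex^4^2 \<Rightarrow> complex^2^2" where
  "Y_of r M = (\<chi> i. vector [M$i$2 - of_real r * M$i$1, - M$i$4])"

lemma X_of_nth [simp]: "X_of M $ i $ 1 = M$i$1" "X_of M $ i $ 2 = M$i$3"
  by (simp_all add: X_of_def)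

lemma Y_of_nth [simp]: "Y_of r M $ i $ 1 = M$i$2 - of_real r * M$i$1" "Y_of r M $ i $ 2 = - M$i$4"
  by (simp_all add: Y_of_def)

lemma bmat_X_of_Y_of: "bmat r (X_of M) (Y_of r M) = M"
  by (simp add: vec4_eq_iff)

text \<open>\<open>- Y\<^sup>-\<^sup>1 X\<close> by Cramer's rule.\<close>

definition S_of :: "real \<Rightarrow> complex^4^2 \<Rightarrow> complex^2^2" where
  "S_of r M = (let X = X_of M; Y = Y_of r M in (\<chi> i j.
     if i = 1 then (Y$1$2 * X$2$j - Y$2$2 * X$1$j) / det Y else (Y$2$1 * X$1$j - Y$1$1 * X$2$j) / det Y))"

text \<open>Self-adjointness passes from one representative to any other, so the invertible normal
  form applies to \<open>M\<close> itself. Solving for its \<open>T\<close> gives Cramer's formula,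
  whose continuity in the equation and the matrix is visible.\<close>

lemma S_of_normal_form:
  assumes Y: "det (Y_of r M) \<noteq> 0" and M: "bc_class M \<in> BC"
  shows "normal_pair (mat 1) (S_of r M)"
    and "bc_class M = bc_class (bmat r (mat 1 - mat 1 - S_of r M) (mat 1))"
proof -
  define X' Y' where XY: "X' = X_of M" "Y' = Y_of r M"
  have MXY: "bmat r X' Y' = M" unfolding XY by (rule bmat_X_of_Y_of)
  obtain X0 Y0 where 0: "bc_class M = bc_class (bmat r X0 Y0)" "X0 ** adjoint_matrix Y0 = Y0 ** adjoint_matrix X0"
    using BC_bmat[OF M] by metis
  obtain T0 where "bmat r X' Y' = T0 ** bmat r X0 Y0"
    using bc_class_eqD[OF 0(1)] unfolding MXY by metis
  then have sa: "X' ** adjoint_matrix Y' = Y' ** adjoint_matrix X'"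
    using selfadjoint_mult[OF 0(2), of T0] by (simp add: bmat_mult bmat_eq_iff)
  obtain T S where T: "invertible T" "T ** Y' = mat 1" "T ** X' = - S" and S: "adjoint_matrix S = S"
    using normal_form_invertible[OF Y[folded XY] sa] by metis
  have "S = S_of r M"
  proof -
    define D where "D = det Y'"
    have D: "D \<noteq> 0" using Y XY by (simp add: D_def)
    have D': "D = Y'$1$1 * Y'$2$2 - Y'$1$2 * Y'$2$1" by (simp add: D_def det_2_complex)
    have T': "T$1$1 * Y'$1$1 + T$1$2 * Y'$2$1 = 1" "T$1$1 * Y'$1$2 + T$1$2 * Y'$2$2 = 0"
      "T$2$1 * Y'$1$1 + T$2$2 * Y'$2$1 = 0" "T$2$1 * Y'$1$2 + T$2$2 * Y'$2$2 = 1"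
      using T(2) by (simp_all add: mat2_eq_iff)
    have T_D: "T$1$1 * D = Y'$2$2" "T$1$2 * D = - Y'$1$2" "T$2$1 * D = - Y'$2$1" "T$2$2 * D = Y'$1$1"
      unfolding D' using T' by algebra+
    have "S = - (T ** X')" using T(3) by simp
    then have S': "S$i$j = - (T$i$1 * X'$1$j + T$i$2 * X'$2$j)" for i j by simp
    have lin: "- (a * x + b * y) * D = - (a * D) * x - (b * D) * y" for a b x y by algebra
    have "S$1$j * D = Y'$1$2 * X'$2$j - Y'$2$2 * X'$1$j" for j
      unfolding S' lin T_D by simp
    moreover have "S$2$j * D = Y'$2$1 * X'$1$j - Y'$1$1 * X'$2$j" for j
      unfolding S' lin T_D by simp
    ultimately show ?thesis
      unfolding S_of_def Let_def XY[symmetric] D_def[symmetric]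
      using D by (simp add: vec_eq_iff forall_2 eq_divide_eq)
  qed
  then show "normal_pair (mat 1) (S_of r M)"
    using S by (simp add: normal_pair_def mat2_eq_iff)
  show "bc_class M = bc_class (bmat r (mat 1 - mat 1 - S_of r M) (mat 1))"
  proof -
    have "bc_class M = bc_class (T ** bmat r X' Y')" by (simp only: bc_class_mult[OF T(1)] MXY)
    also have "\<dots> = bc_class (bmat r (- S) (mat 1))" by (simp only: bmat_mult T)
    finally show ?thesis using \<open>S = _\<close> by simp
  qed
qed

lemma tendsto_if_const:
  "(b \<Longrightarrow> (f \<longlongrightarrow> l) F) \<Longrightarrow> (\<not> b \<Longrightarrow> (g \<longlongrightarrow> m) F) \<Longrightarrow>
    ((\<lambda>x. if b then f x else g x) \<longlongrightarrow> (if b then l else m)) F"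
  by (cases b) auto

lemma tendsto_component:
  "(f \<longlongrightarrow> l) F \<Longrightarrow> ((\<lambda>x. f x n) \<longlongrightarrow> l n) F" for f :: "'a \<Rightarrow> nat \<Rightarrow> real"
proof -
  assume f: "(f \<longlongrightarrow> l) F"
  have "continuous_on UNIV (\<lambda>x::nat \<Rightarrow> real. x n)"
    by (rule continuous_on_product_then_coordinatewise) (rule continuous_on_id)
  from continuous_on_tendsto_compose[OF this f] show ?thesis by simp
qed

lemma tendsto_pencil:
  fixes \<omega> :: equation and M :: "complex^4^2" and c :: real
  assumes \<omega>: "\<omega> \<in> Omega N" and Y: "det (Y_of (1 / f_of \<omega> 0) M) \<noteq> 0"
  defines "F \<equiv> \<lambda>p i j. stiffness N (fst p) (S_of (1 / f_of (fst p) 0) (snd p)) i j - of_real c * weight (fst p) i j"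
  shows "i \<in> {1..N} \<Longrightarrow> j \<in> {1..N} \<Longrightarrow> ((\<lambda>p. F p i j) \<longlongrightarrow> F (\<omega>, M) i j) (nhds (\<omega>, M))"
    and "((\<lambda>p. det (Y_of (1 / f_of (fst p) 0) (snd p))) \<longlongrightarrow> det (Y_of (1 / f_of \<omega> 0) M)) (nhds (\<omega>, M))"
proof -
  have id: "((\<lambda>p. p) \<longlongrightarrow> (\<omega>, M)) (nhds (\<omega>, M))" by (rule filterlim_ident)
  have \<omega>t: "(fst \<longlongrightarrow> \<omega>) (nhds (\<omega>, M))" and Mt: "(snd \<longlongrightarrow> M) (nhds (\<omega>, M))"
    using tendsto_fst[OF id] tendsto_snd[OF id] by simp_all
  have f: "((\<lambda>p. f_of (fst p) n) \<longlongrightarrow> f_of \<omega> n) (nhds (\<omega>, M))" if "n \<le> N" for n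
  proof -
    have "fst \<omega> n \<noteq> 0" using \<omega> that by (auto simp: Omega_def PiE_iff)
    then show ?thesis unfolding f_of_def by (intro tendsto_intros tendsto_component tendsto_fst \<omega>t)
  qed
  have q: "((\<lambda>p. q_of (fst p) n) \<longlongrightarrow> q_of \<omega> n) (nhds (\<omega>, M))"
    and w: "((\<lambda>p. w_of (fst p) n) \<longlongrightarrow> w_of \<omega> n) (nhds (\<omega>, M))" for n
    unfolding q_of_def w_of_def by (intro tendsto_component tendsto_fst tendsto_snd \<omega>t)+
  have f0: "f_of \<omega> 0 \<noteq> 0" using f_of_nonzero[OF \<omega>] by simp
  have m: "((\<lambda>p. snd p $ k $ n) \<longlongrightarrow> M $ k $ n) (nhds (\<omega>, M))" for k n
    by (intro tendsto_vec_nth Mt)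
  have Yt: "((\<lambda>p. Y_of (1 / f_of (fst p) 0) (snd p) $ k $ 1) \<longlongrightarrow> Y_of (1 / f_of \<omega> 0) M $ k $ 1) (nhds (\<omega>, M))"
    "((\<lambda>p. Y_of (1 / f_of (fst p) 0) (snd p) $ k $ 2) \<longlongrightarrow> Y_of (1 / f_of \<omega> 0) M $ k $ 2) (nhds (\<omega>, M))" for k
    unfolding Y_of_nth by (intro tendsto_intros m f f0 le0)+
  show det: "((\<lambda>p. det (Y_of (1 / f_of (fst p) 0) (snd p))) \<longlongrightarrow> det (Y_of (1 / f_of \<omega> 0) M)) (nhds (\<omega>, M))"
    unfolding det_2_complex by (intro tendsto_intros Yt)
  have Xt: "((\<lambda>p. X_of (snd p) $ k $ 1) \<longlongrightarrow> X_of M $ k $ 1) (nhds (\<omega>, M))"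
    "((\<lambda>p. X_of (snd p) $ k $ 2) \<longlongrightarrow> X_of M $ k $ 2) (nhds (\<omega>, M))" for k
    unfolding X_of_nth by (intro m)+
  have Xt': "((\<lambda>p. X_of (snd p) $ k $ n) \<longlongrightarrow> X_of M $ k $ n) (nhds (\<omega>, M))" for k n
    using exhaust_2[of n] Xt[of k] by auto
  have S: "((\<lambda>p. S_of (1 / f_of (fst p) 0) (snd p) $ k $ n) \<longlongrightarrow> S_of (1 / f_of \<omega> 0) M $ k $ n) (nhds (\<omega>, M))" for k n
    unfolding S_of_def Let_def vec_lambda_beta
    by (intro tendsto_if_const tendsto_divide tendsto_diff tendsto_mult Yt Xt' det Y)
  assume i: "i \<in> {1..N}" and j: "j \<in> {1..N}"
  have "((\<lambda>p. jacobi N (fst p) i j) \<longlongrightarrow> jacobi N \<omega> i j) (nhds (\<omega>, M))"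
    unfolding jacobi_def
    by (intro tendsto_diff tendsto_if_const tendsto_of_real tendsto_add q f tendsto_const) (use i j in auto)
  moreover have "((\<lambda>p. corner N (S_of (1 / f_of (fst p) 0) (snd p)) i j) \<longlongrightarrow>
      corner N (S_of (1 / f_of \<omega> 0) M) i j) (nhds (\<omega>, M))"
    unfolding corner_def by (intro tendsto_add tendsto_if_const tendsto_const S)
  moreover have "((\<lambda>p. weight (fst p) i j) \<longlongrightarrow> weight \<omega> i j) (nhds (\<omega>, M))"
    unfolding weight_def by (intro tendsto_if_const tendsto_of_real tendsto_const w)
  ultimately show "((\<lambda>p. F p i j) \<longlongrightarrow> F (\<omega>, M) i j) (nhds (\<omega>, M))"
    unfolding F_def stiffness_def fst_conv snd_conv by (intro tendsto_intros)
qed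

text \<open>Continuity is available for pairs of an equation and a matrix, while the topology is on
  classes. Openness of the class map closes this gap: every class in \<open>U\<close> has some
  representative close to \<open>M\<close>, and the pencil is evaluated there.\<close>

lemma pencil_neighbourhood:
  assumes \<omega>: "\<omega> \<in> Omega N" and M: "M \<in> rank2" "bc_class M \<in> BC"
    and Y: "det (Y_of (1 / f_of \<omega> 0) M) \<noteq> 0" and \<delta>: "0 < \<delta>"
  obtains U where "openin (SL_topology N) U" "(\<omega>, bc_class M) \<in> U"
    "\<And>p. p \<in> U \<Longrightarrow> \<exists>\<omega>' M'. p = (\<omega>', bc_class M') \<and> \<omega>' \<in> Omega N \<and> bc_class M' \<in> BC \<and>
       det (Y_of (1 / f_of \<omega>' 0) M') \<noteq> 0 \<and>
       (\<Sum>i=1..N. \<Sum>j=1..N. cmod ((stiffness N \<omega>' (S_of (1 / f_of \<omega>' 0) M') i j - of_real c * weight \<omega>' i j) -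
          (stiffness N \<omega> (S_of (1 / f_of \<omega> 0) M) i j - of_real c * weight \<omega> i j))) < \<delta>"
proof -
  define F where "F = (\<lambda>p i j. stiffness N (fst p) (S_of (1 / f_of (fst p) 0) (snd p)) i j - of_real c * weight (fst p) i j)"
  define s where "s = (\<lambda>p. \<Sum>i=1..N. \<Sum>j=1..N. cmod (F p i j - F (\<omega>, M) i j))"
  have "(s \<longlongrightarrow> (\<Sum>i=1..N. \<Sum>j=1..N. cmod (F (\<omega>, M) i j - F (\<omega>, M) i j))) (nhds (\<omega>, M))"
    unfolding s_def F_def
    by (intro tendsto_sum tendsto_norm tendsto_diff[OF _ tendsto_const] tendsto_pencil(1)[OF \<omega> Y])
  then have "(s \<longlongrightarrow> 0) (nhds (\<omega>, M))" by simp
  then have 1: "eventually (\<lambda>p. s p < \<delta>) (nhds (\<omega>, M))" by (rule order_tendstoD(2)[OF _ \<delta>])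
  have "eventually (\<lambda>p. det (Y_of (1 / f_of (fst p) 0) (snd p)) \<noteq> 0) (nhds (\<omega>, M))"
    by (rule tendsto_imp_eventually_ne[OF tendsto_pencil(2)[OF \<omega> Y] Y])
  from eventually_conj[OF 1 this] obtain O' where O': "open O'" "(\<omega>, M) \<in> O'"
    "\<And>p. p \<in> O' \<Longrightarrow> s p < \<delta> \<and> det (Y_of (1 / f_of (fst p) 0) (snd p)) \<noteq> 0"
    unfolding eventually_nhds by blast
  obtain A B where AB: "open A" "open B" "(\<omega>, M) \<in> A \<times> B" "A \<times> B \<subseteq> O'"
    using open_prod_elim[OF O'(1,2)] by blast
  show thesis
  proof (rule that[OF openin_SL_topology[OF AB(1,2)]])
    show "(\<omega>, bc_class M) \<in> (A \<inter> Omega N) \<times> (bc_class ` (B \<inter> rank2) \<inter> BC)"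
      using AB(3) \<omega> M by auto
    fix p assume "p \<in> (A \<inter> Omega N) \<times> (bc_class ` (B \<inter> rank2) \<inter> BC)"
    then obtain \<omega>' M' where p: "p = (\<omega>', bc_class M')" "\<omega>' \<in> A" "\<omega>' \<in> Omega N" "M' \<in> B" "bc_class M' \<in> BC" by auto
    then have "(\<omega>', M') \<in> O'" using AB(4) by auto
    from O'(3)[OF this] p show "\<exists>\<omega>' M'. p = (\<omega>', bc_class M') \<and> \<omega>' \<in> Omega N \<and> bc_class M' \<in> BC \<and>
       det (Y_of (1 / f_of \<omega>' 0) M') \<noteq> 0 \<and>
       (\<Sum>i=1..N. \<Sum>j=1..N. cmod ((stiffness N \<omega>' (S_of (1 / f_of \<omega>' 0) M') i j - of_real c * weight \<omega>' i j) -
          (stiffness N \<omega> (S_of (1 / f_of \<omega> 0) M) i j - of_real c * weight \<omega> i j))) < \<delta>"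
      unfolding s_def F_def fst_conv snd_conv by blast
  qed
qed

lemma regular_spectrum:
  assumes N: "2 \<le> N" and \<omega>: "\<omega> \<in> Omega N" and M: "bc_class M \<in> BC"
    and Y: "det (Y_of (1 / f_of \<omega> 0) M) \<noteq> 0"
  obtains y \<mu> where "spectral_basis N (supp_space N) (stiffness N \<omega> (S_of (1 / f_of \<omega> 0) M)) (weight \<omega>) N y \<mu>"
    "has_exactly N (\<omega>, bc_class M) N" "\<And>n. n < N \<Longrightarrow> nth_eigenvalue N n (\<omega>, bc_class M) = \<mu> n"
  using problem_spectrum[OF N \<omega> S_of_normal_form[OF Y M] M] unfolding form_domain_one dim_supp_space by metis

lemma regular_representative:
  assumes p: "(\<omega>, C) \<in> SL_problems N - P_exc N"
  obtains M where "C = bc_class M" "M \<in> rank2" "det (Y_of (1 / f_of \<omega> 0) M) \<noteq> 0"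
proof -
  have \<omega>: "\<omega> \<in> Omega N" and C: "C \<in> BC" using p by (auto simp: SL_problems_def)
  obtain X Y where XY: "C = bc_class (bmat (1 / f_of \<omega> 0) X Y)" "rank (bmat (1 / f_of \<omega> 0) X Y) = 2"
    using BC_bmat[OF C] by metis
  have "Y_of r (bmat r X Y) = Y" for r by (simp add: mat2_eq_iff)
  moreover have "det Y \<noteq> 0" using P_exc_iff_det[OF \<omega>, of X Y] p C XY(1) by auto
  ultimately show thesis using XY that[of "bmat (1 / f_of \<omega> 0) X Y"] by (simp add: rank2_def)
qed

lemma eigenvalue_continuous:
  assumes N: "2 \<le> N" and n: "n \<le> N - 1" and p: "p \<in> SL_problems N - P_exc N"
  shows "eigenvalue_continuous_at N n p"
proof -
  obtain \<omega> C where pC: "p = (\<omega>, C)" by (cases p)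
  then have \<omega>: "\<omega> \<in> Omega N" and C: "C \<in> BC" using p by (auto simp: SL_problems_def)
  obtain M where M: "C = bc_class M" "M \<in> rank2" and Y: "det (Y_of (1 / f_of \<omega> 0) M) \<noteq> 0"
    using regular_representative[of \<omega> C N] p pC by metis
  have MC: "bc_class M \<in> BC" using M C by simp
  have nN: "n < N" using n N by simp
  obtain y \<mu> where sb: "spectral_basis N (supp_space N) (stiffness N \<omega> (S_of (1 / f_of \<omega> 0) M)) (weight \<omega>) N y \<mu>"
    and ex: "has_exactly N (\<omega>, bc_class M) N"
    and nth: "\<And>n. n < N \<Longrightarrow> nth_eigenvalue N n (\<omega>, bc_class M) = \<mu> n"
    using regular_spectrum[OF N \<omega> MC Y] by metis
  note W = hermitian_weight positive_weight[OF \<omega>]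
  note stable = sb subspace_supp_space subset_refl W nN
  \<comment> \<open>Stated for an arbitrary property \<open>R\<close> so that it serves both bounds,
    with \<open>R\<close> being "below \<open>c\<close>" or "above \<open>c\<close>".\<close>
  have near: "\<exists>U. openin (SL_topology N) U \<and> p \<in> U \<and> (\<forall>p'\<in>U. R (nth_eigenvalue N n p'))"
    if \<delta>: "0 < \<delta>" and R: "\<And>H' W' y' \<mu>'. spectral_basis N (supp_space N) H' W' N y' \<mu>' \<Longrightarrow>
      hermitian N W' \<Longrightarrow> positive_form N W' \<Longrightarrow>
      (\<Sum>i=1..N. \<Sum>j=1..N. cmod ((H' i j - of_real c * W' i j) -
        (stiffness N \<omega> (S_of (1 / f_of \<omega> 0) M) i j - of_real c * weight \<omega> i j))) < \<delta> \<Longrightarrow> R (\<mu>' n)" for \<delta> c R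
  proof -
    obtain U where U: "openin (SL_topology N) U" "(\<omega>, bc_class M) \<in> U"
      "\<And>p. p \<in> U \<Longrightarrow> \<exists>\<omega>' M'. p = (\<omega>', bc_class M') \<and> \<omega>' \<in> Omega N \<and> bc_class M' \<in> BC \<and>
         det (Y_of (1 / f_of \<omega>' 0) M') \<noteq> 0 \<and>
         (\<Sum>i=1..N. \<Sum>j=1..N. cmod ((stiffness N \<omega>' (S_of (1 / f_of \<omega>' 0) M') i j - of_real c * weight \<omega>' i j) -
            (stiffness N \<omega> (S_of (1 / f_of \<omega> 0) M) i j - of_real c * weight \<omega> i j))) < \<delta>"
      using pencil_neighbourhood[OF \<omega> M(2) MC Y \<delta>, of c] by blast
    have "R (nth_eigenvalue N n p')" if "p' \<in> U" for p'
    proof -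
      from U(3)[OF that] obtain \<omega>' M' where p': "p' = (\<omega>', bc_class M')" "\<omega>' \<in> Omega N" "bc_class M' \<in> BC"
        "det (Y_of (1 / f_of \<omega>' 0) M') \<noteq> 0"
        "(\<Sum>i=1..N. \<Sum>j=1..N. cmod ((stiffness N \<omega>' (S_of (1 / f_of \<omega>' 0) M') i j - of_real c * weight \<omega>' i j) -
            (stiffness N \<omega> (S_of (1 / f_of \<omega> 0) M) i j - of_real c * weight \<omega> i j))) < \<delta>" by blast
      obtain y' \<mu>' where "spectral_basis N (supp_space N) (stiffness N \<omega>' (S_of (1 / f_of \<omega>' 0) M')) (weight \<omega>') N y' \<mu>'"
        "nth_eigenvalue N n (\<omega>', bc_class M') = \<mu>' n"
        using regular_spectrum[OF N p'(2-4)] nN by metis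
      then show ?thesis using R[OF _ hermitian_weight positive_weight[OF p'(2)] p'(5)] p'(1) by simp
    qed
    then show ?thesis using U(1,2) pC M(1) by blast
  qed
  have below: "\<exists>U. openin (SL_topology N) U \<and> p \<in> U \<and> (\<forall>p'\<in>U. nth_eigenvalue N n p' < c)" if c: "\<mu> n < c" for c
    by (rule eigenvalue_less_stable[OF stable c]) (rule near, assumption, blast)
  have above: "\<exists>U. openin (SL_topology N) U \<and> p \<in> U \<and> (\<forall>p'\<in>U. c < nth_eigenvalue N n p')" if c: "c < \<mu> n" for c
    by (rule eigenvalue_greater_stable[OF stable c]) (rule near, assumption, blast)
  have num: "n < num_eigenvalues N p"
    using num_eigenvalues_exact[OF ex] nN pC M(1) by simp
  have nthp: "nth_eigenvalue N n p = \<mu> n" using nth[OF nN] pC M(1) by simp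
  show ?thesis
    unfolding eigenvalue_continuous_at_def topcontinuous_at_def
  proof (intro conjI allI impI)
    show "p \<in> topspace (subtopology (SL_topology N) {p'. n < num_eigenvalues N p'})"
      using p num by (simp add: topspace_SL_topology)
    show "nth_eigenvalue N n \<in> topspace (subtopology (SL_topology N) {p'. n < num_eigenvalues N p'}) \<rightarrow> topspace euclideanreal"
      by simp
    fix V assume V: "openin euclideanreal V \<and> nth_eigenvalue N n p \<in> V"
    then obtain e where e: "0 < e" "\<And>t. \<bar>t - \<mu> n\<bar> < e \<Longrightarrow> t \<in> V"
      unfolding nthp open_openin[symmetric] open_dist dist_real_def by blast
    obtain U1 where U1: "openin (SL_topology N) U1" "p \<in> U1" "\<And>p'. p' \<in> U1 \<Longrightarrow> nth_eigenvalue N n p' < \<mu> n + e"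
      using below[of "\<mu> n + e"] e(1) by auto
    obtain U2 where U2: "openin (SL_topology N) U2" "p \<in> U2" "\<And>p'. p' \<in> U2 \<Longrightarrow> \<mu> n - e < nth_eigenvalue N n p'"
      using above[of "\<mu> n - e"] e(1) by auto
    have "\<And>p'. p' \<in> U1 \<inter> U2 \<Longrightarrow> nth_eigenvalue N n p' \<in> V"
      using U1(3) U2(3) by (intro e(2)) (force simp: abs_less_iff)
    moreover have "openin (subtopology (SL_topology N) {p'. n < num_eigenvalues N p'}) (U1 \<inter> U2 \<inter> {p'. n < num_eigenvalues N p'})"
      using U1(1) U2(1) by (intro openin_subtopology_Int openin_Int)
    ultimately show "\<exists>U. openin (subtopology (SL_topology N) {p'. n < num_eigenvalues N p'}) U \<and> p \<in> U \<and>
        (\<forall>y\<in>U. nth_eigenvalue N n y \<in> V)"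
      using U1(2) U2(2) num by (intro exI[of _ "U1 \<inter> U2 \<inter> {p'. n < num_eigenvalues N p'}"]) auto
  qed
qed

section \<open>The penalty perturbation and discontinuity on the exceptional set\<close>

lemma corner_combine: "corner N (S - k *\<^sub>R Q) i j = corner N S i j - of_real k * corner N Q i j"
  by (simp add: corner_def scaleR_conv_of_real[where 'a = complex] algebra_simps)

lemma corner_complement_null:
  assumes N: "2 \<le> N" and u: "u \<in> form_domain N P"
  shows "form N (corner N (mat 1 - P)) u z = 0"
proof -
  have "(mat 1 - P) *v ends N u = 0"
    using u by (simp add: form_domain_def matrix_vector_mult_diff_rdistrib)
  then have "row_value N (corner N (mat 1 - P)) u i = 0" if "i \<in> {1..N}" for i
    unfolding row_corner[OF N that] by simp
  then show ?thesis unfolding form_row by simp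
qed

text \<open>Supplies the direction in which the penalty acts: end values in the nonzero range of
  \<open>1 - P\<close>, where the corner form is the squared length.\<close>

lemma corner_complement_positive:
  assumes N: "2 \<le> N" and P: "normal_pair P S" "P \<noteq> mat 1"
  obtains x where "x \<in> supp_space N" "0 < Re (form N (corner N (mat 1 - P)) x x)"
proof -
  have "\<exists>a. (mat 1 - P) *v a \<noteq> 0"
  proof (rule ccontr)
    assume "\<nexists>a. (mat 1 - P) *v a \<noteq> 0"
    then have "P *v a = mat 1 *v a" for a by (simp add: matrix_vector_mult_diff_rdistrib)
    then show False using P(2) by (metis matrix_eq)
  qed
  then obtain a' where a': "(mat 1 - P) *v a' \<noteq> 0" by blast
  define a where "a = (mat 1 - P) *v a'"
  have "P *v (P *v a') = P *v a'"
    using P(1) by (simp only: normal_pair_def matrix_vector_mul_assoc)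
  then have a: "(mat 1 - P) *v a = a"
    unfolding a_def by (simp add: matrix_vector_mult_diff_rdistrib matrix_vector_mult_diff_distrib)
  define x where "x = (\<lambda>n. if n = 1 then a$1 else if n = N then a$2 else 0)"
  have x: "ends N x = a" using N by (simp add: x_def vec_eq_iff forall_2)
  have "form N (corner N (mat 1 - P)) x x =
      row_value N (corner N (mat 1 - P)) x 1 * cnj (x 1) + row_value N (corner N (mat 1 - P)) x N * cnj (x N)"
    unfolding form_row by (rule sum_ends[OF N]) (simp add: x_def)
  also have "\<dots> = a$1 * cnj (a$1) + a$2 * cnj (a$2)"
  proof -
    have "row_value N (corner N (mat 1 - P)) x 1 = a$1" "row_value N (corner N (mat 1 - P)) x N = a$2"
      using N row_corner[OF N, of 1 "mat 1 - P" x] row_corner[OF N, of N "mat 1 - P" x]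
      unfolding x a by simp_all
    then show ?thesis using N by (simp add: x_def)
  qed
  also have "\<dots> = of_real ((cmod (a$1))\<^sup>2 + (cmod (a$2))\<^sup>2)"
    unfolding of_real_add complex_norm_square ..
  finally have "Re (form N (corner N (mat 1 - P)) x x) = (cmod (a$1))\<^sup>2 + (cmod (a$2))\<^sup>2" by simp
  moreover have "a$1 \<noteq> 0 \<or> a$2 \<noteq> 0" using a' unfolding a_def[symmetric] by (simp add: vec_eq_iff forall_2)
  then have "0 < (cmod (a$1))\<^sup>2 + (cmod (a$2))\<^sup>2" by (auto simp: add_pos_nonneg add_nonneg_pos)
  ultimately show thesis using that[of x] N by (auto simp: x_def supp_space_def)
qed

text \<open>Replacing \<open>P\<close> by \<open>P + \<epsilon> (1 - P)\<close> turns the constraint into the penalty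
  \<open>- (1 / \<epsilon>) (1 - P)\<close>.\<close>

lemma perturbed_normal_form:
  fixes r :: real
  assumes PS: "normal_pair P S" and \<epsilon>: "0 < \<epsilon>"
  defines "S' \<equiv> S - (1 / \<epsilon>) *\<^sub>R (mat 1 - P)" and "M \<equiv> bmat r (mat 1 - P - S) (P + \<epsilon> *\<^sub>R (mat 1 - P))"
  shows "normal_pair (mat 1) S'" "bc_class M = bc_class (bmat r (mat 1 - mat 1 - S') (mat 1))"
    "M \<in> rank2" "bc_class M \<in> BC" "det (P + \<epsilon> *\<^sub>R (mat 1 - P)) \<noteq> 0"
proof -
  define Q where "Q = mat 1 - P"
  have PP: "P ** P = P" "P ** S = S" using PS by (auto simp: normal_pair_def)
  have sc: "(k *\<^sub>R A) ** B = k *\<^sub>R (A ** B)" "A ** (k *\<^sub>R B) = k *\<^sub>R (A ** B)" for A B :: "complex^2^2" and k :: real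
    by (simp_all add: mat2_eq_iff algebra_simps)
  have dist: "(A + A') ** B = A ** B + A' ** B" "A ** (B + B') = A ** B + A ** B'"
    "(A - A') ** B = A ** B - A' ** B" "A ** (B - B') = A ** B - A ** B'" for A A' B B' :: "complex^2^2"
    by (simp_all add: mat2_eq_iff algebra_simps)
  have PQ: "P ** Q = 0" "Q ** P = 0" "Q ** Q = Q" "Q ** S = 0"
    unfolding Q_def dist by (simp_all add: PP)
  let ?T = "P + \<epsilon> *\<^sub>R Q" and ?T' = "P + (1 / \<epsilon>) *\<^sub>R Q"
  have "?T ** ?T' = mat 1" "?T' ** ?T = mat 1"
    unfolding dist sc PQ PP using \<epsilon> by (simp_all add: Q_def)
  then have T: "invertible ?T" by (auto simp: invertible_def)
  then show "det (P + \<epsilon> *\<^sub>R (mat 1 - P)) \<noteq> 0" by (simp add: invertible_det_nz Q_def)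
  \<comment> \<open>The factor \<open>\<epsilon>\<close> on \<open>Q\<close> cancels the penalty
    factor, while \<open>S\<close> lies in the range of \<open>P\<close> and is left
    unchanged.\<close>
  have "?T ** (- S') = Q - S"
  proof -
    have "- S' = (1 / \<epsilon>) *\<^sub>R Q - S" by (simp add: S'_def Q_def)
    then show ?thesis
      unfolding dist sc PQ PP using \<epsilon> by (simp add: dist sc PQ PP)
  qed
  then have M: "M = ?T ** bmat r (- S') (mat 1)"
    unfolding M_def bmat_mult by (simp add: Q_def)
  have adj: "adjoint_matrix S' = S'"
  proof -
    have "adjoint_matrix S = S" "adjoint_matrix P = P" using PS by (auto simp: normal_pair_def)
    moreover have "adjoint_matrix S' = adjoint_matrix S - (1 / \<epsilon>) *\<^sub>R (mat 1 - adjoint_matrix P)"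
      by (simp add: S'_def mat2_eq_iff)
    ultimately show ?thesis by (simp add: S'_def)
  qed
  then show "normal_pair (mat 1) S'" by (simp add: normal_pair_def mat2_eq_iff)
  show cls: "bc_class M = bc_class (bmat r (mat 1 - mat 1 - S') (mat 1))"
    unfolding M by (simp add: bc_class_mult[OF T])
  have rk: "rank (bmat r (- S') (mat 1)) = 2" by (rule bmat_rankI) simp
  then show "M \<in> rank2" unfolding M rank2_def mem_Collect_eq by (rule rank2_mult[OF T])
  have "bc_class (bmat r (- S') (mat 1)) \<in> BC"
  proof (rule bmat_in_BC[OF rk])
    have "adjoint_matrix (- S') = - adjoint_matrix S'" "adjoint_matrix (mat 1) = mat 1" by (simp_all add: mat2_eq_iff)
    then show "(- S') ** adjoint_matrix (mat 1) = mat 1 ** adjoint_matrix (- S')" using adj by simp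
  qed
  then show "bc_class M \<in> BC" using cls by simp
qed

text \<open>To refute continuity it suffices to vary the boundary matrix at a fixed equation; open
  sets of classes pull back to relatively open sets of rank 2 matrices.\<close>

lemma openin_slice:
  assumes U: "openin (SL_topology N) U" "(\<omega>, bc_class M) \<in> U"
  obtains B where "open B" "M \<in> rank2 \<Longrightarrow> M \<in> B"
    "\<And>M'. M' \<in> rank2 \<Longrightarrow> M' \<in> B \<Longrightarrow> bc_class M' \<in> BC \<Longrightarrow> (\<omega>, bc_class M') \<in> U"
proof -
  obtain U1 U2 where U12: "openin BC_topology U2" "\<omega> \<in> U1" "bc_class M \<in> U2" "U1 \<times> U2 \<subseteq> U"
    using U(1)[unfolded SL_topology_def openin_prod_topology_alt, rule_format, OF U(2)] by blast
  obtain Q where Q: "openin quotient_topology Q" "U2 = Q \<inter> BC"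
    using U12(1) unfolding BC_topology_def openin_subtopology by blast
  obtain B where B: "open B" "{M \<in> rank2. bc_class M \<in> Q} = rank2 \<inter> B"
    using Q(1) unfolding openin_quotient_topology openin_open by blast
  show thesis
  proof (rule that[OF B(1)])
    show "M \<in> B" if "M \<in> rank2" using that U12(3) Q(2) B(2) by blast
    show "(\<omega>, bc_class M') \<in> U" if "M' \<in> rank2" "M' \<in> B" "bc_class M' \<in> BC" for M'
      using that U12(2,4) Q(2) B(2) by blast
  qed
qed

text \<open>A level \<open>c\<close> is placed strictly between \<open>\<lambda>_{n-1}\<close> and
  \<open>\<lambda>_n\<close> of \<open>p\<close>. Continuity would keep \<open>\<lambda>_n\<close>
  above \<open>c\<close> near \<open>p\<close>, whereas the penalised problems approach
  \<open>p\<close> and have \<open>\<lambda>_n\<close> below \<open>c\<close>. The hypothesis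
  \<open>gap\<close> is what makes room for \<open>c\<close>.\<close>

lemma eigenvalue_discontinuous:
  assumes N: "2 \<le> N" and n: "n \<le> N - 1" and p: "p \<in> P_exc N"
    and gap: "\<not> (0 < n \<and> n < num_eigenvalues N p \<and> nth_eigenvalue N (n - 1) p = nth_eigenvalue N n p)"
  shows "\<not> eigenvalue_continuous_at N n p"
proof
  assume cont: "eigenvalue_continuous_at N n p"
  obtain \<omega> C where pC: "p = (\<omega>, C)" by (cases p)
  have \<omega>: "\<omega> \<in> Omega N" and C: "C \<in> BC"
    using subsetD[OF P_exc_subset p] unfolding pC SL_problems_def by simp_all
  obtain P S where PS: "normal_pair P S" and CPS: "C = bc_class (bmat (1 / f_of \<omega> 0) (mat 1 - P - S) P)"
    and cases: "((\<omega>, C) \<notin> P_exc N \<and> P = mat 1 \<and> cseq.dim (form_domain N P) = N) \<or>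
     ((\<omega>, C) \<in> P5 N \<and> P \<noteq> mat 1 \<and> cseq.dim (form_domain N P) = N - 2) \<or>
     ((\<omega>, C) \<in> P_exc N - P5 N \<and> P \<noteq> mat 1 \<and> cseq.dim (form_domain N P) = N - 1)"
    by (rule problem_normal_form[OF N \<omega> C])
  have P1: "P \<noteq> mat 1" using cases p pC by auto
  define d where "d = cseq.dim (form_domain N P)"
  let ?H = "stiffness N \<omega> S" and ?W = "weight \<omega>" and ?r = "1 / f_of \<omega> 0"
  obtain y \<mu> where sb: "spectral_basis N (form_domain N P) ?H ?W d y \<mu>"
    and ex: "has_exactly N p d" and nth: "\<And>k. k < d \<Longrightarrow> nth_eigenvalue N k p = \<mu> k"
    using problem_spectrum[OF N \<omega> PS CPS C] unfolding pC d_def by metis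
  \<comment> \<open>If \<open>\<lambda>_n\<close> is undefined at \<open>p\<close>, continuity fails
    by definition; only \<open>n < d\<close> remains to be treated.\<close>
  have nd: "n < d"
    using cont num_eigenvalues_exact[OF ex]
    by (auto simp: eigenvalue_continuous_at_def topcontinuous_at_def)
  obtain c where c: "n = 0 \<or> \<mu> (n - 1) < c" "c < \<mu> n"
  proof (cases "n = 0")
    case True
    then show thesis using that[of "\<mu> n - 1"] by simp
  next
    case False
    then have "\<mu> (n - 1) \<noteq> \<mu> n" using gap num_eigenvalues_exact[OF ex] nth nd by auto
    moreover have "\<mu> (n - 1) \<le> \<mu> n" using spectral_basisD(5)[OF sb, of "n - 1" n] nd by simp
    ultimately show thesis using dense[of "\<mu> (n - 1)" "\<mu> n"] that by auto
  qed
  have H: "hermitian N ?H"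
    using PS N by (intro hermitian_stiffness) (simp_all add: normal_pair_def)
  have "adjoint_matrix (mat 1 - P) = mat 1 - P"
    using PS unfolding normal_pair_def by (simp add: mat2_eq_iff)
  then have G: "hermitian N (corner N (mat 1 - P))" by (rule hermitian_corner[OF _ N])
  obtain x0 where x0: "x0 \<in> supp_space N" "0 < Re (form N (corner N (mat 1 - P)) x0 x0)"
    by (rule corner_complement_positive[OF N PS P1])
  obtain K where K: "\<And>k d' y' \<mu>'. K \<le> k \<Longrightarrow> n < d' \<Longrightarrow>
    spectral_basis N (supp_space N) (\<lambda>i j. ?H i j - of_real k * corner N (mat 1 - P) i j) ?W d' y' \<mu>' \<Longrightarrow> \<mu>' n < c"
  proof (rule eigenvalue_drops[OF sb subspace_form_domain form_domain_subset H hermitian_weight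
        positive_weight[OF \<omega>] less_imp_le[OF nd] c(1) G corner_complement_null[OF N] x0], goal_cases)
    case 1
    from 1(2) show ?case .
  next
    case (2 K)
    from 2(2) show thesis by (rule that)
  qed
  define M where "M = (\<lambda>\<epsilon>. bmat ?r (mat 1 - P - S) (P + \<epsilon> *\<^sub>R (mat 1 - P)))"
  have M0: "C = bc_class (M 0)" using CPS by (simp add: M_def)
  have M0r: "M 0 \<in> rank2"
  proof -
    obtain X Y where XY: "C = bc_class (bmat 0 X Y)" "rank (bmat 0 X Y) = 2" using BC_bmat[OF C] by metis
    have "bc_class (M 0) = bc_class (bmat 0 X Y)" using M0 XY(1) by simp
    then obtain T where "invertible T" "M 0 = T ** bmat 0 X Y" by (rule bc_class_eqD)
    then show ?thesis using rank2_mult[OF _ XY(2)] by (simp add: rank2_def)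
  qed
  have "openin euclideanreal {c<..} \<and> nth_eigenvalue N n p \<in> {c<..}" using nth[OF nd] c(2) by simp
  with cont obtain U' where U': "openin (subtopology (SL_topology N) {p'. n < num_eigenvalues N p'}) U'"
    "p \<in> U'" "\<forall>p'\<in>U'. nth_eigenvalue N n p' \<in> {c<..}"
    unfolding eigenvalue_continuous_at_def topcontinuous_at_def by blast
  then obtain U where U: "openin (SL_topology N) U" "U' = U \<inter> {p'. n < num_eigenvalues N p'}"
    unfolding openin_subtopology by blast
  have "(\<omega>, bc_class (M 0)) \<in> U" using U'(2) U(2) pC M0 by simp
  from openin_slice[OF U(1) this] obtain B where B: "open B" "M 0 \<in> B"
    "\<And>M'. M' \<in> rank2 \<Longrightarrow> M' \<in> B \<Longrightarrow> bc_class M' \<in> BC \<Longrightarrow> (\<omega>, bc_class M') \<in> U"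
    using M0r by metis
  have "(M \<longlongrightarrow> M 0) (at_right 0)"
  proof (rule vec_tendstoI, rule vec_tendstoI)
    fix i j
    have e: "((\<lambda>\<epsilon>. (P + \<epsilon> *\<^sub>R (mat 1 - P)) $ i $ k) \<longlongrightarrow> (P + 0 *\<^sub>R (mat 1 - P)) $ i $ k) (at_right 0)" for k
      by (intro tendsto_intros)
    show "((\<lambda>\<epsilon>. M \<epsilon> $ i $ j) \<longlongrightarrow> M 0 $ i $ j) (at_right 0)"
      using exhaust_4[of j] unfolding M_def
      by (elim disjE; hypsubst; unfold bmat_nth; intro tendsto_intros e)
  qed
  then have ev1: "eventually (\<lambda>\<epsilon>. M \<epsilon> \<in> B) (at_right 0)" using B(1,2) by (rule topological_tendstoD)
  \<comment> \<open>This bound on \<open>\<epsilon>\<close> makes the penalty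
    \<open>1 / \<epsilon>\<close> exceed the threshold \<open>K\<close>; the absolute value and the
    1 keep the bound positive for every \<open>K\<close>.\<close>
  have ev2: "eventually (\<lambda>\<epsilon>. 0 < \<epsilon> \<and> \<epsilon> < 1 / (\<bar>K\<bar> + 1)) (at_right (0::real))"
    unfolding eventually_at_right_field by (intro exI[of _ "1 / (\<bar>K\<bar> + 1)"]) auto
  have "eventually (\<lambda>\<epsilon>. False) (at_right (0::real))"
    using ev1 ev2
  proof eventually_elim
    case (elim \<epsilon>)
    then have \<epsilon>: "0 < \<epsilon>" by simp
    let ?S = "S - (1 / \<epsilon>) *\<^sub>R (mat 1 - P)"
    have cls: "bc_class (M \<epsilon>) = bc_class (bmat ?r (mat 1 - mat 1 - ?S) (mat 1))"
      and BC: "bc_class (M \<epsilon>) \<in> BC" and r2: "M \<epsilon> \<in> rank2" and np: "normal_pair (mat 1) ?S"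
      unfolding M_def by (rule perturbed_normal_form[OF PS \<epsilon>])+
    obtain y' \<mu>' where sb': "spectral_basis N (supp_space N) (stiffness N \<omega> ?S) ?W N y' \<mu>'"
      and ex': "has_exactly N (\<omega>, bc_class (M \<epsilon>)) N"
      and nth': "\<And>k. k < N \<Longrightarrow> nth_eigenvalue N k (\<omega>, bc_class (M \<epsilon>)) = \<mu>' k"
      using problem_spectrum[OF N \<omega> np cls BC] unfolding form_domain_one dim_supp_space by metis
    have eq: "stiffness N \<omega> ?S = (\<lambda>i j. ?H i j - of_real (1 / \<epsilon>) * corner N (mat 1 - P) i j)"
      by (intro ext) (simp only: stiffness_def corner_combine add_diff_eq)
    have K1: "K \<le> 1 / \<epsilon>"
    proof -
      have "\<bar>K\<bar> + 1 \<le> 1 / \<epsilon>" using elim by (simp add: field_simps)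
      then show ?thesis by linarith
    qed
    have nN: "n < N" using n N by simp
    have "\<mu>' n < c" by (rule K[OF K1 nN sb'[unfolded eq]])
    moreover have "(\<omega>, bc_class (M \<epsilon>)) \<in> U'"
      using B(3)[OF r2 _ BC] elim num_eigenvalues_exact[OF ex'] nN by (simp add: U(2))
    then have "c < \<mu>' n" using U'(3) nth'[OF nN] by fastforce
    ultimately show False by simp
  qed
  then show False by (simp add: eventually_False)
qed

theorem theorem5p5:
  fixes N :: nat
  assumes "2 \<le> N"
  shows "(\<forall>p \<in> P5 N. has_exactly N p (N - 2)) \<and>
    (\<forall>p \<in> P_exc N - P5 N. has_exactly N p (N - 1)) \<and>
    (\<forall>p \<in> SL_problems N - P_exc N. has_exactly N p N) \<and>
    (\<forall>n \<le> N - 1. \<forall>p \<in> SL_problems N - P_exc N. eigenvalue_continuous_at N n p) \<and>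
    (\<forall>n \<le> N - 1. \<forall>p \<in> P_exc N.
       \<not> (0 < n \<and> n < num_eigenvalues N p \<and> nth_eigenvalue N (n - 1) p = nth_eigenvalue N n p)
       \<longrightarrow> \<not> eigenvalue_continuous_at N n p)"
  using eigenvalue_count[OF assms] eigenvalue_continuous[OF assms] eigenvalue_discontinuous[OF assms]
    P5_subset[of N] P_exc_subset[of N]
  by blast

end
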